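(* Let $L$ be any operator as described in the context, whose kernel satisfies $$0<\frac{\lambda}{|y|^{n+2s}}\le K(y)\le\frac{\Lambda}{|y|^{n+2s}}.$$ Assume that $u$ satisfies $$Lu\ge-C_0\quad\text{in }B_1$$ in the weak (or viscosity) sense, for some $C_0>0$. Assume in addition that $u\ge0$ in $\mathbb R^n$. Then $$\int_{\mathbb R^n}\frac{u(x)}{1+|x|^{n+2s}}\,dx\le C\left(\inf_{B_{1/2}}u+C_0\right).$$ The constant $C$ depends only on $n$, $s$ and the ellipticity constants $\lambda,\Lambda$.
   Context: **Operators.** $s\in(0,1)$, $0<\lambda\le\Lambda$. $K\in L^1_{\rm loc}(\mathbb R^n\setminus\{0\})$ is nonnegative and positively homogeneous of degree $-n-2s$; if $s=\frac12$, moreover $\int_{\partial B_1}y\,K(y)\,d\mathcal H^{n-1}(y)=0$, and $b\in\mathbb R^n$ satisfies $|b|\le\Lambda$. The operator is $$Lu(x)=\begin{cases}\int_{\mathbb R^n}(u(x)-u(x+y))K(y)\,dy & s\in(0,\frac12),\\ \mathrm{P.V.}\int_{\mathbb R^n}(u(x)-u(x+y))K(y)\,dy+b\cdot\nabla u(x)& s=\frac12,\\ \int_{\mathbb R^n}(u(x)-u(x+y)+\nabla u(x)\cdot y)K(y)\,dy& s\in(\frac12,1).\end{cases}$$ **Weak inequality.** $L^*$ is the operator of the same form with $K(y)$ replaced by $K(-y)$ and $b$ by $-b$. $Lu\ge-C_0$ in $B_1$ in the weak sense means $\int_{\mathbb R^n}u\,L^*\eta\,dx\ge-C_0\int_{B_1}\eta\,dx$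 for every $\eta\in C_c^\infty(B_1)$ with $\eta\ge0$. $B_r$ is the ball of radius $r$ centered at $0$. *)

theory Defs
  imports "HOL-Analysis.Analysis"
begin

subsection \<open>Hausdorff measure\<close>

text \<open>Empty sets in a covering contribute 0; this matters for \<open>d = 0\<close>, where \<open>0 ^ 0 = 1\<close> makes
  every nonempty set of diameter 0 contribute 1, so that the 0-dimensional measure is the
  counting measure.\<close>

definition hausdorff_content :: "nat \<Rightarrow> real \<Rightarrow> 'a::euclidean_space set \<Rightarrow> ennreal" where
  "hausdorff_content d \<delta> A =
     (INF U \<in> {U :: nat \<Rightarrow> 'a set. A \<subseteq> (\<Union>i. U i) \<and> (\<forall>i. bounded (U i) \<and> diameter (U i) \<le> \<delta>)}.
        \<Sum>i. if U i = {} then 0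
             else ennreal (unit_ball_vol (real d) * (diameter (U i) / 2) ^ d))"

definition hausdorff_outer :: "nat \<Rightarrow> 'a::euclidean_space set \<Rightarrow> ennreal" where
  "hausdorff_outer d A = (SUP \<delta> \<in> {0<..}. hausdorff_content d \<delta> A)"

text \<open>The measure lives on the Caratheodory-measurable sets, so it is complete.\<close>

definition hausdorff_measure :: "nat \<Rightarrow> 'a::euclidean_space measure" where
  "hausdorff_measure d =
     measure_of UNIV (lambda_system UNIV (Pow UNIV) (hausdorff_outer d)) (hausdorff_outer d)"


subsection \<open>Regularity classes and gradients\<close>

text \<open>\<open>C\<^sup>k\<close> regularity on an open set \<open>S\<close>; the witness \<open>g\<close> is the gradient of \<open>f\<close> on \<open>S\<close>.\<close>

primrec Ck_on :: "nat \<Rightarrow> 'a::euclidean_space set \<Rightarrow> ('a \<Rightarrow> real) \<Rightarrow> bool" where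
  "Ck_on 0 S f \<longleftrightarrow> continuous_on S f"
| "Ck_on (Suc k) S f \<longleftrightarrow>
     (\<exists>g :: 'a \<Rightarrow> 'a. (\<forall>x\<in>S. (f has_derivative (\<lambda>h. g x \<bullet> h)) (at x)) \<and>
                     (\<forall>i\<in>Basis. Ck_on k S (\<lambda>x. g x \<bullet> i)))"

definition smooth_compact_support :: "'a::euclidean_space set \<Rightarrow> ('a \<Rightarrow> real) \<Rightarrow> bool" where
  "smooth_compact_support S \<eta> \<longleftrightarrow>
     (\<forall>k. Ck_on k UNIV \<eta>) \<and> compact (closure {x. \<eta> x \<noteq> 0}) \<and> closure {x. \<eta> x \<noteq> 0} \<subseteq> S"

definition grad :: "('a::euclidean_space \<Rightarrow> real) \<Rightarrow> 'a \<Rightarrow> 'a" where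
  "grad f x = (\<Sum>i\<in>Basis. frechet_derivative f (at x) i *\<^sub>R i)"

definition lower_semicontinuous_on :: "'a::topological_space set \<Rightarrow> ('a \<Rightarrow> real) \<Rightarrow> bool" where
  "lower_semicontinuous_on S u \<longleftrightarrow>
     (\<forall>x\<in>S. \<forall>c<u x. eventually (\<lambda>z. c < u z) (at x within S))"


subsection \<open>The operators\<close>

text \<open>In the cancellation condition the integrability contained in \<open>has_bochner_integral\<close> is
  automatic from local integrability and homogeneity. Local integrability on \<open>- {0}\<close> includes
  Lebesgue measurability.\<close>

definition admissible_kernel :: "real \<Rightarrow> ('a::euclidean_space \<Rightarrow> real) \<Rightarrow> bool" where
  "admissible_kernel s K \<longleftrightarrow>
     (\<forall>A. compact A \<and> A \<subseteq> - {0} \<longrightarrow> set_integrable lebesgue A K) \<and>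
     (\<forall>y. y \<noteq> 0 \<longrightarrow> 0 \<le> K y) \<and>
     (\<forall>t>0. \<forall>y. y \<noteq> 0 \<longrightarrow> K (t *\<^sub>R y) = t powr (- real DIM('a) - 2 * s) * K y) \<and>
     (s = 1 / 2 \<longrightarrow>
        has_bochner_integral (hausdorff_measure (DIM('a) - 1))
          (\<lambda>y. indicator (sphere 0 1) y *\<^sub>R (K y *\<^sub>R y)) (0 :: 'a))"

text \<open>The vector \<open>b\<close> only enters for \<open>s = 1/2\<close>.\<close>

definition nonlocal_op ::
  "real \<Rightarrow> ('a::euclidean_space \<Rightarrow> real) \<Rightarrow> 'a \<Rightarrow> ('a \<Rightarrow> real) \<Rightarrow> 'a \<Rightarrow> real" where
  "nonlocal_op s K b u x =
     (if s < 1 / 2 then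
        LINT y|lebesgue. (u x - u (x + y)) * K y
      else if s = 1 / 2 then
        Lim (at_right 0) (\<lambda>\<epsilon>. LINT y : - ball 0 \<epsilon> | lebesgue. (u x - u (x + y)) * K y)
          + b \<bullet> grad u x
      else
        LINT y|lebesgue. (u x - u (x + y) + grad u x \<bullet> y) * K y)"

definition dual_op ::
  "real \<Rightarrow> ('a::euclidean_space \<Rightarrow> real) \<Rightarrow> 'a \<Rightarrow> ('a \<Rightarrow> real) \<Rightarrow> 'a \<Rightarrow> real" where
  "dual_op s K b = nonlocal_op s (\<lambda>y. K (- y)) (- b)"


subsection \<open>Supersolutions\<close>

text \<open>\<open>L u \<ge> -C\<^sub>0\<close> in \<open>\<Omega>\<close>. Integrability of \<open>u L\<^sup>*\<eta>\<close> is required explicitly because the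
  Bochner integral of a non-integrable function is 0 by convention.\<close>

definition weak_supersolution ::
  "real \<Rightarrow> ('a::euclidean_space \<Rightarrow> real) \<Rightarrow> 'a \<Rightarrow> real \<Rightarrow> 'a set \<Rightarrow> ('a \<Rightarrow> real) \<Rightarrow> bool" where
  "weak_supersolution s K b C0 \<Omega> u \<longleftrightarrow>
     u \<in> borel_measurable lebesgue \<and>
     (\<forall>\<eta>. smooth_compact_support \<Omega> \<eta> \<and> (\<forall>x. 0 \<le> \<eta> x) \<longrightarrow>
        integrable lebesgue (\<lambda>x. u x * dual_op s K b \<eta> x) \<and>
        (LINT x|lebesgue. u x * dual_op s K b \<eta> x) \<ge> - C0 * (LINT x:\<Omega>|lebesgue. \<eta> x))"

text \<open>The test functions \<open>\<phi>\<close> are \<open>C\<^sup>2\<close> near the contact point and in the weighted \<open>L\<^sup>1\<close> space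
  which makes \<open>L \<phi>\<close> well defined there.\<close>

definition viscosity_supersolution ::
  "real \<Rightarrow> ('a::euclidean_space \<Rightarrow> real) \<Rightarrow> 'a \<Rightarrow> real \<Rightarrow> 'a set \<Rightarrow> ('a \<Rightarrow> real) \<Rightarrow> bool" where
  "viscosity_supersolution s K b C0 \<Omega> u \<longleftrightarrow>
     u \<in> borel_measurable lebesgue \<and> lower_semicontinuous_on \<Omega> u \<and>
     (\<forall>x\<in>\<Omega>. \<forall>N \<phi>. open N \<and> x \<in> N \<and> N \<subseteq> \<Omega> \<and> Ck_on 2 N \<phi> \<and>
        integrable lebesgue (\<lambda>y. \<phi> y / (1 + norm y powr (real DIM('a) + 2 * s))) \<and>
        \<phi> x = u x \<and> (\<forall>y. \<phi> y \<le> u y) \<longrightarrow>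
        nonlocal_op s K b \<phi> x \<ge> - C0)"

text \<open>Essential infimum of a function that is bounded below on the non-null set \<open>A\<close>; this is the
  meaning of \<open>inf\<close> for weak supersolutions, which are only determined almost everywhere.\<close>

definition ess_inf_on :: "'a::euclidean_space set \<Rightarrow> ('a \<Rightarrow> real) \<Rightarrow> real" where
  "ess_inf_on A u = Sup {c. AE x in lebesgue. x \<in> A \<longrightarrow> c \<le> u x}"

end

theory Submission
  imports Defs
begin

text \<open>Let \<open>m\<close> exceed the infimum of \<open>u\<close> over \<open>B\<^bsub>1/2\<^esub>\<close>. A downward translate of the paraboloid
  \<open>t (9/16 - |x|\<^sup>2)\<close> with \<open>t = 16 m / 5\<close> touches \<open>u\<close> from below at a point \<open>x\<^sub>0\<close> of \<open>B\<^bsub>3/4\<^esub>\<close>. Evaluating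
  \<open>L u \<ge> - C\<^sub>0\<close> at \<open>x\<^sub>0\<close>, the paraboloid contributes at most a multiple of \<open>t\<close>, while the nonnegative
  difference contributes \<open>- \<integral> (u - paraboloid)(x\<^sub>0 + y) K(y) dy\<close>; the lower bound on \<open>K\<close> turns this
  into the weighted integral of \<open>u\<close>. A viscosity supersolution admits the paraboloid glued to
  truncations of \<open>u\<close> as test functions. A weak supersolution is mollified: testing with a translate
  of the mollifier evaluates the operator on \<open>u * \<rho>\<close> at the contact point, and the weighted integrals
  of \<open>u\<close> and \<open>u * \<rho>\<close> are comparable because the weight varies by a bounded factor on unit balls.
  For \<open>s = 1/2\<close> the principal value exists because the Hausdorff measure on the sphere is a
  multiple of the radial projection of Lebesgue measure, so \<open>y K(y)\<close> has integral 0 over annuli.\<close>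

subsection \<open>Hausdorff measure\<close>

text \<open>Both notions of supersolution are funnelled into one estimate,
  \<open>core_estimate\<close>, about the truncated operator at a contact point. Its constants do
  not depend on the truncation radius r, so no regularity is asked at that point: what the
  truncation omits near the origin is an error of order \<open>r powr \<kappa>\<close> with \<kappa>
  > 0, and Fatou's lemma lets r tend to 0. For s > 1/2 the truncated drift may blow up in this
  limit; it is therefore carried at radius 1, and the first moment of K over the annulus in between
  supplies the gradient term of the Taylor remainder. In the weak case the mollification radius is
  never sent to 0. It is chosen once, from the level m, so that the mollified function still falls
  below m somewhere in the half ball; returning to u costs the factor 1 + 2^N, whatever the radius.
  Mollifying presupposes that the weighted integral of u is finite. This comes from the
  integrability demanded in \<open>weak_supersolution\<close>: away from the support of a bump,
  minus the dual operator is bounded below by a multiple of \<open>1 / wt\<close>, and every point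
  is away from one of two disjoint bumps.\<close>

text \<open>Charging infinity for unbounded or too wide sets turns the constrained infimum of
  \<open>hausdorff_content\<close> into an unconstrained \<open>outer_measure\<close>. Boundedness
  is asked separately because the real supremum behind \<open>diameter\<close> carries no
  information on an unbounded set.\<close>

definition hausdorff_gauge :: "nat \<Rightarrow> real \<Rightarrow> 'a::euclidean_space set \<Rightarrow> ennreal" where
  "hausdorff_gauge d \<delta> U =
     (if U = {} then 0
      else if bounded U \<and> diameter U \<le> \<delta>
      then ennreal (unit_ball_vol (real d) * (diameter U / 2) ^ d) else \<infinity>)"

lemma hausdorff_gauge_mono:
  assumes "U \<subseteq> V" shows "hausdorff_gauge d \<delta> U \<le> hausdorff_gauge d \<delta> V"
proof (cases "U \<noteq> {} \<and> bounded V \<and> diameter V \<le> \<delta>")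
  case True
  then have "bounded U" "diameter U \<le> diameter V" "0 \<le> diameter U" "V \<noteq> {}"
    using assms bounded_subset diameter_subset diameter_ge_0 by blast+
  then show ?thesis
    using True assms
    by (auto simp: hausdorff_gauge_def intro!: ennreal_leI mult_left_mono power_mono)
qed (use assms in \<open>auto simp: hausdorff_gauge_def\<close>)

lemma positive_hausdorff_gauge: "positive M (hausdorff_gauge d \<delta>)"
  by (simp add: positive_def hausdorff_gauge_def)

lemma increasing_hausdorff_gauge: "increasing M (hausdorff_gauge d \<delta>)"
  by (simp add: increasing_def hausdorff_gauge_mono)

lemma hausdorff_content_eq_outer_measure:
  assumes "0 \<le> \<delta>"
  shows "hausdorff_content d \<delta> = outer_measure (Pow UNIV) (hausdorff_gauge d \<delta>)"
proof (rule ext, rule antisym)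
  fix A :: "'a set"
  show "hausdorff_content d \<delta> A \<le> outer_measure (Pow UNIV) (hausdorff_gauge d \<delta>) A"
    unfolding outer_measure_def
  proof (rule INF_greatest, clarify)
    fix U :: "nat \<Rightarrow> 'a set"
    assume U: "A \<subseteq> (\<Union>i. U i)"
    show "hausdorff_content d \<delta> A \<le> (\<Sum>i. hausdorff_gauge d \<delta> (U i))"
    proof (cases "\<forall>i. bounded (U i) \<and> diameter (U i) \<le> \<delta>")
      case True
      then show ?thesis using U
        unfolding hausdorff_content_def hausdorff_gauge_def
        by (intro INF_lower2[of U] suminf_le) auto
    next
      case False
      then obtain i where "\<not> (bounded (U i) \<and> diameter (U i) \<le> \<delta>)" by blast
      \<comment> \<open>Such a \<open>U i\<close> is nonempty, since the empty set is bounded with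
        diameter 0 \<le> \<delta>; this is where the sign of \<delta> enters.\<close>
      then have "hausdorff_gauge d \<delta> (U i) = \<infinity>"
        using assms by (auto simp: hausdorff_gauge_def)
      moreover have "hausdorff_gauge d \<delta> (U i) \<le> (\<Sum>i. hausdorff_gauge d \<delta> (U i))"
        using sum_le_suminf[of "\<lambda>i. hausdorff_gauge d \<delta> (U i)" "{i}"] by simp
      ultimately show ?thesis by (simp add: top_unique)
    qed
  qed
  show "outer_measure (Pow UNIV) (hausdorff_gauge d \<delta>) A \<le> hausdorff_content d \<delta> A"
    unfolding hausdorff_content_def
  proof (rule INF_greatest, clarify)
    fix U :: "nat \<Rightarrow> 'a set"
    assume U: "A \<subseteq> (\<Union>i. U i)" and b: "\<forall>i. bounded (U i) \<and> diameter (U i) \<le> \<delta>"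
    interpret ring_of_sets UNIV "Pow UNIV :: 'a set set"
      by (meson algebra.axioms(1) algebra_Pow)
    have "outer_measure (Pow UNIV) (hausdorff_gauge d \<delta>) A \<le> (\<Sum>i. hausdorff_gauge d \<delta> (U i))"
      using U by (intro outer_measure_le positive_hausdorff_gauge increasing_hausdorff_gauge) auto
    also have "\<dots> = (\<Sum>i. if U i = {} then 0 else ennreal (unit_ball_vol (real d) * (diameter (U i) / 2) ^ d))"
      using b by (auto simp: hausdorff_gauge_def intro!: suminf_cong)
    finally show "outer_measure (Pow UNIV) (hausdorff_gauge d \<delta>) A \<le> \<dots>" .
  qed
qed

lemma outer_measure_space_hausdorff_content:
  assumes "0 \<le> \<delta>"
  shows "outer_measure_space (Pow UNIV) (hausdorff_content d \<delta> :: 'a::euclidean_space set \<Rightarrow> _)"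
proof -
  interpret ring_of_sets UNIV "Pow UNIV :: 'a set set"
    by (meson algebra.axioms(1) algebra_Pow)
  show ?thesis
    unfolding hausdorff_content_eq_outer_measure[OF assms]
    using outer_measure_space_outer_measure[OF positive_hausdorff_gauge increasing_hausdorff_gauge]
    by simp
qed

lemma hausdorff_content_antimono:
  "\<delta> \<le> \<epsilon> \<Longrightarrow> hausdorff_content d \<epsilon> A \<le> hausdorff_content d \<delta> A"
  unfolding hausdorff_content_def by (rule INF_superset_mono) (auto intro: order_trans)

text \<open>The axioms of an outer measure survive a supremum over scales; for subadditivity, each
  summand is enlarged to its supremum before the supremum is taken on the left.\<close>

lemma outer_measure_space_hausdorff_outer:
  "outer_measure_space (Pow UNIV) (hausdorff_outer d :: 'a::euclidean_space set \<Rightarrow> _)"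
  unfolding outer_measure_space_def
proof (intro conjI)
  have c: "positive (Pow UNIV) (hausdorff_content d \<delta> :: 'a set \<Rightarrow> _)"
      "increasing (Pow UNIV) (hausdorff_content d \<delta> :: 'a set \<Rightarrow> _)"
      "countably_subadditive (Pow UNIV) (hausdorff_content d \<delta> :: 'a set \<Rightarrow> _)"
    if "0 < \<delta>" for \<delta>
    using outer_measure_space_hausdorff_content[of \<delta> d] that
    unfolding outer_measure_space_def by auto
  have "hausdorff_outer d ({} :: 'a set) \<le> 0"
    unfolding hausdorff_outer_def
  proof (rule SUP_least)
    fix \<delta> :: real assume "\<delta> \<in> {0<..}"
    then show "hausdorff_content d \<delta> ({} :: 'a set) \<le> 0" using c(1)[of \<delta>] by (simp add: positive_def)
  qed
  then show "positive (Pow UNIV) (hausdorff_outer d :: 'a set \<Rightarrow> _)"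
    by (simp add: positive_def)
  show "increasing (Pow UNIV) (hausdorff_outer d :: 'a set \<Rightarrow> _)"
    unfolding increasing_def hausdorff_outer_def
  proof (intro ballI impI SUP_mono)
    fix A B :: "'a set" and \<delta> :: real assume "A \<subseteq> B" "\<delta> \<in> {0<..}"
    then show "\<exists>m\<in>{0<..}. hausdorff_content d \<delta> A \<le> hausdorff_content d m B"
      using c(2)[of \<delta>] unfolding increasing_def by (intro bexI[of _ \<delta>]) auto
  qed
  show "countably_subadditive (Pow UNIV) (hausdorff_outer d :: 'a set \<Rightarrow> _)"
    unfolding countably_subadditive_def
  proof clarify
    fix A :: "nat \<Rightarrow> 'a set" assume dj: "disjoint_family A"
    show "hausdorff_outer d (\<Union>i. A i) \<le> (\<Sum>i. hausdorff_outer d (A i))"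
      unfolding hausdorff_outer_def
    proof (rule SUP_least)
      fix \<delta> :: real assume "\<delta> \<in> {0<..}"
      then have "hausdorff_content d \<delta> (\<Union>i. A i) \<le> (\<Sum>i. hausdorff_content d \<delta> (A i))"
        using c(3)[of \<delta>] dj unfolding countably_subadditive_def by auto
      also have "\<dots> \<le> (\<Sum>i. SUP \<delta>\<in>{0<..}. hausdorff_content d \<delta> (A i))"
        using \<open>\<delta> \<in> {0<..}\<close> by (intro suminf_le SUP_upper) auto
      finally show "hausdorff_content d \<delta> (\<Union>i. A i) \<le> (\<Sum>i. SUP \<delta>\<in>{0<..}. hausdorff_content d \<delta> (A i))" .
    qed
  qed
qed

lemma hausdorff_measure_space:
  "measure_space UNIV (lambda_system UNIV (Pow UNIV) (hausdorff_outer d :: 'a::euclidean_space set \<Rightarrow> _)) (hausdorff_outer d)"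
  using sigma_algebra.caratheodory_lemma[OF sigma_algebra_Pow outer_measure_space_hausdorff_outer] .

lemma space_hausdorff_measure [simp]: "space (hausdorff_measure d) = UNIV"
  by (simp add: hausdorff_measure_def)

lemma sets_hausdorff_measure:
  "sets (hausdorff_measure d) = lambda_system UNIV (Pow UNIV) (hausdorff_outer d)"
  using hausdorff_measure_space[of d] unfolding hausdorff_measure_def measure_space_def
  by (metis sigma_algebra.sets_measure_of_eq)

lemma emeasure_hausdorff_measure:
  "A \<in> sets (hausdorff_measure d) \<Longrightarrow> emeasure (hausdorff_measure d) A = hausdorff_outer d A"
  using hausdorff_measure_space[of d] unfolding sets_hausdorff_measure measure_space_def
  unfolding hausdorff_measure_def by (metis emeasure_measure_of_sigma)

lemma hausdorff_outer_mono: "A \<subseteq> B \<Longrightarrow> hausdorff_outer d A \<le> hausdorff_outer d B"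
  using outer_measure_space_hausdorff_outer[of d] by (auto simp: outer_measure_space_def increasing_def)

lemma hausdorff_outer_empty [simp]: "hausdorff_outer d {} = 0"
  using outer_measure_space_hausdorff_outer[of d] by (auto simp: outer_measure_space_def positive_def)

lemma hausdorff_outer_Un_le:
  "hausdorff_outer d (A \<union> B) \<le> hausdorff_outer d A + hausdorff_outer d B"
proof -
  have "subadditive (Pow UNIV) (hausdorff_outer d :: 'a set \<Rightarrow> _)"
    using outer_measure_space_hausdorff_outer[of d] ring_of_sets.countably_subadditive_subadditive
    by (metis algebra.axioms(1) algebra_Pow outer_measure_space_def)
  then have "A \<inter> (B - A) = {} \<Longrightarrow> hausdorff_outer d (A \<union> (B - A)) \<le> hausdorff_outer d A + hausdorff_outer d (B - A)"
    unfolding subadditive_def by blast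
  then have "hausdorff_outer d (A \<union> B) \<le> hausdorff_outer d A + hausdorff_outer d (B - A)" by simp
  also have "\<dots> \<le> hausdorff_outer d A + hausdorff_outer d B"
    by (intro add_left_mono hausdorff_outer_mono) auto
  finally show ?thesis .
qed

text \<open>\<open>countably_subadditive\<close> speaks of disjoint families only; passing to
  \<open>disjointed\<close> and using monotonicity removes the restriction.\<close>

lemma hausdorff_outer_UN_le:
  "hausdorff_outer d (\<Union>i::nat. A i) \<le> (\<Sum>i. hausdorff_outer d (A i))"
proof -
  have "hausdorff_outer d (\<Union>i::nat. disjointed A i) \<le> (\<Sum>i. hausdorff_outer d (disjointed A i))"
    using outer_measure_space_hausdorff_outer[of d]
    unfolding outer_measure_space_def countably_subadditive_def
    by (metis Pow_UNIV disjoint_family_disjointed subset_UNIV UNIV_I)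
  also have "\<dots> \<le> (\<Sum>i. hausdorff_outer d (A i))"
    by (intro suminf_le hausdorff_outer_mono disjointed_subset) auto
  finally show ?thesis by (simp add: UN_disjointed_eq)
qed

text \<open>A covering set of diameter below the gap \<open>e\<close> meets at most one of
  \<open>A\<close> and \<open>B\<close>, so every fine cover of the union splits into a cover of
  each without extra cost.\<close>

lemma hausdorff_outer_Un_separated:
  fixes A B :: "'a::euclidean_space set"
  assumes "0 < e" and sep: "\<And>x y. x \<in> A \<Longrightarrow> y \<in> B \<Longrightarrow> e \<le> dist x y"
  shows "hausdorff_outer d A + hausdorff_outer d B \<le> hausdorff_outer d (A \<union> B)"
proof -
  have content: "hausdorff_content d \<delta> A + hausdorff_content d \<delta> B \<le> hausdorff_outer d (A \<union> B)"
    if \<delta>: "0 < \<delta>" "\<delta> < e" for \<delta>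
  proof -
    have "hausdorff_content d \<delta> A + hausdorff_content d \<delta> B \<le> hausdorff_content d \<delta> (A \<union> B)"
      unfolding hausdorff_content_def[of d \<delta> "A \<union> B"]
    proof (rule INF_greatest, clarify)
      fix U :: "nat \<Rightarrow> 'a set"
      assume U: "A \<union> B \<subseteq> (\<Union>i. U i)" and b: "\<forall>i. bounded (U i) \<and> diameter (U i) \<le> \<delta>"
      define c where "c = (\<lambda>V::'a set. if V = {} then 0 else ennreal (unit_ball_vol (real d) * (diameter V / 2) ^ d))"
      define UA where "UA i = (if U i \<inter> A = {} then {} else U i)" for i
      define UB where "UB i = (if U i \<inter> B = {} then {} else U i)" for i
      have disj: "UA i = {} \<or> UB i = {}" for i
      proof (rule ccontr)
        assume "\<not> ?thesis"
        then obtain x y where xy: "x \<in> U i" "x \<in> A" "y \<in> U i" "y \<in> B"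
          by (auto simp: UA_def UB_def split: if_splits)
        then have "dist x y \<le> diameter (U i)" using diameter_bounded_bound b by blast
        then show False using b[rule_format, of i] sep[OF xy(2,4)] \<delta> by linarith
      qed
      have "hausdorff_content d \<delta> A \<le> (\<Sum>i. c (UA i))"
        unfolding hausdorff_content_def c_def using U b \<delta>
        by (intro INF_lower2[of UA]) (fastforce simp: UA_def)+
      moreover have "hausdorff_content d \<delta> B \<le> (\<Sum>i. c (UB i))"
        unfolding hausdorff_content_def c_def using U b \<delta>
        by (intro INF_lower2[of UB]) (fastforce simp: UB_def)+
      ultimately have "hausdorff_content d \<delta> A + hausdorff_content d \<delta> B \<le> (\<Sum>i. c (UA i) + c (UB i))"
        by (subst suminf_add[symmetric]) (auto intro: add_mono)
      also have "\<dots> \<le> (\<Sum>i. c (U i))"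
      proof (intro suminf_le)
        show "c (UA i) + c (UB i) \<le> c (U i)" for i
          using disj[of i] unfolding c_def by (cases "U i = {}") (auto simp: UA_def UB_def split: if_splits)
      qed auto
      finally show "hausdorff_content d \<delta> A + hausdorff_content d \<delta> B
         \<le> (\<Sum>i. if U i = {} then 0 else ennreal (unit_ball_vol (real d) * (diameter (U i) / 2) ^ d))"
        by (simp add: c_def)
    qed
    also have "\<dots> \<le> hausdorff_outer d (A \<union> B)"
      unfolding hausdorff_outer_def using \<delta> by (intro SUP_upper) auto
    finally show ?thesis .
  qed
  \<comment> \<open>The supremum over all scales is the limit along one sequence, so a sum of two
    suprema becomes a single limit. The 2 in the denominator keeps every scale below
    \<open>e\<close>.\<close>
  have lim: "(\<lambda>n. hausdorff_content d (e / (2 + real n)) S) \<longlonglongrightarrow> hausdorff_outer d S" for S :: "'a set"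
  proof -
    have "hausdorff_outer d S = (SUP n. hausdorff_content d (e / (2 + real n)) S)"
      unfolding hausdorff_outer_def
    proof (rule antisym)
      show "(SUP \<delta>\<in>{0<..}. hausdorff_content d \<delta> S) \<le> (SUP n. hausdorff_content d (e / (2 + real n)) S)"
      proof (rule SUP_least)
        fix \<delta> :: real assume "\<delta> \<in> {0<..}"
        then obtain n :: nat where "e / \<delta> < real n" "0 < \<delta>" using reals_Archimedean2 by auto
        then have "e / (2 + real n) \<le> \<delta>" using assms by (simp add: field_simps)
        then show "hausdorff_content d \<delta> S \<le> (SUP n. hausdorff_content d (e / (2 + real n)) S)"
          by (meson SUP_upper2 UNIV_I hausdorff_content_antimono)
      qed
      show "(SUP n. hausdorff_content d (e / (2 + real n)) S) \<le> (SUP \<delta>\<in>{0<..}. hausdorff_content d \<delta> S)"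
        using assms by (intro SUP_least SUP_upper) auto
    qed
    moreover have "incseq (\<lambda>n. hausdorff_content d (e / (2 + real n)) S)"
      using assms by (auto simp: incseq_def intro!: hausdorff_content_antimono divide_left_mono)
    ultimately show ?thesis using LIMSEQ_SUP by metis
  qed
  have "(\<lambda>n. hausdorff_content d (e / (2 + real n)) A + hausdorff_content d (e / (2 + real n)) B)
     \<longlonglongrightarrow> hausdorff_outer d A + hausdorff_outer d B"
    by (intro tendsto_intros lim)
  then show ?thesis
  proof (rule LIMSEQ_le_const2, intro exI allI impI)
    fix n :: nat
    have "0 < e / (2 + real n)" "e / (2 + real n) < e" using \<open>0 < e\<close> by (auto simp: field_simps add_pos_nonneg)
    then show "hausdorff_content d (e / (2 + real n)) A + hausdorff_content d (e / (2 + real n)) B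
        \<le> hausdorff_outer d (A \<union> B)" by (rule content)
  qed
qed

text \<open>Caratheodory's criterion: the distance shells around \<open>C\<close> with indices of equal parity are
  mutually separated, so their outer measures have a finite sum and the tails tend to 0.\<close>

lemma closed_in_sets_hausdorff_measure:
  fixes C :: "'a::euclidean_space set"
  assumes "closed C"
  shows "C \<in> sets (hausdorff_measure d)"
proof -
  let ?H = "hausdorff_outer d :: 'a set \<Rightarrow> _"
  have key: "?H (T \<inter> C) + ?H (T - C) \<le> ?H T" if ne: "C \<noteq> {}" and fin: "?H T < \<infinity>" for T
  proof -
    define D where "D k = {x \<in> T. 1 / real (Suc k) \<le> infdist x C}" for k
    define R where "R k = {x \<in> T. 1 / real (Suc (Suc k)) \<le> infdist x C \<and> infdist x C < 1 / real (Suc k)}" for k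
    have H_D: "?H (T \<inter> C) + ?H (D k) \<le> ?H T" for k
    proof -
      have "?H (T \<inter> C) + ?H (D k) \<le> ?H ((T \<inter> C) \<union> D k)"
      proof (rule hausdorff_outer_Un_separated[of "1 / real (Suc k)"])
        fix x y assume "x \<in> T \<inter> C" "y \<in> D k"
        then show "1 / real (Suc k) \<le> dist x y"
          using infdist_le[of x C y] by (auto simp: D_def dist_commute)
      qed simp
      also have "\<dots> \<le> ?H T" by (rule hausdorff_outer_mono) (auto simp: D_def)
      finally show ?thesis .
    qed
    \<comment> \<open>The gap is 0 for adjacent shells \<open>k = j + 1\<close>, hence the split by
      parity.\<close>
    have Rsep: "1 / real (Suc (Suc j)) - 1 / real (Suc k) \<le> dist x y"
      if "x \<in> R j" "y \<in> R k" "j < k" for j k x y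
      using that infdist_triangle[of x C y] by (auto simp: R_def)
    have parity: "(\<Sum>i<m. ?H (R (2 * i + p))) \<le> ?H T" for m p
    proof -
      have "(\<Sum>i<m. ?H (R (2 * i + p))) \<le> ?H (\<Union>i<m. R (2 * i + p))"
      proof (induction m)
        case (Suc m)
        have "(\<Sum>i<Suc m. ?H (R (2 * i + p))) \<le> ?H (\<Union>i<m. R (2 * i + p)) + ?H (R (2 * m + p))"
          using Suc by (simp add: add_right_mono)
        also have "\<dots> \<le> ?H ((\<Union>i<m. R (2 * i + p)) \<union> R (2 * m + p))"
        proof (rule hausdorff_outer_Un_separated)
          \<comment> \<open>For \<open>m = 0\<close> the left union is empty and any positive gap
            serves; the general formula would be negative at \<open>m = p = 0\<close>, where
            \<open>1 / 0 = 0\<close>.\<close>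
          have "0 < 1 / real (2 * m + p) - 1 / real (Suc (2 * m + p)) \<or> m = 0"
            by (auto simp: field_simps)
          then show "0 < (if m = 0 then 1 else 1 / real (2 * m + p) - 1 / real (Suc (2 * m + p)))" by auto
          fix x y assume "x \<in> (\<Union>i<m. R (2 * i + p))" "y \<in> R (2 * m + p)"
          then obtain i where i: "i < m" "x \<in> R (2 * i + p)" "y \<in> R (2 * m + p)" by auto
          have "1 / real (2 * m + p) \<le> 1 / real (Suc (Suc (2 * i + p)))"
            using i(1) by (intro divide_left_mono) auto
          then show "(if m = 0 then 1 else 1 / real (2 * m + p) - 1 / real (Suc (2 * m + p))) \<le> dist x y"
            using Rsep[OF i(2,3)] i(1) by auto
        qed
        finally show ?case by (simp add: lessThan_Suc Un_commute)
      qed simp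
      also have "\<dots> \<le> ?H T" by (rule hausdorff_outer_mono) (auto simp: R_def)
      finally show ?thesis .
    qed
    have total: "(\<Sum>i<m. ?H (R i)) \<le> ?H T + ?H T" for m
    proof -
      have "(\<Sum>i<m. ?H (R i)) \<le> (\<Sum>i<2 * m. ?H (R i))"
        by (rule sum_mono2) auto
      also have "\<dots> = (\<Sum>i<m. ?H (R (2 * i + 0))) + (\<Sum>i<m. ?H (R (2 * i + 1)))"
        by (induction m) (simp_all add: algebra_simps)
      also have "\<dots> \<le> ?H T + ?H T" by (intro add_mono parity)
      finally show ?thesis .
    qed
    have sumR: "(\<Sum>i. ?H (R i)) \<noteq> top"
    proof -
      have "(\<Sum>i. ?H (R i)) \<le> ?H T + ?H T"
        by (intro suminf_le_const total) auto
      then show ?thesis using fin by (auto simp: top_unique)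
    qed
    have tail: "(\<lambda>k. \<Sum>i. ?H (R (i + k))) \<longlonglongrightarrow> 0"
    proof -
      have "(\<Sum>i. ?H (R (i + k))) = (\<Sum>i. ?H (R i)) - (\<Sum>i<k. ?H (R i))" for k
      proof -
        have "(\<Sum>i. ?H (R i)) = (\<Sum>i. ?H (R (i + k))) + (\<Sum>i<k. ?H (R i))"
          by (rule suminf_offset) auto
        moreover have "(\<Sum>i<k. ?H (R i)) \<noteq> top"
          using total[of k] fin
          by (metis ennreal_add_less_top infinity_ennreal_def less_irrefl order.strict_trans1)
        ultimately show ?thesis by simp
      qed
      moreover have "(\<lambda>k. (\<Sum>i. ?H (R i)) - (\<Sum>i<k. ?H (R i))) \<longlonglongrightarrow> (\<Sum>i. ?H (R i)) - (\<Sum>i. ?H (R i))"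
        by (intro tendsto_diff_ennreal tendsto_const summable_LIMSEQ) (use sumR in auto)
      ultimately show ?thesis using sumR by (simp add: less_top)
    qed
    have cover: "T - C \<subseteq> D k \<union> (\<Union>i. R (i + k))" for k
    proof
      fix x assume x: "x \<in> T - C"
      then have "infdist x C > 0"
        using assms ne in_closed_iff_infdist_zero[of C x] infdist_nonneg[of x C] by auto
      then obtain n where n: "1 / real (Suc n) < infdist x C"
        using nat_approx_posE by blast
      show "x \<in> D k \<union> (\<Union>i. R (i + k))"
      proof (cases "1 / real (Suc k) \<le> infdist x C")
        case False
        define j where "j = (LEAST j. 1 / real (Suc j) \<le> infdist x C)"
        have j: "1 / real (Suc j) \<le> infdist x C" unfolding j_def by (rule LeastI[of _ n]) (use n in auto)
        have "k < j"
        proof (rule ccontr)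
          assume "\<not> k < j"
          then have "1 / real (Suc k) \<le> 1 / real (Suc j)" by (intro divide_left_mono) auto
          then show False using j False by auto
        qed
        then obtain i where i: "j = Suc (i + k)" by (metis add.commute less_iff_Suc_add)
        have "\<not> 1 / real (Suc (i + k)) \<le> infdist x C"
          using not_less_Least[of "i + k" "\<lambda>j. 1 / real (Suc j) \<le> infdist x C"] i unfolding j_def[symmetric] by simp
        then have "x \<in> R (i + k)" using j i x by (auto simp: R_def)
        then show ?thesis by blast
      qed (use x in \<open>auto simp: D_def\<close>)
    qed
    have "?H (T \<inter> C) + ?H (T - C) \<le> ?H T + (\<Sum>i. ?H (R (i + k)))" for k
    proof -
      have "?H (T - C) \<le> ?H (D k) + ?H (\<Union>i. R (i + k))"
        using hausdorff_outer_mono[OF cover[of k]] hausdorff_outer_Un_le order_trans by blast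
      also have "\<dots> \<le> ?H (D k) + (\<Sum>i. ?H (R (i + k)))"
        by (intro add_left_mono hausdorff_outer_UN_le)
      finally have "?H (T \<inter> C) + ?H (T - C) \<le> (?H (T \<inter> C) + ?H (D k)) + (\<Sum>i. ?H (R (i + k)))"
        by (simp add: add_left_mono add.assoc)
      also have "\<dots> \<le> ?H T + (\<Sum>i. ?H (R (i + k)))"
        by (intro add_right_mono H_D)
      finally show ?thesis .
    qed
    moreover have "(\<lambda>k. ?H T + (\<Sum>i. ?H (R (i + k)))) \<longlonglongrightarrow> ?H T + 0"
      by (intro tendsto_intros tail)
    ultimately show ?thesis
      using LIMSEQ_le_const by (metis (no_types, lifting) add.right_neutral)
  qed
  have "?H (T \<inter> C) + ?H (T - C) = ?H T" for T
  proof (rule antisym)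
    show "?H (T \<inter> C) + ?H (T - C) \<le> ?H T"
      using key[of T] by (cases "C = {}"; cases "?H T = \<infinity>") (auto simp: less_top)
    have "?H ((T \<inter> C) \<union> (T - C)) \<le> ?H (T \<inter> C) + ?H (T - C)" by (rule hausdorff_outer_Un_le)
    then show "?H T \<le> ?H (T \<inter> C) + ?H (T - C)" by (simp add: Int_Diff_Un)
  qed
  then show ?thesis
    unfolding sets_hausdorff_measure algebra.lambda_system_eq[OF algebra_Pow] by auto
qed

lemma borel_subset_sets_hausdorff_measure: "sets borel \<subseteq> sets (hausdorff_measure d)"
proof -
  have "sigma_sets UNIV (Collect closed) \<subseteq> sets (hausdorff_measure d :: 'a measure)"
    using sets.sigma_sets_subset[of "Collect closed" "hausdorff_measure d"] closed_in_sets_hausdorff_measure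
    by auto
  then show ?thesis by (simp add: borel_eq_closed sets_measure_of_conv)
qed

subsection \<open>Uniqueness of measures with uniform balls\<close>

text \<open>If the sphere were null it would have covers of arbitrarily small cost. The part of the
  annulus 1 \<le> norm y < 2 lying radially over a covering set \<open>U\<close> has Lebesgue
  measure at most \<open>C * c U\<close>, so the annulus would be null too.\<close>

lemma hausdorff_outer_sphere_pos:
  "hausdorff_outer (DIM('a) - 1) (sphere (0::'a::euclidean_space) 1) > 0"
proof (rule ccontr)
  let ?n = "DIM('a)"
  let ?S = "sphere (0::'a) 1"
  let ?A = "{y::'a. 1 \<le> norm y \<and> norm y < 2}"
  define w where "w = unit_ball_vol (real (?n - 1))"
  define W where "W = unit_ball_vol (real ?n)"
  have w: "w > 0" and W: "W > 0" by (simp_all add: w_def W_def)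
  define c where "c = (\<lambda>U::'a set. if U = {} then 0 else w * (diameter U / 2) ^ (?n - 1))"
  \<comment> \<open>At most 2 / d balls of radius 3 d cover the cone over a set of diameter d > 0;
    the factors \<open>2 ^ (?n - 1)\<close> and \<open>w\<close> undo the normalisation of the
    gauge.\<close>
  define C where "C = 2 * 3 ^ ?n * 2 ^ (?n - 1) * W / w"
  have C: "C > 0" using w W by (simp add: C_def)
  have n: "?n \<ge> 1" by (simp add: Suc_leI)
  have cone: "\<exists>V. V \<in> sets borel \<and> emeasure lborel V \<le> ennreal (C * c U) \<and>
       (\<forall>y\<in>?A. (1 / norm y) *\<^sub>R y \<in> U \<longrightarrow> y \<in> V)"
    if U: "bounded U" "diameter U \<le> 1" for U
  proof (cases "U \<inter> ?S = {}")
    case True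
    then show ?thesis by (intro exI[of _ "{}"]) force
  next
    case False
    then obtain x where x: "x \<in> U" "norm x = 1" by auto
    define d where "d = diameter U"
    have d: "0 \<le> d" "d \<le> 1" using U diameter_ge_0 by (auto simp: d_def)
    have dist: "norm (y - x) \<le> d" if "y \<in> U" for y
      using diameter_bounded_bound[OF U(1) that x(1)] by (simp add: d_def dist_norm)
    have cU: "c U = w * (d / 2) ^ (?n - 1)" using x by (auto simp: c_def d_def)
    \<comment> \<open>The balls are centred on the segment from \<open>x\<close> to
      \<open>2 x\<close>. Rounding the norm of a point down to a multiple of 1 / k costs 1 / k, and
      its direction deviates from \<open>x\<close> by at most \<open>d\<close>, which norm y < 2 at
      most doubles.\<close>
    have sausage: "\<exists>V. V \<in> sets borel \<and> emeasure lborel V \<le> ennreal (real k * (W * (2 * d + 1 / real k) ^ ?n)) \<and>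
       (\<forall>y\<in>?A. (1 / norm y) *\<^sub>R y \<in> U \<longrightarrow> y \<in> V)" if k: "k \<ge> 1" for k :: nat
    proof (intro exI[of _ "\<Union>j<k. ball ((1 + real j / real k) *\<^sub>R x) (2 * d + 1 / real k)"] conjI ballI impI)
      have "emeasure lborel (\<Union>j<k. ball ((1 + real j / real k) *\<^sub>R x) (2 * d + 1 / real k))
          \<le> (\<Sum>j<k. emeasure lborel (ball ((1 + real j / real k) *\<^sub>R x) (2 * d + 1 / real k)))"
        by (intro emeasure_subadditive_finite) auto
      also have "\<dots> = (\<Sum>j<k. ennreal (W * (2 * d + 1 / real k) ^ ?n))"
        using d by (simp add: emeasure_ball W_def)
      also have "\<dots> = ennreal (real k * (W * (2 * d + 1 / real k) ^ ?n))"
        using d W by (simp add: ennreal_of_nat_eq_real_of_nat ennreal_mult)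
      finally show "emeasure lborel (\<Union>j<k. ball ((1 + real j / real k) *\<^sub>R x) (2 * d + 1 / real k))
         \<le> ennreal (real k * (W * (2 * d + 1 / real k) ^ ?n))" .
    next
      fix y assume y: "y \<in> ?A" "(1 / norm y) *\<^sub>R y \<in> U"
      define t where "t = norm y"
      define z where "z = (1 / norm y) *\<^sub>R y"
      have t: "1 \<le> t" "t < 2" and yz: "y = t *\<^sub>R z" using y by (auto simp: t_def z_def)
      define j where "j = nat \<lfloor>(t - 1) * real k\<rfloor>"
      have nn: "0 \<le> (t - 1) * real k" using t k by simp
      have j1: "real j \<le> (t - 1) * real k" "(t - 1) * real k < real j + 1"
        using nn by (auto simp: j_def)
      have "(t - 1) * real k < 1 * real k" using t k by (intro mult_strict_right_mono) auto
      then have jk: "j < k" using j1 by simp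
      have tj: "\<bar>t - (1 + real j / real k)\<bar> < 1 / real k"
      proof -
        have "t - (1 + real j / real k) = ((t - 1) * real k - real j) / real k"
          using k by (simp add: field_simps)
        moreover have "\<bar>((t - 1) * real k - real j) / real k\<bar> < 1 / real k"
          unfolding abs_divide abs_of_nat using j1 k by (intro divide_strict_right_mono) (auto simp: abs_if)
        ultimately show ?thesis by simp
      qed
      have "y - (1 + real j / real k) *\<^sub>R x = t *\<^sub>R (z - x) + (t - (1 + real j / real k)) *\<^sub>R x"
        by (simp add: yz algebra_simps)
      then have "norm (y - (1 + real j / real k) *\<^sub>R x) \<le> t * norm (z - x) + \<bar>t - (1 + real j / real k)\<bar>"
        using norm_triangle_ineq[of "t *\<^sub>R (z - x)" "(t - (1 + real j / real k)) *\<^sub>R x"] x t by simp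
      also have "\<dots> < 2 * d + 1 / real k"
      proof -
        have "t * norm (z - x) \<le> 2 * d"
          using t dist[of z] y(2) by (intro mult_mono) (auto simp: z_def)
        then show ?thesis using tj by linarith
      qed
      finally show "y \<in> (\<Union>j<k. ball ((1 + real j / real k) *\<^sub>R x) (2 * d + 1 / real k))"
        using jk by (auto simp: dist_norm norm_minus_commute)
    qed auto
    \<comment> \<open>A one-point set costs \<open>w * 0 ^ (?n - 1)\<close>, which is
      \<open>w\<close> in dimension 1 and 0 otherwise. In dimension 1 a single ball is therefore
      affordable; in higher dimension the cone is a piece of a ray and must be caught in a null
      hyperplane.\<close>
    consider "d > 0" | "d = 0" "?n = 1" | "d = 0" "?n \<ge> 2" using d n by linarith
    then show ?thesis
    proof cases
      case 1
      define k where "k = nat \<lceil>1 / d\<rceil>"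
      have k: "1 / d \<le> real k" "real k \<le> 1 / d + 1" using 1 by (auto simp: k_def)
      then have k1: "k \<ge> 1" using 1 by (cases k) (auto simp: field_simps)
      have kd: "real k \<le> 2 / d" "1 / real k \<le> d"
        using k 1 d k1 by (auto simp: field_simps)
      have "real k * (W * (2 * d + 1 / real k) ^ ?n) \<le> (2 / d) * (W * (3 * d) ^ ?n)"
        using kd 1 W by (intro mult_mono power_mono) auto
      also have "\<dots> = C * c U"
      proof -
        have "d ^ ?n = d * d ^ (?n - 1)" using n power_eq_if[of d ?n] by simp
        then show ?thesis using 1 w by (simp add: C_def cU power_mult_distrib power_divide field_simps)
      qed
      finally show ?thesis using sausage[OF k1] by (meson ennreal_leI order_trans)
    next
      case 2
      then have "real 1 * (W * (2 * d + 1 / real 1) ^ ?n) \<le> C * c U"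
        using w W by (simp add: C_def cU)
      then show ?thesis using sausage[of 1] by (meson ennreal_leI order_trans order_refl)
    next
      case 3
      obtain a where a: "a \<noteq> 0" "orthogonal x a" using orthogonal_to_vector_exists[OF 3(2)] by blast
      have "{y. a \<bullet> y = 0} \<in> null_sets lborel"
        using negligible_hyperplane[of a 0] a closed_hyperplane[of a 0]
        by (auto simp: negligible_iff_null_sets null_sets_completion_iff)
      moreover have "a \<bullet> y = 0" if "y \<in> ?A" "(1 / norm y) *\<^sub>R y \<in> U" for y
      proof -
        have "(1 / norm y) *\<^sub>R y = x" using dist[OF that(2)] 3 by simp
        then have "y = norm y *\<^sub>R x" using that by auto
        then show ?thesis using a by (metis inner_commute inner_scaleR_right mult_zero_right orthogonal_def)
      qed
      ultimately show ?thesis by (intro exI[of _ "{y. a \<bullet> y = 0}"]) (auto simp: null_sets_def)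
    qed
  qed
  assume "\<not> ?thesis"
  then have H0: "hausdorff_outer (?n - 1) ?S = 0" by simp
  have bound: "emeasure lborel ?A \<le> ennreal (C * e)" if "e > 0" for e
  proof -
    have "hausdorff_content (?n - 1) 1 ?S \<le> hausdorff_outer (?n - 1) ?S"
      unfolding hausdorff_outer_def by (intro SUP_upper) auto
    then have "hausdorff_content (?n - 1) 1 ?S < ennreal e" using H0 that by simp
    then obtain U where U: "?S \<subseteq> (\<Union>i. U i)" "\<And>i. bounded (U i)" "\<And>i. diameter (U i) \<le> 1"
      and sum: "(\<Sum>i. if U i = {} then 0 else ennreal (w * (diameter (U i) / 2) ^ (?n - 1))) < ennreal e"
      unfolding hausdorff_content_def INF_less_iff w_def by (auto simp del: of_nat_diff)
    have "\<forall>i. \<exists>V. V \<in> sets borel \<and> emeasure lborel V \<le> ennreal (C * c (U i)) \<and>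
       (\<forall>y\<in>?A. (1 / norm y) *\<^sub>R y \<in> U i \<longrightarrow> y \<in> V)"
      using cone U by blast
    from choice[OF this] obtain V where "\<forall>i. V i \<in> sets borel \<and> emeasure lborel (V i) \<le> ennreal (C * c (U i)) \<and>
       (\<forall>y\<in>?A. (1 / norm y) *\<^sub>R y \<in> U i \<longrightarrow> y \<in> V i)" ..
    then have V: "\<And>i. V i \<in> sets borel" "\<And>i. emeasure lborel (V i) \<le> ennreal (C * c (U i))"
      "\<And>i y. y \<in> ?A \<Longrightarrow> (1 / norm y) *\<^sub>R y \<in> U i \<Longrightarrow> y \<in> V i" by blast+
    have "?A \<subseteq> (\<Union>i. V i)"
    proof
      fix y assume y: "y \<in> ?A"
      then have "(1 / norm y) *\<^sub>R y \<in> ?S" by auto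
      then obtain i where "(1 / norm y) *\<^sub>R y \<in> U i" using U by blast
      then show "y \<in> (\<Union>i. V i)" using V(3) y by blast
    qed
    then have "emeasure lborel ?A \<le> emeasure lborel (\<Union>i. V i)"
      using V by (intro emeasure_mono) auto
    also have "\<dots> \<le> (\<Sum>i. emeasure lborel (V i))"
      using V by (intro emeasure_subadditive_countably) auto
    also have "\<dots> \<le> (\<Sum>i. ennreal C * ennreal (c (U i)))"
      using V C by (intro suminf_le) (auto simp: ennreal_mult'[symmetric])
    also have "\<dots> = ennreal C * (\<Sum>i. if U i = {} then 0 else ennreal (w * (diameter (U i) / 2) ^ (?n - 1)))"
      by (subst ennreal_suminf_cmult) (auto simp: c_def if_distrib[of ennreal] cong: if_cong)
    also have "\<dots> \<le> ennreal C * ennreal e"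
      using sum by (intro mult_left_mono) auto
    finally show ?thesis using C that by (simp add: ennreal_mult)
  qed
  have "emeasure lborel ?A \<le> 0"
  proof (rule ennreal_le_epsilon)
    fix e :: real assume "e > 0"
    then show "emeasure lborel ?A \<le> 0 + ennreal e" using bound[of "e / C"] C by simp
  qed
  moreover have "emeasure lborel ({y::'a. 1 < norm y \<and> norm y < 2}) > 0"
  proof -
    have op: "open {y::'a. 1 < norm y \<and> norm y < 2}"
      by (intro open_Collect_conj open_Collect_less continuous_intros)
    obtain b :: 'a where "b \<in> Basis" using nonempty_Basis by blast
    then have "(3/2) *\<^sub>R b \<in> {y::'a. 1 < norm y \<and> norm y < 2}" by simp
    then have "{y::'a. 1 < norm y \<and> norm y < 2} \<notin> null_sets lborel"
      using open_not_negligible[OF op] op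
      by (metis (lifting) borel_open empty_iff negligible_iff_null_sets null_sets_completion_iff sets_lborel)
    then show ?thesis using op by (auto simp: null_sets_def zero_less_iff_neq_zero)
  qed
  moreover have "emeasure lborel ({y::'a. 1 < norm y \<and> norm y < 2}) \<le> emeasure lborel ?A"
    by (intro emeasure_mono) auto
  ultimately show False by auto
qed

section \<open>Reflections and the invariance of Lebesgue measure\<close>

text \<open>The reflection in the hyperplane orthogonal to \<open>x - y\<close>. For
  \<open>x = y\<close> the vector \<open>v\<close> is 0 and the formula yields the identity.\<close>

lemma ex_reflection:
  fixes x y :: "'a::euclidean_space"
  assumes "norm x = norm y"
  obtains T where "linear T" "\<And>z. norm (T z) = norm z" "\<And>z. T (T z) = z" "T x = y"
proof -
  define v where "v = x - y"
  define T where "T = (\<lambda>z. z - (2 * (z \<bullet> v) / (v \<bullet> v)) *\<^sub>R v)"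
  have lin: "linear T"
    unfolding T_def
    by (rule linearI) (auto simp: algebra_simps add_divide_distrib)
  have inv: "T (T z) = z" for z
    by (cases "v = 0") (auto simp: T_def algebra_simps)
  have "T z \<bullet> T z = z \<bullet> z" for z
    by (cases "v = 0")
      (auto simp: T_def inner_diff_left inner_diff_right inner_commute[of v z] field_simps power2_eq_square)
  then have nrm: "norm (T z) = norm z" for z by (simp add: norm_eq_sqrt_inner)
  have "T x = y"
  proof (cases "v = 0")
    case False
    have "x \<bullet> x = y \<bullet> y" using assms by (simp add: norm_eq)
    then have "2 * (x \<bullet> v) = v \<bullet> v"
      by (simp add: v_def inner_diff_left inner_diff_right inner_commute)
    moreover have "v \<bullet> v \<noteq> 0" using False by simp
    ultimately show ?thesis by (simp add: T_def) (simp add: v_def)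
  qed (simp add: T_def v_def)
  then show thesis using that lin inv nrm by blast
qed

text \<open>Tonelli for the kernel \<open>indicator {dist x y < r}\<close>; letting \<open>r \<rightarrow> 0\<close> compares two
  measures whose balls have masses independent of the centre.\<close>

lemma uniform_balls_comparison:
  fixes \<mu> \<nu> :: "'a::euclidean_space measure"
  assumes sf: "sigma_finite_measure \<mu>" "sigma_finite_measure \<nu>"
    and [measurable_cong]: "sets \<mu> = sets borel" "sets \<nu> = sets borel"
    and ae: "AE x in \<mu>. x \<in> X"
    and F [measurable]: "F \<in> sets borel" and "F \<subseteq> X"
    and h: "\<And>x. x \<in> X \<Longrightarrow> emeasure \<mu> (ball x r) = h"
    and g: "\<And>x. x \<in> X \<Longrightarrow> emeasure \<nu> (ball x r) = g"
  shows "h * emeasure \<nu> F \<le> g * emeasure \<mu> (\<Union>y\<in>F. ball y r)"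
proof -
  interpret pair_sigma_finite \<mu> \<nu>
    using sf by (simp add: pair_sigma_finite_def)
  let ?f = "\<lambda>x y. indicator F y * indicator {p. dist (fst p) (snd p) < r} (x, y) :: ennreal"
  have [measurable]: "{p::'a \<times> 'a. dist (fst p) (snd p) < r} \<in> sets (borel \<Otimes>\<^sub>M borel)"
    unfolding borel_prod by (intro borel_open open_Collect_less continuous_intros)
  have U [measurable]: "(\<Union>y\<in>F. ball y r) \<in> sets borel" by (intro borel_open open_UN) auto
  have m: "(\<lambda>(x, y). ?f x y) \<in> borel_measurable (\<mu> \<Otimes>\<^sub>M \<nu>)" by measurable
  have "h * emeasure \<nu> F = (\<integral>\<^sup>+y. h * indicator F y \<partial>\<nu>)"
    using assms(4) F by (simp add: nn_integral_cmult_indicator)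
  also have "\<dots> = (\<integral>\<^sup>+y. (\<integral>\<^sup>+x. ?f x y \<partial>\<mu>) \<partial>\<nu>)"
  proof (rule nn_integral_cong)
    fix y
    show "h * indicator F y = (\<integral>\<^sup>+x. ?f x y \<partial>\<mu>)"
    proof (cases "y \<in> F")
      case True
      have "(\<integral>\<^sup>+x. ?f x y \<partial>\<mu>) = (\<integral>\<^sup>+x. indicator (ball y r) x \<partial>\<mu>)"
        using True by (intro nn_integral_cong) (auto simp: indicator_def dist_commute)
      then show ?thesis using True h[of y] \<open>F \<subseteq> X\<close> by auto
    qed simp
  qed
  also have "\<dots> = (\<integral>\<^sup>+x. (\<integral>\<^sup>+y. ?f x y \<partial>\<nu>) \<partial>\<mu>)" using Fubini'[OF m] .
  also have "\<dots> \<le> (\<integral>\<^sup>+x. g * indicator (\<Union>y\<in>F. ball y r) x \<partial>\<mu>)"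
  proof (rule nn_integral_mono_AE, use ae in eventually_elim)
    fix x assume x: "x \<in> X"
    show "(\<integral>\<^sup>+y. ?f x y \<partial>\<nu>) \<le> g * indicator (\<Union>y\<in>F. ball y r) x"
    proof (cases "x \<in> (\<Union>y\<in>F. ball y r)")
      case True
      have "(\<integral>\<^sup>+y. ?f x y \<partial>\<nu>) \<le> (\<integral>\<^sup>+y. indicator (ball x r) y \<partial>\<nu>)"
        by (intro nn_integral_mono) (auto simp: indicator_def)
      then show ?thesis using True g[OF x] by auto
    next
      case False
      then have "(\<integral>\<^sup>+y. ?f x y \<partial>\<nu>) = (\<integral>\<^sup>+y. 0 \<partial>\<nu>)"
        by (intro nn_integral_cong) (auto simp: indicator_def dist_commute)
      then show ?thesis by simp
    qed
  qed
  also have "\<dots> = g * emeasure \<mu> (\<Union>y\<in>F. ball y r)"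
    using assms(3) U by (simp add: nn_integral_cmult_indicator)
  finally show ?thesis .
qed

text \<open>Lebesgue measure and its image give all balls of one radius the same finite positive
  mass. Cancelling it in \<open>uniform_balls_comparison\<close> bounds either measure of
  \<open>F\<close> by the other measure of a neighbourhood of \<open>F\<close>; on boxes the
  neighbourhoods are again controlled by boxes, and the radius tends to 0.\<close>

lemma distr_lborel_isometry:
  fixes T :: "'a::euclidean_space \<Rightarrow> 'a"
  assumes lin: "linear T" and nrm: "\<And>z. norm (T z) = norm z" and inv: "\<And>z. T (T z) = z"
  shows "distr lborel borel T = lborel"
proof -
  have cont: "continuous_on UNIV T"
    using lin linear_continuous_on linear_conv_bounded_linear by blast
  then have [measurable]: "T \<in> borel_measurable borel" by (rule borel_measurable_continuous_onI)
  let ?N = "distr lborel borel T"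
  have dT: "dist (T x) (T y) = dist x y" for x y
    using nrm lin by (simp add: dist_norm linear_diff[symmetric])
  have ball: "emeasure ?N (ball x r) = emeasure lborel (ball 0 r :: 'a set)" for x r
  proof -
    have "T -` ball x r = ball (T x) r"
      using dT[of "T x"] inv by (auto simp: ball_def)
    then show ?thesis by (cases "r \<ge> 0") (auto simp: emeasure_distr emeasure_ball ball_empty)
  qed
  have ball': "emeasure lborel (ball x r) = emeasure lborel (ball 0 r :: 'a set)" for x :: 'a and r
    by (cases "r \<ge> 0") (auto simp: emeasure_ball ball_empty)
  interpret N: sigma_finite_measure ?N
  proof
    show "\<exists>A. countable A \<and> A \<subseteq> sets ?N \<and> \<Union> A = space ?N \<and> (\<forall>a\<in>A. emeasure ?N a \<noteq> \<infinity>)"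
    proof (intro exI conjI)
      show "countable (range (\<lambda>n::nat. ball (0::'a) (real n)))" by auto
      show "\<Union> (range (\<lambda>n::nat. ball (0::'a) (real n))) = space ?N"
        using reals_Archimedean2 by auto
      show "\<forall>a\<in>range (\<lambda>n::nat. ball (0::'a) (real n)). emeasure ?N a \<noteq> \<infinity>"
        using emeasure_lborel_ball_finite by (auto simp: ball less_top)
    qed auto
  qed
  have cancel: "emeasure \<nu> F \<le> emeasure \<mu> (\<Union>y\<in>F. ball y r)"
    if "\<mu> = lborel \<and> \<nu> = ?N \<or> \<mu> = ?N \<and> \<nu> = lborel" "F \<in> sets borel" "r > 0" for \<mu> \<nu> :: "'a measure" and F r
  proof -
    let ?b = "emeasure lborel (ball 0 r :: 'a set)"
    have "?b * emeasure \<nu> F \<le> ?b * emeasure \<mu> (\<Union>y\<in>F. ball y r)"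
      using that ball ball'
      by (intro uniform_balls_comparison[where X=UNIV])
         (auto intro: N.sigma_finite_measure_axioms lborel.sigma_finite_measure_axioms)
    moreover have "0 < ?b" "?b < \<infinity>"
      using that(3) emeasure_lborel_ball_finite by (auto simp: emeasure_ball)
    ultimately show ?thesis
      by (simp add: ennreal_mult_le_mult_iff less_top[symmetric])
  qed
  have fat: "(\<Union>y\<in>box a b. ball y r) \<subseteq> box (a - r *\<^sub>R One) (b + r *\<^sub>R One)" for a b :: 'a and r
  proof clarify
    fix y z assume y: "y \<in> box a b" and z: "z \<in> ball y r"
    have "\<bar>(z - y) \<bullet> i\<bar> < r" if "i \<in> Basis" for i
      using Basis_le_norm[OF that, of "z - y"] z by (auto simp: dist_norm norm_minus_commute)
    then show "z \<in> box (a - r *\<^sub>R One) (b + r *\<^sub>R One)"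
      using y by (fastforce simp: mem_box inner_diff_left inner_add_left abs_less_iff)
  qed
  show ?thesis
  proof (rule lborel_eqI[symmetric])
    fix l u :: 'a assume lu: "\<And>b. b \<in> Basis \<Longrightarrow> l \<bullet> b \<le> u \<bullet> b"
    \<comment> \<open>The maximum with 0 covers negative \<open>r\<close>, where the shrunken box
      may be empty.\<close>
    have vol: "emeasure lborel (box (l - r *\<^sub>R One) (u + r *\<^sub>R One)) = ennreal (\<Prod>b\<in>Basis. max 0 ((u - l) \<bullet> b + 2 * r))" for r
      proof (cases "\<forall>b\<in>Basis. (l - r *\<^sub>R One) \<bullet> b \<le> (u + r *\<^sub>R One) \<bullet> b")
        case True
        then have "(\<Prod>b\<in>Basis. max 0 ((u - l) \<bullet> b + 2 * r)) = (\<Prod>b\<in>Basis. (u + r *\<^sub>R One - (l - r *\<^sub>R One)) \<bullet> b)"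
          by (intro prod.cong) (auto simp: inner_diff_left inner_add_left max_def)
        then show ?thesis using True by (subst emeasure_lborel_box) auto
      next
        case False
        then obtain b where b: "b \<in> Basis" "(u - l) \<bullet> b + 2 * r < 0"
          by (auto simp: inner_diff_left inner_add_left)
        then have "(\<Prod>b\<in>Basis. max 0 ((u - l) \<bullet> b + 2 * r)) = 0"
          by (intro prod_zero) (auto intro!: bexI[of _ b])
        moreover have "box (l - r *\<^sub>R One) (u + r *\<^sub>R One) = {}"
          using b by (auto simp: box_eq_empty inner_diff_left inner_add_left intro!: bexI[of _ b])
        ultimately show ?thesis by (metis emeasure_empty ennreal_0)
      qed
    have lim: "((\<lambda>r. ennreal (\<Prod>b\<in>Basis. max 0 ((u - l) \<bullet> b + 2 * (s * r)))) \<longlongrightarrow> ennreal (\<Prod>b\<in>Basis. (u - l) \<bullet> b)) (at_right 0)" for s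
    proof -
      have "((\<lambda>r. ennreal (\<Prod>b\<in>Basis. max 0 ((u - l) \<bullet> b + 2 * (s * r)))) \<longlongrightarrow>
           ennreal (\<Prod>b\<in>Basis. max 0 ((u - l) \<bullet> b + 2 * (s * 0)))) (at_right 0)"
        by (intro tendsto_intros)
      also have "(\<Prod>b\<in>Basis. max 0 ((u - l) \<bullet> b + 2 * (s * 0))) = (\<Prod>b\<in>Basis. (u - l) \<bullet> b)"
        using lu by (intro prod.cong) (auto simp: inner_diff_left)
      finally show ?thesis .
    qed
    have "emeasure ?N (box l u) \<le> ennreal (\<Prod>b\<in>Basis. max 0 ((u - l) \<bullet> b + 2 * (1 * r)))" if "r > 0" for r
    proof -
      have "emeasure ?N (box l u) \<le> emeasure lborel (\<Union>y\<in>box l u. ball y r)"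
        using that by (intro cancel) auto
      also have "\<dots> \<le> emeasure lborel (box (l - r *\<^sub>R One) (u + r *\<^sub>R One))"
        by (intro emeasure_mono fat) auto
      also note vol
      finally show ?thesis by simp
    qed
    then have le: "emeasure ?N (box l u) \<le> ennreal (\<Prod>b\<in>Basis. (u - l) \<bullet> b)"
      by (intro tendsto_lowerbound[OF lim[of 1]]) (auto intro!: eventually_at_right_less eventually_mono[OF eventually_at_right_less])
    \<comment> \<open>The lower bound starts from the box shrunk by \<open>r\<close>, whose
      \<open>r\<close>-neighbourhood still lies in the given box.\<close>
    have "ennreal (\<Prod>b\<in>Basis. max 0 ((u - l) \<bullet> b + 2 * ((-1) * r))) \<le> emeasure ?N (box l u)" if "r > 0" for r
    proof -
      note vol[of "-r", symmetric]
      also have "emeasure lborel (box (l - (-r) *\<^sub>R One) (u + (-r) *\<^sub>R One))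
          \<le> emeasure ?N (\<Union>y\<in>box (l - (-r) *\<^sub>R One) (u + (-r) *\<^sub>R One). ball y r)"
        using that by (intro cancel) auto
      also have "\<dots> \<le> emeasure ?N (box l u)"
        using fat[where a="l - (-r) *\<^sub>R One" and b="u + (-r) *\<^sub>R One" and r=r] by (intro emeasure_mono) auto
      finally show ?thesis by simp
    qed
    then have "ennreal (\<Prod>b\<in>Basis. (u - l) \<bullet> b) \<le> emeasure ?N (box l u)"
      by (intro tendsto_upperbound[OF lim[of "-1"]]) (auto intro!: eventually_mono[OF eventually_at_right_less])
    with le show "emeasure ?N (box l u) = ennreal (\<Prod>b\<in>Basis. (u - l) \<bullet> b)" by (rule antisym)
  qed simp
qed

subsection \<open>Cancellation on annuli\<close>

lemma hausdorff_outer_isometry: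
  fixes T :: "'a::euclidean_space \<Rightarrow> 'a"
  assumes iso: "\<And>x y. dist (T x) (T y) = dist x y" and inv: "\<And>z. T (T z) = z"
  shows "hausdorff_outer d (T ` A) = hausdorff_outer d A"
proof -
  have le: "hausdorff_outer d (T ` A) \<le> hausdorff_outer d A" for A
    unfolding hausdorff_outer_def
  proof (rule SUP_mono)
    fix \<delta> :: real assume \<delta>: "\<delta> \<in> {0<..}"
    have "hausdorff_content d \<delta> (T ` A) \<le> hausdorff_content d \<delta> A"
      unfolding hausdorff_content_def[of d \<delta> A]
    proof (rule INF_greatest, clarify)
      fix U :: "nat \<Rightarrow> 'a set"
      assume U: "A \<subseteq> (\<Union>i. U i)" and b: "\<forall>i. bounded (U i) \<and> diameter (U i) \<le> \<delta>"
      have diam: "diameter (T ` U i) \<le> diameter (U i)" for i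
        using b diameter_ge_0[of "U i"] diameter_bounded_bound[of "U i"]
        by (intro diameter_le) (auto simp: iso dist_norm[symmetric])
      have bdd: "bounded (T ` U i)" for i
      proof -
        obtain x e where "\<forall>y\<in>U i. dist x y \<le> e" using b unfolding bounded_def by blast
        then have "\<forall>y\<in>T ` U i. dist (T x) y \<le> e" by (auto simp: iso)
        then show ?thesis by (auto simp: bounded_def)
      qed
      show "hausdorff_content d \<delta> (T ` A) \<le>
          (\<Sum>i. if U i = {} then 0 else ennreal (unit_ball_vol (real d) * (diameter (U i) / 2) ^ d))"
        unfolding hausdorff_content_def
      proof (rule INF_lower2)
        show "(\<lambda>i. T ` U i) \<in> {V. T ` A \<subseteq> (\<Union>i. V i) \<and> (\<forall>i. bounded (V i) \<and> diameter (V i) \<le> \<delta>)}"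
          using U bdd diam b by (fastforce intro: order_trans)
        show "(\<Sum>i. if T ` U i = {} then 0 else ennreal (unit_ball_vol (real d) * (diameter (T ` U i) / 2) ^ d))
          \<le> (\<Sum>i. if U i = {} then 0 else ennreal (unit_ball_vol (real d) * (diameter (U i) / 2) ^ d))"
          using diam bdd by (intro suminf_le)
            (auto intro!: ennreal_leI mult_left_mono power_mono divide_right_mono diameter_ge_0)
      qed
    qed
    then show "\<exists>m\<in>{0<..}. hausdorff_content d \<delta> (T ` A) \<le> hausdorff_content d m A"
      using \<delta> by blast
  qed
  have "T ` T ` A = A" using inv by (force simp: image_image)
  then show ?thesis using le[of A] le[of "T ` A"] by (simp add: antisym)
qed

text \<open>The Hausdorff measure \<open>M\<close> on the sphere and the radial projection \<open>L\<close> of \<open>norm y powr (- n) dy\<close>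
  on the annulus are both invariant under reflections, so they agree up to a positive factor on
  compact sets; inner regularity of Lebesgue measure extends this to the sets defined by \<open>K\<close>.\<close>

lemma annulus_cancellation:
  fixes K :: "'a::euclidean_space \<Rightarrow> real"
  assumes K: "admissible_kernel (1 / 2) K" and lam: "0 < lam" "\<And>y. norm y = 1 \<Longrightarrow> lam \<le> K y"
    and Km: "K \<in> borel_measurable lebesgue" and ab: "0 < a" "a < b"
  shows "(LINT y:{y. a \<le> norm y \<and> norm y < b}|lebesgue. K y *\<^sub>R y) = 0"
proof -
  let ?n = "DIM('a)"
  let ?S = "sphere (0::'a) 1"
  let ?A = "{y::'a. a \<le> norm y \<and> norm y < b}"
  define N where "N = ?n - 1"
  let ?H = "hausdorff_measure (N) :: 'a measure"
  define f where "f = (\<lambda>y::'a. indicator ?S y *\<^sub>R (K y *\<^sub>R y))"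
  \<comment> \<open>The exponent is dictated by homogeneity: K has degree - n - 1 here, so
    \<open>w y *\<^sub>R f (sgn y) = K y *\<^sub>R y\<close> on the annulus.\<close>
  define w where "w = (\<lambda>y::'a. indicator ?A y * (1 / norm y) ^ ?n)"
  have hb: "has_bochner_integral ?H f 0"
    using K by (simp add: admissible_kernel_def f_def N_def)
  have fH [measurable]: "f \<in> borel_measurable ?H" using hb by (simp add: has_bochner_integral_iff borel_measurable_integrable)
  have borelH: "B \<in> sets ?H" if "B \<in> sets borel" for B using borel_subset_sets_hausdorff_measure that by blast
  have SH [measurable]: "?S \<in> sets ?H" by (intro borelH) auto
  have Ab [measurable]: "?A \<in> sets borel"
  proof -
    have "?A = (- ball 0 a) \<inter> ball 0 b" by auto
    then show ?thesis by auto
  qed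
  have w0: "0 \<le> w y" for y by (simp add: w_def)
  have wle: "w y \<le> (1 / a) ^ ?n * indicator ?A y" for y
    using ab by (auto simp: w_def indicator_def intro!: power_mono frac_le)
  have [measurable]: "w \<in> borel_measurable borel" unfolding w_def by measurable
  have sgnb [measurable]: "sgn \<in> borel_measurable (borel :: 'a measure)"
    unfolding sgn_div_norm by measurable

  define M where "M = distr (restrict_space ?H ?S) borel (\<lambda>x. x)"
  define L where "L = distr (density lborel (\<lambda>y. ennreal (w y))) borel (sgn :: 'a \<Rightarrow> 'a)"
  have idm: "(\<lambda>x. x) \<in> restrict_space ?H ?S \<rightarrow>\<^sub>M borel"
    by (intro measurable_restrict_space1 measurableI) (auto simp: borelH)
  have setsM [simp, measurable_cong]: "sets M = sets borel" and setsL [simp, measurable_cong]: "sets L = sets borel"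
    by (auto simp: M_def L_def)
  have emM: "emeasure M B = emeasure ?H (B \<inter> ?S)" if "B \<in> sets borel" for B
    using that idm SH unfolding M_def
    by (subst emeasure_distr) (auto simp: emeasure_restrict_space space_restrict_space)
  have emL: "emeasure L B = (\<integral>\<^sup>+y. ennreal (w y) * indicator B (sgn y) \<partial>lborel)" if "B \<in> sets borel" for B
    using that unfolding L_def
    by (subst emeasure_distr) (auto simp: emeasure_density measurable_sets_borel[OF sgnb] intro!: nn_integral_cong split: split_indicator)

  \<comment> \<open>Finiteness of the measure of the sphere comes from the cancellation hypothesis
    itself: its integrand is integrable and has norm at least \<open>lam\<close> on the
    sphere.\<close>
  have finH: "emeasure ?H ?S < \<infinity>"
  proof -
    have "ennreal lam * emeasure ?H ?S = (\<integral>\<^sup>+y. ennreal lam * indicator ?S y \<partial>?H)"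
      using SH by (simp add: nn_integral_cmult_indicator)
    also have "\<dots> \<le> (\<integral>\<^sup>+y. ennreal (norm (f y)) \<partial>?H)"
    proof (rule nn_integral_mono)
      fix y
      show "ennreal lam * indicator ?S y \<le> ennreal (norm (f y))"
        using lam by (auto simp: f_def indicator_def intro!: ennreal_leI order_trans[OF lam(2)])
    qed
    also have "\<dots> < \<infinity>" using hb by (simp add: has_bochner_integral_iff integrable_iff_bounded)
    finally show ?thesis using lam by (auto simp: ennreal_mult_less_top)
  qed
  define m where "m = emeasure ?H ?S"
  have m: "m < \<infinity>" "m > 0"
    using finH hausdorff_outer_sphere_pos[where 'a='a] SH
    by (simp_all only: m_def emeasure_hausdorff_measure N_def)
  define V where "V = emeasure L UNIV"
  have wfin: "(\<integral>\<^sup>+y. ennreal (w y) \<partial>lborel) < \<infinity>"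
  proof -
    have "(\<integral>\<^sup>+y. ennreal (w y) \<partial>lborel) \<le> (\<integral>\<^sup>+y. ennreal ((1 / a) ^ ?n) * indicator ?A y \<partial>lborel)"
      by (intro nn_integral_mono order_trans[OF ennreal_leI[OF wle]])
         (auto simp: indicator_def)
    also have "\<dots> = ennreal ((1 / a) ^ ?n) * emeasure lborel ?A" by (simp add: nn_integral_cmult_indicator)
    also have "\<dots> < \<infinity>"
    proof -
      have "bounded ?A" by (rule bounded_subset[of "ball 0 b"]) auto
      then show ?thesis using emeasure_bounded_finite[of ?A] by (simp add: ennreal_mult_less_top)
    qed
    finally show ?thesis .
  qed
  have Vfin: "V < \<infinity>" using wfin by (simp add: V_def emL)
  interpret M: finite_measure M
    by (rule finite_measureI) (use m in \<open>auto simp: emM M_def[symmetric] m_def sets_eq_imp_space_eq[OF setsM] less_top\<close>)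
  interpret L: finite_measure L
    by (rule finite_measureI) (use Vfin in \<open>auto simp: V_def sets_eq_imp_space_eq[OF setsL] less_top\<close>)
  have MU: "emeasure M UNIV = m" by (simp add: emM m_def)
  have MS: "emeasure M ?S = m" by (simp add: emM m_def)
  have aeM: "AE x in M. x \<in> ?S"
    unfolding M_def by (subst AE_distr_iff[OF idm]) (auto intro!: AE_I2 simp: space_restrict_space)
  have sgnA: "sgn y \<in> ?S" if "w y \<noteq> 0" for y
    using that ab by (auto simp: w_def norm_sgn)
  have aeL: "AE x in L. x \<in> ?S"
    unfolding L_def using ab
    by (subst AE_distr_iff) (auto simp: AE_density norm_sgn w_def)

  have ball_M: "emeasure M (ball x r) = emeasure M (ball y r)"
    and ball_L: "emeasure L (ball x r) = emeasure L (ball y r)"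
    if xy: "x \<in> ?S" "y \<in> ?S" for x y r
  proof -
    obtain T where T: "linear T" "\<And>z. norm (T z) = norm z" "\<And>z. T (T z) = z" "T x = y"
      using ex_reflection[of x y] xy by auto
    have iso: "dist (T u) (T v) = dist u v" for u v
      using T(2) T(1) by (simp add: dist_norm linear_diff[symmetric])
    have [measurable]: "T \<in> borel_measurable borel"
      using T(1) by (intro borel_measurable_continuous_onI linear_continuous_on) (simp add: linear_conv_bounded_linear)
    have "T ` (ball x r \<inter> ?S) = ball y r \<inter> ?S"
    proof
      show "T ` (ball x r \<inter> ?S) \<subseteq> ball y r \<inter> ?S" using T iso by (auto simp: iso[of x, unfolded T(4)])
      show "ball y r \<inter> ?S \<subseteq> T ` (ball x r \<inter> ?S)"
      proof
        fix z assume z: "z \<in> ball y r \<inter> ?S"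
        have "T y = x" using T by metis
        then have "T z \<in> ball x r \<inter> ?S" using z iso[of y z] T by auto
        then show "z \<in> T ` (ball x r \<inter> ?S)" using T(3)[of z] by (metis imageI)
      qed
    qed
    then have "hausdorff_outer (N) (ball x r \<inter> ?S) = hausdorff_outer (N) (ball y r \<inter> ?S)"
      using hausdorff_outer_isometry[OF iso T(3), of "N" "ball x r \<inter> ?S"] by simp
    then show "emeasure M (ball x r) = emeasure M (ball y r)"
      by (simp add: emM emeasure_hausdorff_measure borelH)
    have "emeasure L (ball x r) = (\<integral>\<^sup>+z. ennreal (w z) * indicator (ball x r) (sgn z) \<partial>distr lborel borel T)"
      by (simp add: emL distr_lborel_isometry[OF T(1,2,3)])
    also have "\<dots> = (\<integral>\<^sup>+z. ennreal (w (T z)) * indicator (ball x r) (sgn (T z)) \<partial>lborel)"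
    proof -
      have [measurable]: "(\<lambda>z. indicator (ball x r) (sgn z) :: ennreal) \<in> borel_measurable borel"
        by (rule measurable_compose[OF sgnb borel_measurable_indicator]) simp
      show ?thesis by (rule nn_integral_distr) measurable
    qed
    also have "\<dots> = (\<integral>\<^sup>+z. ennreal (w z) * indicator (ball y r) (sgn z) \<partial>lborel)"
    proof (rule nn_integral_cong)
      fix z
      have "sgn (T z) = T (sgn z)" using T by (simp add: sgn_div_norm linear_scale)
      then have "dist x (sgn (T z)) = dist y (sgn z)" using iso[of x "T (sgn z)"] T by (metis iso)
      then show "ennreal (w (T z)) * indicator (ball x r) (sgn (T z)) = ennreal (w z) * indicator (ball y r) (sgn z)"
        by (simp add: w_def T indicator_def)
    qed
    also have "\<dots> = emeasure L (ball y r)" by (simp add: emL)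
    finally show "emeasure L (ball x r) = emeasure L (ball y r)" .
  qed
  obtain p :: 'a where p: "p \<in> ?S" using nonempty_Basis by (metis ex_in_conv norm_Basis mem_sphere_0)

  \<comment> \<open>Two comparisons at the same radius. The first bounds \<open>L\<close> of
    \<open>F\<close> by g / h times \<open>M\<close> of the neighbourhood; the second, with the
    roles exchanged and the whole sphere as set, gives g / h \<le> V / m.\<close>
  have fat: "emeasure L F * m \<le> V * emeasure M (\<Union>y\<in>F. ball y r)"
    if F: "F \<in> sets borel" "F \<subseteq> ?S" and r: "r > 0" for F r
  proof -
    define h where "h = emeasure M (ball p r)"
    define g where "g = emeasure L (ball p r)"
    have 1: "h * emeasure L F \<le> g * emeasure M (\<Union>y\<in>F. ball y r)"
      using ball_M[OF _ p] ball_L[OF _ p] F aeM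
      by (intro uniform_balls_comparison[where X="?S"])
        (auto simp: h_def g_def intro: M.sigma_finite_measure_axioms L.sigma_finite_measure_axioms)
    have "g * emeasure M ?S \<le> h * emeasure L (\<Union>y\<in>?S. ball y r)"
      using ball_M[OF _ p] ball_L[OF _ p] aeL
      by (intro uniform_balls_comparison[where X="?S"])
        (auto simp: h_def g_def intro: M.sigma_finite_measure_axioms L.sigma_finite_measure_axioms)
    also have "\<dots> \<le> h * V" unfolding V_def by (intro mult_left_mono emeasure_mono) auto
    finally have 2: "g * m \<le> h * V" by (simp add: MS)
    have hfin: "h < \<infinity>" by (simp add: h_def M.emeasure_finite less_top[symmetric])
    \<comment> \<open>Finitely many balls of this radius cover the sphere and all have mass
      \<open>h\<close>, whereas the sphere has positive mass.\<close>
    have "h \<noteq> 0"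
    proof
      assume h0: "h = 0"
      obtain D where D: "finite D" "D \<subseteq> ?S" "?S \<subseteq> (\<Union>x\<in>D. ball x r)"
        using compactE_image[of ?S ?S "\<lambda>x. ball x r"] r by (metis (no_types, lifting) UN_I centre_in_ball compact_sphere open_ball subsetI)
      have "m \<le> emeasure M (\<Union>x\<in>D. ball x r)" unfolding MS[symmetric] using D
        by (intro emeasure_mono) auto
      also have "\<dots> \<le> (\<Sum>x\<in>D. emeasure M (ball x r))" using D by (intro emeasure_subadditive_finite) auto
      also have "\<dots> = (\<Sum>x\<in>D. 0)"
        using D h0 ball_M[OF _ p, of _ r] by (intro sum.cong) (auto simp: h_def)
      finally show False using m by simp
    qed
    have "h * (emeasure L F * m) = (h * emeasure L F) * m" by (simp add: mult.assoc)
    also have "\<dots> \<le> g * emeasure M (\<Union>y\<in>F. ball y r) * m" using 1 by (rule mult_right_mono) simp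
    also have "\<dots> = (g * m) * emeasure M (\<Union>y\<in>F. ball y r)" by (simp add: ac_simps)
    also have "\<dots> \<le> (h * V) * emeasure M (\<Union>y\<in>F. ball y r)" using 2 by (rule mult_right_mono) simp
    finally have "h * (emeasure L F * m) \<le> h * (V * emeasure M (\<Union>y\<in>F. ball y r))" by (simp add: mult.assoc)
    then show ?thesis
      using \<open>h \<noteq> 0\<close> hfin by (simp add: ennreal_mult_le_mult_iff less_top[symmetric])
  qed
  have comp: "emeasure L F * m \<le> V * emeasure M F" if F: "compact F" "F \<subseteq> ?S" for F
  proof -
    have Fb: "F \<in> sets borel" using F by (simp add: borel_compact)
    let ?N = "\<lambda>k. \<Union>y\<in>F. ball y (1 / real (Suc k))"
    have "(\<lambda>k. emeasure M (?N k)) \<longlonglongrightarrow> emeasure M (\<Inter>k. ?N k)"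
    proof (rule Lim_emeasure_decseq)
      show "range ?N \<subseteq> sets M" by (auto intro!: borel_open open_UN)
      show "decseq ?N"
        unfolding decseq_def by (intro allI impI UN_mono order_refl subset_ball divide_left_mono) auto
    qed (simp add: M.emeasure_finite)
    also have "(\<Inter>k. ?N k) = F"
    proof
      show "(\<Inter>k. ?N k) \<subseteq> F"
      proof
        fix x assume x: "x \<in> (\<Inter>k. ?N k)"
        have "\<exists>y\<in>F. dist y x < e" if "e > 0" for e
        proof -
          obtain k :: nat where "1 / real (Suc k) < e" using \<open>e > 0\<close> nat_approx_posE by metis
          moreover obtain y where "y \<in> F" "dist y x < 1 / real (Suc k)" using x by force
          ultimately show ?thesis by (intro bexI[of _ y]) auto
        qed
        then show "x \<in> F" using F compact_imp_closed closed_approachable by blast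
      qed
    qed auto
    finally have "(\<lambda>k. V * emeasure M (?N k)) \<longlonglongrightarrow> V * emeasure M F"
      using Vfin by (intro ennreal_tendsto_cmult) auto
    then show ?thesis by (rule LIMSEQ_le_const) (use fat[OF Fb F(2)] in auto)
  qed

  define P where "P B = {y \<in> ?A. f (sgn y) \<in> B}" for B
  define E where "E B = {y \<in> ?S. f y \<in> B}" for B
  have fs: "f (sgn y) = (norm y ^ ?n) *\<^sub>R (K y *\<^sub>R y)" if "y \<in> ?A" for y
  proof -
    have y: "y \<noteq> 0" "norm y > 0" using that ab by auto
    have "K (sgn y) = (1 / norm y) powr (- real ?n - 1) * K y"
    proof -
      have "\<forall>t>0. \<forall>y. y \<noteq> 0 \<longrightarrow> K (t *\<^sub>R y) = t powr (- real ?n - 2 * (1 / 2)) * K y"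
        using K unfolding admissible_kernel_def by blast
      then have "K ((1 / norm y) *\<^sub>R y) = (1 / norm y) powr (- real ?n - 2 * (1 / 2)) * K y"
        using y by (metis zero_less_divide_1_iff)
      moreover have "sgn y = (1 / norm y) *\<^sub>R y" by (simp add: sgn_div_norm inverse_eq_divide)
      ultimately show ?thesis by simp
    qed
    also have "(1 / norm y) powr (- real ?n - 1) = norm y ^ (Suc ?n)"
      using y by (simp add: powr_minus_divide powr_divide powr_realpow[symmetric] powr_add powr_diff field_simps)
    finally show ?thesis using y
      by (simp add: f_def norm_sgn sgn_div_norm)
  qed
  have fsm: "(\<lambda>y. indicator ?A y *\<^sub>R f (sgn y)) \<in> borel_measurable lebesgue"
  proof -
    have "(\<lambda>y. indicator ?A y *\<^sub>R f (sgn y)) = (\<lambda>y. indicator ?A y *\<^sub>R ((norm y ^ ?n) *\<^sub>R (K y *\<^sub>R y)))"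
      using fs by (auto simp: fun_eq_iff indicator_def)
    moreover have [measurable]: "(\<lambda>x::'a. x) \<in> borel_measurable lebesgue" "?A \<in> sets lebesgue"
      by (auto intro: measurable_completion)
    have "(\<lambda>y. indicator ?A y *\<^sub>R ((norm y ^ ?n) *\<^sub>R (K y *\<^sub>R y))) \<in> borel_measurable lebesgue"
      using Km by measurable
    ultimately show ?thesis by simp
  qed
  have Pm: "P B \<in> sets lebesgue" if "B \<in> sets borel" for B
  proof -
    let ?X = "(\<lambda>y. indicator ?A y *\<^sub>R f (sgn y)) -` B \<inter> space lebesgue"
    have "?A \<in> sets lebesgue" using Ab by simp
    then have "?A \<inter> ?X \<in> sets lebesgue" by (rule sets.Int[OF _ measurable_sets[OF fsm that]])
    moreover have "P B = ?A \<inter> ?X" by (auto simp: P_def)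
    ultimately show ?thesis by (simp only:)
  qed
  have Em: "E B \<in> sets ?H" if "B \<in> sets borel" for B
  proof -
    have "E B = ?S \<inter> (f -` B \<inter> space ?H)" by (auto simp: E_def)
    then show ?thesis using sets.Int[OF SH measurable_sets[OF fH that]] by simp
  qed
  let ?W = "density lebesgue (\<lambda>y. ennreal (w y))"
  have wl [measurable]: "w \<in> borel_measurable lebesgue" by (auto intro: measurable_completion)
  have emW: "emeasure ?W Q = (\<integral>\<^sup>+y. ennreal (w y) * indicator Q y \<partial>lebesgue)" if "Q \<in> sets lebesgue" for Q
    using that by (subst emeasure_density) auto
  have WA: "emeasure ?W ?A = V"
  proof -
    have "emeasure ?W ?A = (\<integral>\<^sup>+y. ennreal (w y) * indicator ?A y \<partial>lborel)"
      by (subst emW) (auto simp: nn_integral_completion)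
    also have "\<dots> = (\<integral>\<^sup>+y. ennreal (w y) \<partial>lborel)"
      by (intro nn_integral_cong) (auto simp: w_def indicator_def)
    finally show ?thesis by (simp add: V_def emL)
  qed
  have half: "emeasure ?W (P B) * m \<le> V * emeasure ?H (E B)" if B: "B \<in> sets borel" for B
  proof (rule ennreal_le_epsilon)
    fix e :: real assume e: "e > 0"
    obtain m' where m': "m = ennreal m'" "m' > 0" using m by (cases m) auto
    define e' where "e' = e / ((1 / a) ^ ?n * m')"
    have e': "e' > 0" using e m' ab by (simp add: e'_def)
    obtain Q where Q: "closed Q" "Q \<subseteq> P B" "emeasure lebesgue (P B - Q) < ennreal e'"
      using sets_lebesgue_inner_closed[OF Pm[OF B] e'] by metis
    have QA: "Q \<subseteq> ?A" using Q by (auto simp: P_def)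
    then have "bounded Q" by (intro bounded_subset[of "ball 0 b" Q]) auto
    then have cQ: "compact Q" using Q compact_eq_bounded_closed by blast
    have Q0: "0 \<notin> Q" using QA ab by auto
    define F where "F = (sgn :: 'a \<Rightarrow> 'a) ` Q"
    have cF: "compact F" unfolding F_def
      using cQ Q0 by (intro compact_continuous_image continuous_on_sgn continuous_on_id) auto
    have FS: "F \<subseteq> E B"
    proof
      fix z assume "z \<in> F"
      then obtain y where y: "y \<in> Q" "z = sgn y" by (auto simp: F_def)
      then have "f z \<in> B" "y \<noteq> 0" using Q(2) Q0 by (auto simp: P_def)
      then show "z \<in> E B" using y by (simp add: E_def norm_sgn)
    qed
    have Qm: "Q \<in> sets lebesgue" using Q by auto
    have "emeasure ?W Q \<le> emeasure L F"
    proof -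
      have "emeasure ?W Q = (\<integral>\<^sup>+y. ennreal (w y) * indicator Q y \<partial>lborel)"
        by (subst emW[OF Qm]) (use Q in \<open>auto simp: nn_integral_completion\<close>)
      also have "\<dots> \<le> (\<integral>\<^sup>+y. ennreal (w y) * indicator F (sgn y) \<partial>lborel)"
        by (intro nn_integral_mono mult_left_mono) (auto simp: F_def indicator_def)
      also have "\<dots> = emeasure L F" using cF by (subst emL) (auto intro: borel_compact)
      finally show ?thesis .
    qed
    then have "emeasure ?W Q * m \<le> emeasure L F * m" by (rule mult_right_mono) simp
    also have "\<dots> \<le> V * emeasure M F" using FS by (intro comp cF) (auto simp: E_def)
    also have "\<dots> \<le> V * emeasure ?H (E B)"
      using FS Em[OF B] cF by (auto intro!: mult_left_mono emeasure_mono simp: emM borel_compact)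
    finally have main: "emeasure ?W Q * m \<le> V * emeasure ?H (E B)" .
    have PQ: "P B - Q \<in> sets lebesgue" using Pm[OF B] Qm by auto
    have small: "emeasure ?W (P B - Q) * m \<le> ennreal e"
    proof -
      have "emeasure ?W (P B - Q) \<le> (\<integral>\<^sup>+y. ennreal ((1 / a) ^ ?n) * indicator (P B - Q) y \<partial>lebesgue)"
        unfolding emW[OF PQ]
        by (intro nn_integral_mono mult_right_mono order_trans[OF ennreal_leI[OF wle]])
           (use ab in \<open>auto simp: indicator_def\<close>)
      also have "\<dots> = ennreal ((1 / a) ^ ?n) * emeasure lebesgue (P B - Q)"
        using PQ by (simp add: nn_integral_cmult_indicator)
      also have "\<dots> \<le> ennreal ((1 / a) ^ ?n) * ennreal e'" using Q(3) by (intro mult_left_mono) auto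
      finally have "emeasure ?W (P B - Q) * m \<le> ennreal ((1 / a) ^ ?n) * ennreal e' * ennreal m'"
        unfolding m'(1) by (rule mult_right_mono) simp
      also have "\<dots> = ennreal e" using ab m' e e' by (simp add: ennreal_mult[symmetric] e'_def field_simps)
      finally show ?thesis .
    qed
    have sub: "emeasure ?W (P B) \<le> emeasure ?W Q + emeasure ?W (P B - Q)"
    proof -
      have "P B = Q \<union> (P B - Q)" using Q by auto
      then show ?thesis using emeasure_subadditive[of Q ?W "P B - Q"] Qm PQ by (metis sets_density)
    qed
    have "emeasure ?W (P B) * m \<le> emeasure ?W Q * m + emeasure ?W (P B - Q) * m"
      unfolding distrib_right[symmetric] by (rule mult_right_mono[OF sub]) simp
    also have "\<dots> \<le> V * emeasure ?H (E B) + ennreal e" using main small by (rule add_mono)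
    finally show "emeasure ?W (P B) * m \<le> V * emeasure ?H (E B) + ennreal e" .
  qed
  \<comment> \<open>Approximation by closed sets from inside is used on the Lebesgue side only and
    yields one inequality. The other follows by applying it to \<open>- B\<close>, because over
    \<open>B\<close> and \<open>- B\<close> both sides add up to \<open>V * m\<close>, which is
    finite.\<close>
  have eq: "emeasure ?W (P B) * m = V * emeasure ?H (E B)" if B: "B \<in> sets borel" for B
  proof (rule antisym)
    show "emeasure ?W (P B) * m \<le> V * emeasure ?H (E B)" using half[OF B] .
    have B': "- B \<in> sets borel" using B by (simp add: borel_comp)
    have s1: "emeasure ?W (P B) + emeasure ?W (P (- B)) = V"
    proof -
      have "P B \<union> P (- B) = ?A" by (auto simp: P_def)
      then show ?thesis using WA Pm[OF B] Pm[OF B']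
        by (subst plus_emeasure) (auto simp: P_def)
    qed
    have s2: "emeasure ?H (E B) + emeasure ?H (E (- B)) = m"
    proof -
      have "E B \<union> E (- B) = ?S" by (auto simp: E_def)
      then show ?thesis using Em[OF B] Em[OF B']
        by (subst plus_emeasure) (auto simp: E_def m_def)
    qed
    have "V * emeasure ?H (E B) + V * emeasure ?H (E (- B)) = emeasure ?W (P B) * m + emeasure ?W (P (- B)) * m"
      by (simp add: s1 s2 distrib_left[symmetric] distrib_right[symmetric])
    also have "\<dots> \<le> emeasure ?W (P B) * m + V * emeasure ?H (E (- B))"
      using half[OF B'] by (rule add_left_mono)
    finally have "V * emeasure ?H (E (- B)) + V * emeasure ?H (E B) \<le> V * emeasure ?H (E (- B)) + emeasure ?W (P B) * m"
      by (simp add: add.commute)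
    moreover have "V * emeasure ?H (E (- B)) < \<infinity>"
    proof -
      have "emeasure ?H (E (- B)) \<le> m" unfolding s2[symmetric] by (simp add: add_increasing)
      then show ?thesis using m Vfin by (auto simp: ennreal_mult_less_top intro: order.strict_trans1)
    qed
    ultimately show "V * emeasure ?H (E B) \<le> emeasure ?W (P B) * m"
      by (auto simp: ennreal_add_left_cancel_le)
  qed

  obtain m' where m': "m = ennreal m'" "m' > 0" using m by (cases m) auto
  obtain v where v: "V = ennreal v" "v \<ge> 0" using Vfin by (cases V) auto
  have fR: "f \<in> borel_measurable (restrict_space ?H ?S)" by (intro measurable_restrict_space1 fH)
  define g where "g y = indicator ?A y *\<^sub>R f (sgn y)" for y
  have gW: "g \<in> borel_measurable (restrict_space ?W ?A)"
    using fsm unfolding g_def by (intro measurable_restrict_space1) simp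
  have AW: "?A \<in> sets ?W" using Ab by simp
  define N1 where "N1 = distr (restrict_space ?H ?S) borel f"
  define N2 where "N2 = distr (restrict_space ?W ?A) borel g"
  \<comment> \<open>The images of the two measures under \<open>f\<close> and \<open>g\<close> are
    proportional, hence so are the integrals of the identity against them; on the sphere that
    integral is the vanishing one of the hypothesis.\<close>
  have "density N1 (\<lambda>_. ennreal v) = density N2 (\<lambda>_. ennreal m')"
  proof (rule measure_eqI)
    fix B assume "B \<in> sets (density N1 (\<lambda>_. ennreal v))"
    then have B: "B \<in> sets borel" by (simp add: N1_def)
    have "emeasure N1 B = emeasure ?H (E B)"
    proof -
      have "f -` B \<inter> ?S = E B" by (auto simp: E_def)
      moreover have "emeasure (restrict_space ?H ?S) (E B) = emeasure ?H (E B)"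
        by (rule emeasure_restrict_space) (use SH in \<open>auto simp: E_def\<close>)
      ultimately show ?thesis using B fR unfolding N1_def
        by (simp add: emeasure_distr space_restrict_space)
    qed
    moreover have "emeasure N2 B = emeasure ?W (P B)"
    proof -
      have "g -` B \<inter> ?A = P B" by (auto simp: P_def g_def)
      moreover have "emeasure (restrict_space ?W ?A) (P B) = emeasure ?W (P B)"
        by (rule emeasure_restrict_space) (use AW in \<open>auto simp: P_def\<close>)
      ultimately show ?thesis using B gW unfolding N2_def
        by (simp add: emeasure_distr space_restrict_space)
    qed
    ultimately show "emeasure (density N1 (\<lambda>_. ennreal v)) B = emeasure (density N2 (\<lambda>_. ennreal m')) B"
      using eq[OF B] B v(1) m'(1)
      by (subst (1 2) emeasure_density) (auto simp: N1_def N2_def nn_integral_cmult_indicator ac_simps)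
  qed (simp add: N1_def N2_def)
  then have "(\<integral>x. x \<partial>density N1 (\<lambda>_. ennreal v)) = (\<integral>x. x \<partial>density N2 (\<lambda>_. ennreal m'))" by simp
  then have i: "v *\<^sub>R (\<integral>x. x \<partial>N1) = m' *\<^sub>R (\<integral>x. x \<partial>N2)"
    using v m' by (simp add: integral_density N1_def N2_def)
  have "(\<integral>x. x \<partial>N1) = (\<integral>y. f y \<partial>restrict_space ?H ?S)"
    unfolding N1_def using fR by (subst integral_distr) auto
  also have "\<dots> = (\<integral>y. indicator ?S y *\<^sub>R f y \<partial>?H)"
    using SH by (subst integral_restrict_space) auto
  also have "\<dots> = (\<integral>y. f y \<partial>?H)"
    by (intro Bochner_Integration.integral_cong) (auto simp: f_def indicator_def)
  also have "\<dots> = 0" using hb by (simp add: has_bochner_integral_iff)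
  finally have "(\<integral>x. x \<partial>N2) = 0" using i m' by simp
  moreover have "(\<integral>x. x \<partial>N2) = (\<integral>y. g y \<partial>restrict_space ?W ?A)"
    unfolding N2_def using gW by (subst integral_distr) auto
  moreover have "\<dots> = (\<integral>y. indicator ?A y *\<^sub>R g y \<partial>?W)"
    using AW by (subst integral_restrict_space) auto
  moreover have "\<dots> = (\<integral>y. w y *\<^sub>R (indicator ?A y *\<^sub>R g y) \<partial>lebesgue)"
  proof -
    have "(\<lambda>y. indicator ?A y *\<^sub>R g y) = (\<lambda>y. indicator ?A y *\<^sub>R f (sgn y))"
      by (auto simp: g_def indicator_def)
    then show ?thesis using w0 fsm by (subst integral_density) auto
  qed
  moreover have "\<dots> = (LINT y:?A|lebesgue. K y *\<^sub>R y)"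
    unfolding set_lebesgue_integral_def
  proof (intro Bochner_Integration.integral_cong refl)
    fix y
    show "w y *\<^sub>R (indicator ?A y *\<^sub>R g y) = indicator ?A y *\<^sub>R K y *\<^sub>R y"
    proof (cases "y \<in> ?A")
      case True
      then have "norm y > 0" using ab by auto
      then have "(1 / norm y) ^ ?n * norm y ^ ?n = 1" by (simp add: power_mult_distrib[symmetric])
      then show ?thesis using True fs[OF True] by (simp add: g_def w_def)
    qed simp
  qed
  ultimately show ?thesis by simp
qed

subsection \<open>Truncated operators\<close>

lemma
  fixes t :: "'a::euclidean_space"
  assumes "\<bar>c\<bar> = 1"
  shows lebesgue_affine_isometry_measurable: "(\<lambda>x. t + c *\<^sub>R x) \<in> lebesgue \<rightarrow>\<^sub>M lebesgue"
    and distr_lebesgue_affine_isometry: "distr lebesgue lebesgue (\<lambda>x. t + c *\<^sub>R x) = lebesgue"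
proof -
  have eq: "(\<lambda>x. t + (\<Sum>j\<in>Basis. (c * (x \<bullet> j)) *\<^sub>R j)) = (\<lambda>x. t + c *\<^sub>R x)"
    unfolding scaleR_scaleR[symmetric] scaleR_sum_right[symmetric] by (simp add: euclidean_representation)
  have c: "c \<noteq> 0" using assms by auto
  show "(\<lambda>x. t + c *\<^sub>R x) \<in> lebesgue \<rightarrow>\<^sub>M lebesgue"
    using lebesgue_affine_measurable[of "\<lambda>_. c" t] c unfolding eq by simp
  show "distr lebesgue lebesgue (\<lambda>x. t + c *\<^sub>R x) = lebesgue"
    using lebesgue_affine_euclidean[of "\<lambda>_. c" t] c assms unfolding eq by (simp add: density_1)
qed

lemma lebesgue_measurable_translation [measurable (raw)]:
  fixes f :: "'a::euclidean_space \<Rightarrow> 'b::topological_space"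
  assumes "f \<in> borel_measurable lebesgue"
  shows "(\<lambda>y. f (x + y)) \<in> borel_measurable lebesgue"
  using measurable_compose[OF lebesgue_affine_isometry_measurable[where c=1 and t=x] assms] by simp

lemma lebesgue_measurable_reflection:
  fixes f :: "'a::euclidean_space \<Rightarrow> 'b::topological_space"
  assumes "f \<in> borel_measurable lebesgue"
  shows "(\<lambda>y. f (x - y)) \<in> borel_measurable lebesgue" "(\<lambda>y. f (- y)) \<in> borel_measurable lebesgue"
  using measurable_compose[OF lebesgue_affine_isometry_measurable[where c="-1" and t=x] assms]
    measurable_compose[OF lebesgue_affine_isometry_measurable[where c="-1" and t=0] assms] by simp_all

lemma nn_integral_lebesgue_translation:
  fixes f :: "'a::euclidean_space \<Rightarrow> ennreal"
  assumes "f \<in> borel_measurable lebesgue"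
  shows "(\<integral>\<^sup>+y. f (x + y) \<partial>lebesgue) = (\<integral>\<^sup>+y. f y \<partial>lebesgue)"
  using nn_integral_distr[OF lebesgue_affine_isometry_measurable[where c=1 and t=x], of f] assms
  by (simp add: distr_lebesgue_affine_isometry[where c=1, simplified])

lemma integrable_lebesgue_translation:
  fixes f :: "'a::euclidean_space \<Rightarrow> 'b::{banach,second_countable_topology}"
  assumes "integrable lebesgue f"
  shows "integrable lebesgue (\<lambda>y. f (x + y))"
  using integrable_distr[OF lebesgue_affine_isometry_measurable[where c=1 and t=x], of f] assms
  by (simp add: distr_lebesgue_affine_isometry[where c=1, simplified])

lemma integral_lebesgue_reflection:
  fixes f :: "'a::euclidean_space \<Rightarrow> 'b::{banach,second_countable_topology}"
  assumes "f \<in> borel_measurable lebesgue"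
  shows "(LINT y|lebesgue. f (- y)) = (LINT y|lebesgue. f y)"
  using integral_distr[OF lebesgue_affine_isometry_measurable[where c="-1" and t=0], of f] assms
  by (simp add: distr_lebesgue_affine_isometry[where c="-1" and t=0, simplified])

lemma borel_measurable_lebesgueI: "f \<in> borel_measurable borel \<Longrightarrow> f \<in> borel_measurable lebesgue"
  by (simp add: measurable_completion)

section \<open>Integrals of powers over dyadic rings\<close>

text \<open>A ball of radius 2 \<rho> has volume
  \<open>unit_ball_vol n * 2 ^ n * \<rho> ^ n\<close>, and the denominator sums the geometric series
  of ratio \<open>2 powr (- \<kappa>)\<close> over the rings.\<close>

definition ring_const :: "nat \<Rightarrow> real \<Rightarrow> real" where
  "ring_const n \<kappa> = unit_ball_vol (real n) * 2 ^ n / (1 - 2 powr (- \<kappa>))"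

lemma ring_const_nonneg: "0 < \<kappa> \<Longrightarrow> 0 \<le> ring_const n \<kappa>"
  using powr_mono[of "- \<kappa>" 0 2] by (simp add: ring_const_def)

text \<open>One statement serves rings shrinking to the origin and rings growing to infinity. Each
  ring is replaced by the ball of radius \<open>2 * \<rho> k\<close>; its volume cancels
  \<open>\<rho> k ^ DIM('a)\<close> and leaves a geometric series. The rings share boundary spheres,
  which is harmless for an upper bound.\<close>

lemma nn_integral_dyadic_rings:
  fixes f :: "'a::euclidean_space \<Rightarrow> real"
  assumes \<kappa>: "0 < \<kappa>" and B: "0 \<le> B" and \<rho>: "\<And>k. 0 < \<rho> k"
    and f: "\<And>k y. \<rho> k \<le> norm y \<Longrightarrow> norm y \<le> 2 * \<rho> k \<Longrightarrow> f y \<le> B * (2 powr (- \<kappa>)) ^ k / \<rho> k ^ DIM('a)"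
    and S: "\<And>y. y \<in> S \<Longrightarrow> y \<noteq> 0 \<Longrightarrow> \<exists>k::nat. \<rho> k \<le> norm y \<and> norm y \<le> 2 * \<rho> k"
  shows "(\<integral>\<^sup>+y. ennreal (f y) * indicator S y \<partial>lebesgue) \<le> ennreal (ring_const DIM('a) \<kappa> * B)"
proof -
  let ?n = "DIM('a)"
  let ?W = "unit_ball_vol (real ?n)"
  define \<theta> where "\<theta> = 2 powr (- \<kappa>)"
  have \<theta>: "0 < \<theta>" "\<theta> < 1" using \<kappa> by (auto simp: \<theta>_def powr_less_one)
  define g where "g k y = ennreal (B * \<theta> ^ k / \<rho> k ^ ?n) * indicator (cball (0::'a) (2 * \<rho> k)) y" for k y
  have gm: "g k \<in> borel_measurable lebesgue" for k
    unfolding g_def by (intro borel_measurable_lebesgueI borel_measurable_times_ennreal borel_measurable_indicator) auto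
  have int: "(\<integral>\<^sup>+y. g k y \<partial>lebesgue) = ennreal (?W * 2 ^ ?n * B * \<theta> ^ k)" for k
  proof -
    have "(\<integral>\<^sup>+y. g k y \<partial>lebesgue) = ennreal (B * \<theta> ^ k / \<rho> k ^ ?n) * emeasure lebesgue (cball (0::'a) (2 * \<rho> k))"
      unfolding g_def by (subst nn_integral_cmult_indicator) auto
    also have "emeasure lebesgue (cball (0::'a) (2 * \<rho> k)) = ennreal (?W * (2 * \<rho> k) ^ ?n)"
      using \<rho>[of k] by (simp add: emeasure_cball)
    also have "ennreal (B * \<theta> ^ k / \<rho> k ^ ?n) * \<dots> = ennreal (B * \<theta> ^ k / \<rho> k ^ ?n * (?W * (2 * \<rho> k) ^ ?n))"
      using \<rho>[of k] B \<theta> by (subst ennreal_mult) auto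
    also have "B * \<theta> ^ k / \<rho> k ^ ?n * (?W * (2 * \<rho> k) ^ ?n) = ?W * 2 ^ ?n * B * \<theta> ^ k"
      using \<rho>[of k] by (simp add: power_mult_distrib field_simps)
    finally show ?thesis .
  qed
  have "(\<integral>\<^sup>+y. ennreal (f y) * indicator S y \<partial>lebesgue) \<le> (\<integral>\<^sup>+y. (\<Sum>k. g k y) \<partial>lebesgue)"
  proof (rule nn_integral_mono_AE)
    have "AE y in lebesgue. y \<noteq> (0::'a)"
      by (rule AE_completion) (rule AE_lborel_singleton)
    then show "AE y in lebesgue. ennreal (f y) * indicator S y \<le> (\<Sum>k. g k y)"
    proof eventually_elim
      fix y :: 'a assume y: "y \<noteq> 0"
      show "ennreal (f y) * indicator S y \<le> (\<Sum>k. g k y)"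
      proof (cases "y \<in> S")
        case True
        then obtain k where k: "\<rho> k \<le> norm y" "norm y \<le> 2 * \<rho> k" using S y by blast
        have "ennreal (f y) \<le> g k y"
          using f[OF k] k by (auto simp: g_def \<theta>_def intro!: ennreal_leI)
        also have "\<dots> \<le> (\<Sum>k. g k y)"
          using sum_le_suminf[of "\<lambda>k. g k y" "{k}"] by simp
        finally show ?thesis using True by simp
      qed simp
    qed
  qed
  also have "\<dots> = (\<Sum>k. ennreal (?W * 2 ^ ?n * B * \<theta> ^ k))"
    using gm by (simp add: nn_integral_suminf int)
  also have "\<dots> = ennreal (ring_const ?n \<kappa> * B)"
  proof (rule suminf_ennreal_eq)
    have "(\<lambda>k. ?W * 2 ^ ?n * B * \<theta> ^ k) sums (?W * 2 ^ ?n * B * (1 / (1 - \<theta>)))"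
      using \<theta> by (intro sums_mult geometric_sums) simp
    then show "(\<lambda>k. ?W * 2 ^ ?n * B * \<theta> ^ k) sums (ring_const ?n \<kappa> * B)"
      by (simp add: ring_const_def \<theta>_def)
  qed (use B \<theta> in auto)
  finally show ?thesis .
qed

lemma ex_dyadic:
  assumes "1 \<le> (x::real)" shows "\<exists>k::nat. 2 ^ k \<le> x \<and> x \<le> 2 * 2 ^ k"
proof -
  define k where "k = nat \<lfloor>log 2 x\<rfloor>"
  have "0 \<le> log 2 x" using assms by simp
  then have k: "real k \<le> log 2 x" "log 2 x \<le> real k + 1" by (auto simp: k_def)
  have "2 powr real k \<le> x" using k(1) assms by (simp add: le_log_iff)
  moreover have "x \<le> 2 powr (real k + 1)" using k(2) assms by (simp add: log_le_iff)
  ultimately show ?thesis by (intro exI[of _ k]) (simp add: powr_realpow powr_add)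
qed

lemma nn_integral_norm_powr_ball:
  assumes \<kappa>: "0 < \<kappa>" and r: "0 < r"
  shows "(\<integral>\<^sup>+y. ennreal (norm (y::'a::euclidean_space) powr (\<kappa> - real DIM('a))) * indicator (ball 0 r) y \<partial>lebesgue)
      \<le> ennreal (ring_const DIM('a) \<kappa> * r powr \<kappa>)"
proof (rule nn_integral_dyadic_rings[where \<rho>="\<lambda>k. r / (2 * 2 ^ k)"])
  fix k :: nat and y :: 'a
  assume y: "r / (2 * 2 ^ k) \<le> norm y" "norm y \<le> 2 * (r / (2 * 2 ^ k))"
  then have y0: "0 < norm y" using r by (meson divide_pos_pos mult_pos_pos order.strict_trans2 zero_less_numeral zero_less_power)
  have "norm y powr (\<kappa> - real DIM('a)) = norm y powr \<kappa> / norm y ^ DIM('a)"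
    using y0 by (simp add: powr_diff powr_realpow)
  also have "\<dots> \<le> (2 * (r / (2 * 2 ^ k))) powr \<kappa> / (r / (2 * 2 ^ k)) ^ DIM('a)"
    using y y0 r \<kappa> by (intro frac_le powr_mono2 power_mono) auto
  also have "(2 * (r / (2 * 2 ^ k))) powr \<kappa> = r powr \<kappa> * (2 powr (- \<kappa>)) ^ k"
  proof -
    have "(2 * (r / (2 * 2 ^ k))) powr \<kappa> = r powr \<kappa> / (2 ^ k) powr \<kappa>" using r by (simp add: powr_divide)
    also have "(2 ^ k) powr \<kappa> = (2::real) powr (real k * \<kappa>)" by (simp add: powr_realpow[symmetric] powr_powr)
    also have "r powr \<kappa> / 2 powr (real k * \<kappa>) = r powr \<kappa> * (2 powr (- \<kappa>)) ^ k"
    proof -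
      have "(2 powr (- \<kappa>)) ^ k = (2::real) powr (- (real k * \<kappa>))"
        by (subst powr_realpow[symmetric]) (auto simp: powr_powr mult.commute)
      then show ?thesis by (simp only: powr_minus_divide) simp
    qed
    finally show ?thesis .
  qed
  finally show "norm y powr (\<kappa> - real DIM('a)) \<le> r powr \<kappa> * (2 powr - \<kappa>) ^ k / (r / (2 * 2 ^ k)) ^ DIM('a)" .
next
  fix y :: 'a assume y: "y \<in> ball 0 r" "y \<noteq> 0"
  then have "1 \<le> r / norm y" by simp
  then obtain k :: nat where "2 ^ k \<le> r / norm y" "r / norm y \<le> 2 * 2 ^ k" using ex_dyadic by blast
  then show "\<exists>k. r / (2 * 2 ^ k) \<le> norm y \<and> norm y \<le> 2 * (r / (2 * 2 ^ k))"
    using y by (intro exI[of _ k]) (simp add: field_simps)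
qed (use r \<kappa> in auto)

lemma nn_integral_norm_powr_tail:
  assumes \<kappa>: "0 < \<kappa>" and r: "0 < r"
  shows "(\<integral>\<^sup>+y. ennreal (norm (y::'a::euclidean_space) powr (- \<kappa> - real DIM('a))) * indicator (- ball 0 r) y \<partial>lebesgue)
      \<le> ennreal (ring_const DIM('a) \<kappa> * r powr (- \<kappa>))"
proof (rule nn_integral_dyadic_rings[where \<rho>="\<lambda>k. r * 2 ^ k"])
  fix k :: nat and y :: 'a
  assume y: "r * 2 ^ k \<le> norm y" "norm y \<le> 2 * (r * 2 ^ k)"
  then have y0: "0 < norm y" using r by (meson mult_pos_pos order.strict_trans2 zero_less_numeral zero_less_power)
  have "norm y powr (- \<kappa> - real DIM('a)) = norm y powr (- \<kappa>) / norm y ^ DIM('a)"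
    using y0 by (simp add: powr_diff powr_realpow)
  also have "\<dots> \<le> (r * 2 ^ k) powr (- \<kappa>) / (r * 2 ^ k) ^ DIM('a)"
    using y y0 r \<kappa> by (intro frac_le powr_mono2' power_mono) auto
  also have "(r * 2 ^ k) powr (- \<kappa>) = r powr (- \<kappa>) * (2 powr (- \<kappa>)) ^ k"
  proof -
    have "(r * 2 ^ k) powr (- \<kappa>) = r powr (- \<kappa>) * (2 ^ k) powr (- \<kappa>)" using r by (simp add: powr_mult)
    also have "(2 ^ k) powr (- \<kappa>) = (2::real) powr (real k * (- \<kappa>))"
      by (simp only: powr_realpow[symmetric, of 2, simplified] powr_powr)
    also have "\<dots> = (2 powr (- \<kappa>)) ^ k"
      by (simp add: powr_realpow[symmetric] powr_powr mult.commute)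
    finally show ?thesis .
  qed
  finally show "norm y powr (- \<kappa> - real DIM('a)) \<le> r powr - \<kappa> * (2 powr - \<kappa>) ^ k / (r * 2 ^ k) ^ DIM('a)" .
next
  fix y :: 'a assume y: "y \<in> - ball 0 r" "y \<noteq> 0"
  then have "1 \<le> norm y / r" using r by simp
  then obtain k :: nat where "2 ^ k \<le> norm y / r" "norm y / r \<le> 2 * 2 ^ k" using ex_dyadic by blast
  then show "\<exists>k. r * 2 ^ k \<le> norm y \<and> norm y \<le> 2 * (r * 2 ^ k)"
    using y r by (intro exI[of _ k]) (simp add: field_simps)
qed (use r \<kappa> in auto)

lemma set_integrable_bound_nn:
  fixes f :: "'a \<Rightarrow> 'b::{banach,second_countable_topology}"
  assumes m: "f \<in> borel_measurable M" and gm: "g \<in> borel_measurable M" and A: "A \<in> sets M"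
    and le: "\<And>y. y \<in> A \<Longrightarrow> norm (f y) \<le> c * g y" and c: "0 \<le> c"
    and int: "(\<integral>\<^sup>+y. ennreal (g y) * indicator A y \<partial>M) \<le> ennreal B" and B: "0 \<le> B"
  shows "set_integrable M A f" and "norm (LINT y:A|M. f y) \<le> c * B"
proof -
  have "(\<integral>\<^sup>+y. ennreal (norm (indicator A y *\<^sub>R f y)) \<partial>M) \<le> (\<integral>\<^sup>+y. ennreal c * (ennreal (g y) * indicator A y) \<partial>M)"
  proof (rule nn_integral_mono)
    fix y show "ennreal (norm (indicator A y *\<^sub>R f y)) \<le> ennreal c * (ennreal (g y) * indicator A y)"
      using le[of y] c by (cases "y \<in> A") (auto simp: ennreal_mult'[symmetric] intro!: ennreal_leI)
  qed
  also have "\<dots> = ennreal c * (\<integral>\<^sup>+y. ennreal (g y) * indicator A y \<partial>M)"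
    using gm A by (intro nn_integral_cmult borel_measurable_times_ennreal borel_measurable_indicator) auto
  also have "\<dots> \<le> ennreal (c * B)" using int c B by (simp add: ennreal_mult mult_left_mono)
  finally have *: "(\<integral>\<^sup>+y. ennreal (norm (indicator A y *\<^sub>R f y)) \<partial>M) \<le> ennreal (c * B)" .
  show si: "set_integrable M A f"
    unfolding set_integrable_def using m A *
    by (intro integrableI_bounded) (auto intro: order.strict_trans1)
  have "ennreal (norm (LINT y:A|M. f y)) \<le> (\<integral>\<^sup>+y. ennreal (norm (indicator A y *\<^sub>R f y)) \<partial>M)"
    using si unfolding set_lebesgue_integral_def set_integrable_def by (rule integral_norm_bound_ennreal)
  also note *
  finally show "norm (LINT y:A|M. f y) \<le> c * B"
    using c B by (simp add: mult_nonneg_nonneg)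
qed

section \<open>Size and cancellation of the kernel\<close>

text \<open>What the estimates retain of an admissible kernel: the condition on the sphere is
  replaced by cancellation over annuli, the form in which the principal value uses it. The class is
  closed under reflection of the argument, so it also covers the dual operator.\<close>

definition elliptic_kernel :: "real \<Rightarrow> real \<Rightarrow> real \<Rightarrow> ('a::euclidean_space \<Rightarrow> real) \<Rightarrow> bool" where
  "elliptic_kernel s lam Lam K \<longleftrightarrow>
     K \<in> borel_measurable lebesgue \<and>
     (\<forall>y. y \<noteq> 0 \<longrightarrow> lam / norm y powr (real DIM('a) + 2 * s) \<le> K y \<and>
                   K y \<le> Lam / norm y powr (real DIM('a) + 2 * s)) \<and>
     (s = 1 / 2 \<longrightarrow> (\<forall>a b. 0 < a \<and> a < b \<longrightarrow> (LINT y:{y. a \<le> norm y \<and> norm y < b}|lebesgue. K y *\<^sub>R y) = 0))"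

text \<open>Compact annuli exhaust the complement of 0 and local integrability makes K measurable on
  each; the value at 0 is added as a function supported at one point.\<close>

lemma admissible_kernel_measurable:
  assumes "admissible_kernel s K"
  shows "K \<in> borel_measurable lebesgue"
proof -
  define A where "A k = cball (0::'a) (real (Suc k)) - ball 0 (1 / real (Suc k))" for k
  have "(\<lambda>y. indicator (A k) y *\<^sub>R K y) \<in> borel_measurable lebesgue" for k
  proof -
    have "compact (A k)" "A k \<subseteq> - {0}" by (auto simp: A_def intro!: compact_diff)
    then have "set_integrable lebesgue (A k) K" using assms by (auto simp: admissible_kernel_def)
    then show ?thesis unfolding set_integrable_def by (rule borel_measurable_integrable)
  qed
  moreover have "(\<lambda>k. indicator (A k) y *\<^sub>R K y) \<longlonglongrightarrow> indicator (- {0}) y *\<^sub>R K y" for y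
  proof (cases "y = 0")
    case False
    obtain m where m: "norm y < real m" using reals_Archimedean2 by blast
    obtain l :: nat where l: "1 / real (Suc l) < norm y" using nat_approx_posE False by (metis zero_less_norm_iff)
    have "eventually (\<lambda>k. indicator (A k) y *\<^sub>R K y = indicator (- {0}) y *\<^sub>R K y) sequentially"
      using eventually_ge_at_top[of "max m l"]
    proof eventually_elim
      case (elim k)
      have "1 / real (Suc k) \<le> 1 / real (Suc l)" using elim by (intro divide_left_mono) auto
      then have "y \<in> A k" using elim m l by (auto simp: A_def)
      then show ?case using False by simp
    qed
    then show ?thesis by (rule tendsto_eventually)
  qed (simp add: A_def)
  ultimately have "(\<lambda>y. indicator (- {0}) y *\<^sub>R K y) \<in> borel_measurable lebesgue"
    by (rule borel_measurable_LIMSEQ_metric)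
  then have "(\<lambda>y. indicator (- {0}) y *\<^sub>R K y + indicator {0} y *\<^sub>R K 0) \<in> borel_measurable lebesgue"
    by (rule borel_measurable_add) (intro borel_measurable_lebesgueI borel_measurable_scaleR borel_measurable_indicator, auto)
  also have "(\<lambda>y. indicator (- {0}) y *\<^sub>R K y + indicator {0} y *\<^sub>R K 0) = K"
    by (auto simp: fun_eq_iff indicator_def)
  finally show ?thesis .
qed

lemma elliptic_kernelI:
  fixes K :: "'a::euclidean_space \<Rightarrow> real"
  assumes K: "admissible_kernel s K" and "0 < lam"
    and bd: "\<And>y. y \<noteq> 0 \<Longrightarrow> lam / norm y powr (real DIM('a) + 2 * s) \<le> K y \<and>
                   K y \<le> Lam / norm y powr (real DIM('a) + 2 * s)"
  shows "elliptic_kernel s lam Lam K"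
proof -
  have m: "K \<in> borel_measurable lebesgue" using K by (rule admissible_kernel_measurable)
  have "lam \<le> K y" if "norm y = 1" for y using bd[of y] that by (cases "y = 0") auto
  then have "(LINT y:{y. a \<le> norm y \<and> norm y < b}|lebesgue. K y *\<^sub>R y) = 0" if "s = 1 / 2" "0 < a" "a < b" for a b
    using annulus_cancellation[of K lam a b] K m that \<open>0 < lam\<close> by auto
  then show ?thesis using m bd by (simp add: elliptic_kernel_def)
qed

lemma set_integral_lebesgue_reflection:
  fixes f :: "'a::euclidean_space \<Rightarrow> 'b::{banach,second_countable_topology}"
  assumes f: "f \<in> borel_measurable lebesgue" and A: "A \<in> sets lebesgue" and sym: "\<And>y. - y \<in> A \<longleftrightarrow> y \<in> A"
  shows "(LINT y:A|lebesgue. f (- y)) = (LINT y:A|lebesgue. f y)"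
proof -
  have "(\<lambda>y. indicator A y *\<^sub>R f y) \<in> borel_measurable lebesgue"
    using f A by (intro borel_measurable_scaleR borel_measurable_indicator) auto
  from integral_lebesgue_reflection[OF this] show ?thesis
    by (simp add: set_lebesgue_integral_def indicator_def sym)
qed

lemma borel_annulus [measurable]: "{y::'a::real_normed_vector. a \<le> norm y \<and> norm y < b} \<in> sets borel"
proof -
  have "{y::'a. a \<le> norm y \<and> norm y < b} = (- ball 0 a) \<inter> ball 0 b" by auto
  then show ?thesis by auto
qed

lemma elliptic_kernel_reflect:
  fixes K :: "'a::euclidean_space \<Rightarrow> real"
  assumes "elliptic_kernel s lam Lam K"
  shows "elliptic_kernel s lam Lam (\<lambda>y. K (- y))"
proof -
  have m [measurable]: "K \<in> borel_measurable lebesgue" using assms by (simp add: elliptic_kernel_def)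
  have "(LINT y:{y. a \<le> norm y \<and> norm y < b}|lebesgue. K (- y) *\<^sub>R y) = 0"
    if s: "s = 1 / 2" "0 < a" "a < b" for a b
  proof -
    have [measurable]: "(\<lambda>y::'a. y) \<in> borel_measurable lebesgue" by (intro borel_measurable_lebesgueI) auto
    have "(LINT y:{y. a \<le> norm y \<and> norm y < b}|lebesgue. K (- y) *\<^sub>R - y) =
        (LINT y:{y. a \<le> norm y \<and> norm y < b}|lebesgue. K y *\<^sub>R y)"
      by (rule set_integral_lebesgue_reflection[where f="\<lambda>y. K y *\<^sub>R y"]) (use borel_annulus in auto)
    also have "\<dots> = 0" using assms s by (simp add: elliptic_kernel_def)
    finally show ?thesis by (simp add: set_lebesgue_integral_def)
  qed
  note c = this
  have bd: "lam / norm y powr (real DIM('a) + 2 * s) \<le> K (- y) \<and>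
      K (- y) \<le> Lam / norm y powr (real DIM('a) + 2 * s)" if "y \<noteq> 0" for y
  proof -
    have "\<forall>y. y \<noteq> 0 \<longrightarrow> lam / norm y powr (real DIM('a) + 2 * s) \<le> K y \<and>
      K y \<le> Lam / norm y powr (real DIM('a) + 2 * s)"
      using assms unfolding elliptic_kernel_def by blast
    from this[rule_format, of "- y"] that show ?thesis by simp
  qed
  show ?thesis
    unfolding elliptic_kernel_def using lebesgue_measurable_reflection(2)[OF m] bd c by blast
qed

section \<open>Splitting the operator into far part, drift and core\<close>

text \<open>Whether the core contains a gradient term. At s = 1/2 the operator itself has none under
  the integral, but inserting one is free there because \<open>K y *\<^sub>R y\<close> has integral
  0 over annuli.\<close>

definition first_order :: "real \<Rightarrow> real" where "first_order s = (if s < 1 / 2 then 0 else 1)"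

text \<open>The order to which the integrand of \<open>core_op\<close> vanishes at
  \<open>y = 0\<close>, apart from the kernel. It exceeds 2 s in all three cases, which makes the
  core absolutely convergent.\<close>

definition taylor_order :: "real \<Rightarrow> real" where "taylor_order s = (if s < 1 / 2 then 1 else 2)"

text \<open>All three cases of the operator are the truncation to \<open>norm y \<ge> r\<close>, corrected by a drift
  depending on \<open>r\<close>, plus an absolutely convergent integral near the origin.\<close>

definition trunc_drift :: "real \<Rightarrow> ('a::euclidean_space \<Rightarrow> real) \<Rightarrow> 'a \<Rightarrow> real \<Rightarrow> 'a" where
  "trunc_drift s K b r =
     (if s < 1 / 2 then 0 else if s = 1 / 2 then b else LINT y:- ball 0 r|lebesgue. K y *\<^sub>R y)"

definition trunc_op ::
  "real \<Rightarrow> ('a::euclidean_space \<Rightarrow> real) \<Rightarrow> 'a \<Rightarrow> real \<Rightarrow> ('a \<Rightarrow> real) \<Rightarrow> 'a \<Rightarrow> 'a \<Rightarrow> real" where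
  "trunc_op s K b r f G x =
     (LINT y:- ball 0 r|lebesgue. (f x - f (x + y)) * K y) + trunc_drift s K b r \<bullet> G"

definition core_op ::
  "real \<Rightarrow> ('a::euclidean_space \<Rightarrow> real) \<Rightarrow> real \<Rightarrow> ('a \<Rightarrow> real) \<Rightarrow> 'a \<Rightarrow> 'a \<Rightarrow> real" where
  "core_op s K r f G x =
     (LINT y:ball 0 r|lebesgue. (f x - f (x + y) + first_order s * (G \<bullet> y)) * K y)"

lemma grad_eqI:
  assumes "(f has_derivative (\<lambda>h. G \<bullet> h)) (at x)"
  shows "grad f x = G"
proof -
  have "frechet_derivative f (at x) = (\<lambda>h. G \<bullet> h)"
    using frechet_derivative_at[OF assms] by simp
  then show ?thesis by (simp add: grad_def euclidean_representation)
qed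

locale fractional_kernel =
  fixes s lam Lam N :: real and K :: "'a::euclidean_space \<Rightarrow> real"
  assumes N_eq: "N = real DIM('a) + 2 * s" and s: "0 < s" "s < 1" and lam: "0 < lam" "lam \<le> Lam" and good: "elliptic_kernel s lam Lam K"
begin

abbreviation "\<kappa> \<equiv> taylor_order s - 2 * s"

abbreviation wt :: "'a \<Rightarrow> real" where "wt x \<equiv> 1 + norm x powr N"

abbreviation mass :: "('a \<Rightarrow> real) \<Rightarrow> ennreal" where
  "mass u \<equiv> \<integral>\<^sup>+x. ennreal (u x / wt x) \<partial>lebesgue"

lemma \<kappa>_pos: "0 < \<kappa>" using s by (auto simp: taylor_order_def)

lemma K_meas [measurable]: "K \<in> borel_measurable lebesgue"
  using good by (simp add: elliptic_kernel_def)

lemma K_lower: "y \<noteq> 0 \<Longrightarrow> lam / norm y powr N \<le> K y"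
  and K_upper: "y \<noteq> 0 \<Longrightarrow> K y \<le> Lam / norm y powr N"
  and K_nonneg: "y \<noteq> 0 \<Longrightarrow> 0 \<le> K y"
proof -
  show "y \<noteq> 0 \<Longrightarrow> lam / norm y powr N \<le> K y" "y \<noteq> 0 \<Longrightarrow> K y \<le> Lam / norm y powr N"
    using good by (auto simp: elliptic_kernel_def N_eq)
  then show "0 \<le> K y" if "y \<noteq> 0" using lam that by (meson divide_nonneg_nonneg less_imp_le order_trans powr_ge_zero)
qed

lemma id_meas [measurable]: "(\<lambda>y::'a. y) \<in> borel_measurable lebesgue"
  by (intro borel_measurable_lebesgueI) auto

lemma norm_powr_meas [measurable]: "(\<lambda>y::'a. norm y powr c) \<in> borel_measurable lebesgue"
  by (intro borel_measurable_lebesgueI) auto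

lemma reflect: "fractional_kernel s lam Lam N (\<lambda>y. K (- y))"
  using N_eq s lam elliptic_kernel_reflect[OF good] by unfold_locales

text \<open>The factor \<open>q\<close> vanishes to order \<open>taylor_order s\<close> and K has
  size - N, so the product is at most a multiple of \<open>norm y powr (\<kappa> - n)\<close>,
  integrable at the origin because \<kappa> > 0.\<close>

lemma taylor_core:
  assumes m: "q \<in> borel_measurable lebesgue" and M: "0 \<le> M" and r: "0 < r"
    and q: "\<And>y. y \<in> ball 0 r \<Longrightarrow> \<bar>q y\<bar> \<le> M * norm y powr taylor_order s"
  shows "set_integrable lebesgue (ball 0 r) (\<lambda>y. q y * K y)"
    and "\<bar>LINT y:ball 0 r|lebesgue. q y * K y\<bar> \<le> M * Lam * (ring_const DIM('a) \<kappa> * r powr \<kappa>)"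
proof -
  have le: "norm (q y * K y) \<le> (M * Lam) * norm y powr (\<kappa> - real DIM('a))" if "y \<in> ball 0 r" for y
  proof (cases "y = 0")
    case True
    then show ?thesis using q[OF that] by (simp add: taylor_order_def)
  next
    case False
    have "norm (q y * K y) \<le> (M * norm y powr taylor_order s) * (Lam / norm y powr N)"
      using q[OF that] K_upper[OF False] K_nonneg[OF False] M unfolding real_norm_def abs_mult
      by (intro mult_mono) auto
    also have "\<dots> = (M * Lam) * norm y powr (\<kappa> - real DIM('a))"
    proof -
      have "\<kappa> - real DIM('a) = taylor_order s - N" by (simp add: N_eq)
      then show ?thesis by (simp only: powr_diff) simp
    qed
    finally show ?thesis .
  qed
  have meas: "(\<lambda>y. q y * K y) \<in> borel_measurable lebesgue" using m by measurable
  note * = set_integrable_bound_nn[OF meas norm_powr_meas _ le _ nn_integral_norm_powr_ball[OF \<kappa>_pos r]]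
  show "set_integrable lebesgue (ball 0 r) (\<lambda>y. q y * K y)"
    using M lam ring_const_nonneg[OF \<kappa>_pos] by (intro *(1)) auto
  show "\<bar>LINT y:ball 0 r|lebesgue. q y * K y\<bar> \<le> M * Lam * (ring_const DIM('a) \<kappa> * r powr \<kappa>)"
    unfolding real_norm_def[symmetric]
    using M lam ring_const_nonneg[OF \<kappa>_pos] by (intro *(2)) auto
qed

text \<open>Values in a Banach space let the same bound serve scalar differences of functions and
  the vector \<open>y\<close> cut off to an annulus.\<close>

lemma tail_bound:
  fixes q :: "'a \<Rightarrow> 'b::{banach,second_countable_topology}"
  assumes m: "q \<in> borel_measurable lebesgue" and M: "0 \<le> M" and r: "0 < r"
    and q: "\<And>y. y \<in> - ball 0 r \<Longrightarrow> norm (q y) \<le> M"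
  shows "set_integrable lebesgue (- ball 0 r) (\<lambda>y. K y *\<^sub>R q y)"
    and "norm (LINT y:- ball 0 r|lebesgue. K y *\<^sub>R q y) \<le> M * Lam * (ring_const DIM('a) (2 * s) * r powr (- 2 * s))"
proof -
  have le: "norm (K y *\<^sub>R q y) \<le> (M * Lam) * norm y powr (- (2 * s) - real DIM('a))" if "y \<in> - ball 0 r" for y
  proof -
    have y: "y \<noteq> 0" using that r by auto
    have "norm (K y *\<^sub>R q y) \<le> (Lam / norm y powr N) * M"
      using q[OF that] K_upper[OF y] K_nonneg[OF y] M unfolding norm_scaleR
      by (intro mult_mono) auto
    also have "\<dots> = (M * Lam) * norm y powr (- (2 * s) - real DIM('a))"
    proof -
      have "- (2 * s) - real DIM('a) = - N" by (simp add: N_eq)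
      then show ?thesis by (simp only: powr_minus_divide) simp
    qed
    finally show ?thesis .
  qed
  have meas: "(\<lambda>y. K y *\<^sub>R q y) \<in> borel_measurable lebesgue" using m by measurable
  have s2: "0 < 2 * s" using s by simp
  note * = set_integrable_bound_nn[OF meas norm_powr_meas _ le _ nn_integral_norm_powr_tail[OF s2 r]]
  show "set_integrable lebesgue (- ball 0 r) (\<lambda>y. K y *\<^sub>R q y)"
    using M lam ring_const_nonneg[OF s2] by (intro *(1)) auto
  have "norm (LINT y:- ball 0 r|lebesgue. K y *\<^sub>R q y) \<le> M * Lam * (ring_const DIM('a) (2 * s) * r powr (- (2 * s)))"
    using M lam ring_const_nonneg[OF s2] by (intro *(2)) auto
  then show "norm (LINT y:- ball 0 r|lebesgue. K y *\<^sub>R q y) \<le> M * Lam * (ring_const DIM('a) (2 * s) * r powr (- 2 * s))"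
    by simp
qed

lemma kernel_far_integrable: "0 < r \<Longrightarrow> set_integrable lebesgue (- ball 0 r) K"
  using tail_bound(1)[of "\<lambda>_. 1::real" 1 r] by simp

lemma set_integral_inner_kernel:
  assumes "set_integrable lebesgue A (\<lambda>y. K y *\<^sub>R y)"
  shows "set_integrable lebesgue A (\<lambda>y. (G \<bullet> y) * K y)"
    and "(LINT y:A|lebesgue. (G \<bullet> y) * K y) = (LINT y:A|lebesgue. K y *\<^sub>R y) \<bullet> G"
proof -
  have i: "integrable lebesgue (\<lambda>y. indicator A y *\<^sub>R (K y *\<^sub>R y))" using assms by (simp add: set_integrable_def)
  have eq: "(\<lambda>y. indicator A y *\<^sub>R (G \<bullet> y * K y)) = (\<lambda>y. (indicator A y *\<^sub>R (K y *\<^sub>R y)) \<bullet> G)"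
    by (auto simp: fun_eq_iff inner_commute mult_ac)
  show "set_integrable lebesgue A (\<lambda>y. (G \<bullet> y) * K y)"
    unfolding set_integrable_def eq using i by (rule integrable_inner_left)
  show "(LINT y:A|lebesgue. (G \<bullet> y) * K y) = (LINT y:A|lebesgue. K y *\<^sub>R y) \<bullet> G"
    unfolding set_lebesgue_integral_def eq using i by (rule integral_inner_left)
qed

lemma drift_bound:
  assumes s: "1 / 2 < s" and r: "0 < r"
  shows "set_integrable lebesgue (- ball 0 r) (\<lambda>y. K y *\<^sub>R y)"
    and "norm (LINT y:- ball 0 r|lebesgue. K y *\<^sub>R y) \<le> Lam * (ring_const DIM('a) (2 * s - 1) * r powr (1 - 2 * s))"
proof -
  have le: "norm (K y *\<^sub>R y) \<le> Lam * norm y powr (- (2 * s - 1) - real DIM('a))" if "y \<in> - ball 0 r" for y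
  proof -
    have y: "y \<noteq> 0" using that r by auto
    have "norm (K y *\<^sub>R y) \<le> (Lam / norm y powr N) * norm y"
      using K_upper[OF y] K_nonneg[OF y] unfolding norm_scaleR by (intro mult_mono) auto
    also have "\<dots> = Lam * norm y powr (- (2 * s - 1) - real DIM('a))"
    proof -
      have "- (2 * s - 1) - real DIM('a) = 1 - N" by (simp add: N_eq)
      then show ?thesis using y by (simp only: powr_diff) simp
    qed
    finally show ?thesis .
  qed
  have meas: "(\<lambda>y. K y *\<^sub>R y) \<in> borel_measurable lebesgue" by measurable
  have s2: "0 < 2 * s - 1" using s by simp
  note * = set_integrable_bound_nn[OF meas norm_powr_meas _ le _ nn_integral_norm_powr_tail[OF s2 r]]
  show "set_integrable lebesgue (- ball 0 r) (\<lambda>y. K y *\<^sub>R y)"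
    using lam ring_const_nonneg[OF s2] by (intro *(1)) auto
  have "norm (LINT y:- ball 0 r|lebesgue. K y *\<^sub>R y) \<le> Lam * (ring_const DIM('a) (2 * s - 1) * r powr (- (2 * s - 1)))"
    using lam ring_const_nonneg[OF s2] by (intro *(2)) auto
  then show "norm (LINT y:- ball 0 r|lebesgue. K y *\<^sub>R y) \<le> Lam * (ring_const DIM('a) (2 * s - 1) * r powr (1 - 2 * s))"
    by simp
qed

lemma annulus_integrable:
  assumes r: "0 < r" shows "set_integrable lebesgue {y. r \<le> norm y \<and> norm y < R} (\<lambda>y. K y *\<^sub>R y)"
proof -
  let ?A = "{y::'a. r \<le> norm y \<and> norm y < R}"
  have "set_integrable lebesgue (- ball 0 r) (\<lambda>y. K y *\<^sub>R (indicator ?A y *\<^sub>R y))"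
  proof (rule tail_bound(1)[where M="max 0 R"])
    show "(\<lambda>y. indicator ?A y *\<^sub>R y) \<in> borel_measurable lebesgue"
      by (intro borel_measurable_lebesgueI borel_measurable_scaleR borel_measurable_indicator borel_annulus) auto
  qed (use r in \<open>auto simp: indicator_def\<close>)
  moreover have "(\<lambda>y. indicator (- ball 0 r) y *\<^sub>R K y *\<^sub>R (indicator ?A y *\<^sub>R y)) = (\<lambda>y. indicator ?A y *\<^sub>R K y *\<^sub>R y)"
    by (auto simp: fun_eq_iff indicator_def)
  ultimately show ?thesis by (simp add: set_integrable_def)
qed

text \<open>Changing the truncation radius moves the first moment of the annulus in between into the
  drift. The identity also holds for s \<le> 1/2: below 1/2 the factor \<open>first_order s\<close>
  is 0, and at 1/2 the moment vanishes.\<close>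

lemma trunc_drift_split:
  assumes "0 < r" "r < R"
  shows "trunc_drift s K b r = trunc_drift s K b R + first_order s *\<^sub>R (LINT y:{y. r \<le> norm y \<and> norm y < R}|lebesgue. K y *\<^sub>R y)"
proof -
  let ?A = "{y::'a. r \<le> norm y \<and> norm y < R}"
  consider "s < 1/2" | "s = 1/2" | "1/2 < s" by linarith
  then show ?thesis
  proof cases
    case 3
    have U: "- ball 0 r = - ball 0 R \<union> ?A" "- ball 0 R \<inter> ?A = {}" using assms by auto
    have "(LINT y:- ball 0 r|lebesgue. K y *\<^sub>R y) = (LINT y:- ball 0 R|lebesgue. K y *\<^sub>R y) + (LINT y:?A|lebesgue. K y *\<^sub>R y)"
      unfolding U(1) using assms 3 by (intro set_integral_Un U(2) drift_bound annulus_integrable) auto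
    then show ?thesis using 3 by (simp add: trunc_drift_def first_order_def)
  qed (use assms good in \<open>auto simp: trunc_drift_def first_order_def elliptic_kernel_def\<close>)
qed

lemma trunc_drift_reflect: "trunc_drift s (\<lambda>y. K (- y)) (- b) r = - trunc_drift s K b r"
proof -
  have "(LINT y:- ball 0 r|lebesgue. K (- y) *\<^sub>R - y) = (LINT y:- ball 0 r|lebesgue. K y *\<^sub>R y)"
    by (rule set_integral_lebesgue_reflection[where f="\<lambda>y. K y *\<^sub>R y"]) auto
  moreover have "(LINT y:- ball 0 r|lebesgue. K (- y) *\<^sub>R - y) = - (LINT y:- ball 0 r|lebesgue. K (- y) *\<^sub>R y)"
    by (simp add: set_lebesgue_integral_def)
  ultimately have "(LINT y:- ball 0 r|lebesgue. K (- y) *\<^sub>R y) = - (LINT y:- ball 0 r|lebesgue. K y *\<^sub>R y)"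
    using minus_equation_iff[THEN iffD1, symmetric] by (simp only:)
  then show ?thesis by (simp add: trunc_drift_def)
qed

text \<open>For s < 1/2 only the domain is split; for s > 1/2 the far part of the gradient term is
  the truncated drift. For s = 1/2 the proof must also show that the limit inside \<open>Lim\<close>
  exists, which the shrinking of the core provides.\<close>

lemma nonlocal_op_split:
  assumes f: "f \<in> borel_measurable lebesgue" and r: "0 < r" and M: "0 \<le> M"
    and d: "(f has_derivative (\<lambda>h. G \<bullet> h)) (at x)"
    and far: "set_integrable lebesgue (- ball 0 r) (\<lambda>y. (f x - f (x + y)) * K y)"
    and near: "\<And>y. y \<in> ball 0 r \<Longrightarrow> \<bar>f x - f (x + y) + first_order s * (G \<bullet> y)\<bar> \<le> M * norm y powr taylor_order s"
  shows "nonlocal_op s K b f x = trunc_op s K b r f G x + core_op s K r f G x"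
    and "\<bar>core_op s K r f G x\<bar> \<le> M * Lam * (ring_const DIM('a) \<kappa> * r powr \<kappa>)"
proof -
  let ?q = "\<lambda>y. f x - f (x + y) + first_order s * (G \<bullet> y)"
  have fx: "(\<lambda>y. f (x + y)) \<in> borel_measurable lebesgue" using f by (rule lebesgue_measurable_translation)
  have Gm: "(\<lambda>y. G \<bullet> y) \<in> borel_measurable lebesgue" by (intro borel_measurable_lebesgueI) auto
  have qm: "?q \<in> borel_measurable lebesgue" using fx Gm by measurable
  note core = taylor_core[OF qm M _ near]
  show "\<bar>core_op s K r f G x\<bar> \<le> M * Lam * (ring_const DIM('a) \<kappa> * r powr \<kappa>)"
    unfolding core_op_def using core(2)[OF r] by simp
  have U: "- ball 0 r \<union> ball (0::'a) r = UNIV" "- ball 0 r \<inter> ball (0::'a) r = {}" by auto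
  note KGi = set_integral_inner_kernel(1)[where G=G] and KG = set_integral_inner_kernel(2)[where G=G]
  consider "s < 1/2" | "s = 1/2" | "1/2 < s" by linarith
  then show "nonlocal_op s K b f x = trunc_op s K b r f G x + core_op s K r f G x"
  proof cases
    case 1
    have "(LINT y|lebesgue. (f x - f (x + y)) * K y) = (LINT y:- ball 0 r \<union> ball 0 r|lebesgue. (f x - f (x + y)) * K y)"
      unfolding U by (simp add: set_lebesgue_integral_def)
    also have "\<dots> = (LINT y:- ball 0 r|lebesgue. (f x - f (x + y)) * K y) + (LINT y:ball 0 r|lebesgue. (f x - f (x + y)) * K y)"
      using core(1)[OF r] 1 by (intro set_integral_Un U far) (auto simp: first_order_def)
    finally show ?thesis using 1 by (simp add: nonlocal_op_def trunc_op_def trunc_drift_def core_op_def first_order_def)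
  next
    case 3
    have drift: "set_integrable lebesgue (- ball 0 r) (\<lambda>y. K y *\<^sub>R y)" using drift_bound(1)[OF 3 r] .
    have "(LINT y|lebesgue. (f x - f (x + y) + grad f x \<bullet> y) * K y) = (LINT y:- ball 0 r \<union> ball 0 r|lebesgue. ?q y * K y)"
      unfolding U grad_eqI[OF d] using 3 by (simp add: set_lebesgue_integral_def first_order_def)
    also have "\<dots> = (LINT y:- ball 0 r|lebesgue. ?q y * K y) + core_op s K r f G x"
      unfolding core_op_def
    proof (intro set_integral_Un U core(1)[OF r])
      have "set_integrable lebesgue (- ball 0 r) (\<lambda>y. (f x - f (x + y)) * K y + (G \<bullet> y) * K y)"
        using far KGi[OF drift] by (rule set_integral_add(1))
      then show "set_integrable lebesgue (- ball 0 r) (\<lambda>y. ?q y * K y)"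
        using 3 by (simp add: first_order_def distrib_right)
    qed auto
    also have "(LINT y:- ball 0 r|lebesgue. ?q y * K y) = (LINT y:- ball 0 r|lebesgue. (f x - f (x + y)) * K y + (G \<bullet> y) * K y)"
      using 3 by (simp add: first_order_def distrib_right)
    also have "\<dots> = (LINT y:- ball 0 r|lebesgue. (f x - f (x + y)) * K y) + (LINT y:- ball 0 r|lebesgue. (G \<bullet> y) * K y)"
      using far KGi[OF drift] by (rule set_integral_add(2))
    finally show ?thesis using 3 KG[OF drift]
      by (simp add: nonlocal_op_def trunc_op_def trunc_drift_def)
  next
    case 2
    have fo: "first_order s = 1" using 2 by (simp add: first_order_def)
    \<comment> \<open>Over the annulus between \<open>e\<close> and \<open>r\<close> the gradient
      term integrates to 0, so it can be inserted and the annulus reads as a difference of two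
      cores.\<close>
    have trunc: "(LINT y:- ball 0 e|lebesgue. (f x - f (x + y)) * K y) =
       (LINT y:- ball 0 r|lebesgue. (f x - f (x + y)) * K y) + core_op s K r f G x - core_op s K e f G x"
      if e: "0 < e" "e < r" for e
    proof -
      let ?A = "{y::'a. e \<le> norm y \<and> norm y < r}"
      have V: "- ball 0 e = - ball 0 r \<union> ?A" "- ball 0 r \<inter> ?A = {}" "ball 0 r = ball 0 e \<union> ?A" "ball 0 e \<inter> ?A = {}"
        using e by auto
      have i1: "set_integrable lebesgue (ball 0 e) (\<lambda>y. ?q y * K y)"
        using near e by (intro core(1)) auto
      have i2: "set_integrable lebesgue ?A (\<lambda>y. ?q y * K y)"
        by (rule set_integrable_subset[OF core(1)[OF r]]) (auto intro: borel_annulus)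
      have A: "set_integrable lebesgue ?A (\<lambda>y. K y *\<^sub>R y)" using e by (intro annulus_integrable)
      have i3: "set_integrable lebesgue ?A (\<lambda>y. ?q y * K y - (G \<bullet> y) * K y)"
        using i2 KGi[OF A] by (rule set_integral_diff(1))
      have eq: "(\<lambda>y. ?q y * K y - (G \<bullet> y) * K y) = (\<lambda>y. (f x - f (x + y)) * K y)"
        by (auto simp: fun_eq_iff fo algebra_simps)
      have "(LINT y:?A|lebesgue. K y *\<^sub>R y) = 0" using good 2 e by (simp add: elliptic_kernel_def)
      then have z: "(LINT y:?A|lebesgue. (f x - f (x + y)) * K y) = (LINT y:?A|lebesgue. ?q y * K y)"
        using set_integral_diff(2)[OF i2 KGi[OF A]] KG[OF A] unfolding eq by simp
      have "core_op s K r f G x = core_op s K e f G x + (LINT y:?A|lebesgue. ?q y * K y)"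
        unfolding core_op_def V(3) by (intro set_integral_Un V(4) i1 i2)
      moreover have "(LINT y:- ball 0 e|lebesgue. (f x - f (x + y)) * K y) =
         (LINT y:- ball 0 r|lebesgue. (f x - f (x + y)) * K y) + (LINT y:?A|lebesgue. (f x - f (x + y)) * K y)"
        unfolding V(1) using i3 unfolding eq by (intro set_integral_Un V(2) far)
      ultimately show ?thesis using z by simp
    qed
    have small: "((\<lambda>e. core_op s K e f G x) \<longlongrightarrow> 0) (at_right 0)"
    proof (rule Lim_null_comparison)
      show "eventually (\<lambda>e. norm (core_op s K e f G x) \<le> M * Lam * (ring_const DIM('a) \<kappa> * e powr \<kappa>)) (at_right 0)"
        using eventually_at_right_less[of 0] eventually_at_right_real[OF r]
      proof eventually_elim
        case (elim e)
        then show ?case unfolding core_op_def real_norm_def using near by (intro core(2)) auto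
      qed
      have "((\<lambda>e. M * Lam * (ring_const DIM('a) \<kappa> * e powr \<kappa>)) \<longlongrightarrow> M * Lam * (ring_const DIM('a) \<kappa> * 0)) (at_right 0)"
        using \<kappa>_pos by (intro tendsto_intros) (auto intro!: tendsto_zero_powrI tendsto_intros eventually_mono[OF eventually_at_right_less])
      then show "((\<lambda>e. M * Lam * (ring_const DIM('a) \<kappa> * e powr \<kappa>)) \<longlongrightarrow> 0) (at_right 0)" by simp
    qed
    have "((\<lambda>e. (LINT y:- ball 0 r|lebesgue. (f x - f (x + y)) * K y) + core_op s K r f G x - core_op s K e f G x) \<longlongrightarrow>
        (LINT y:- ball 0 r|lebesgue. (f x - f (x + y)) * K y) + core_op s K r f G x - 0) (at_right 0)"
      by (intro tendsto_intros small)
    then have "((\<lambda>e. LINT y:- ball 0 e|lebesgue. (f x - f (x + y)) * K y) \<longlongrightarrow>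
        (LINT y:- ball 0 r|lebesgue. (f x - f (x + y)) * K y) + core_op s K r f G x - 0) (at_right 0)"
      by (rule Lim_transform_eventually) (use eventually_at_right_real[OF r] in \<open>eventually_elim, simp add: trunc\<close>)
    then have "Lim (at_right 0) (\<lambda>e. LINT y:- ball 0 e|lebesgue. (f x - f (x + y)) * K y) =
        (LINT y:- ball 0 r|lebesgue. (f x - f (x + y)) * K y) + core_op s K r f G x"
      by (intro tendsto_Lim) auto
    moreover have c: "(s < 1 / 2) = False" "(s = 1 / 2) = True" using 2 by auto
    ultimately show ?thesis
      unfolding nonlocal_op_def trunc_op_def trunc_drift_def grad_eqI[OF d] c if_False if_True by simp
  qed
qed

end

subsection \<open>The contact argument\<close>

text \<open>Otherwise each \<open>x\<close> has a strictly better point \<open>m x\<close>, and by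
  semicontinuity \<open>g\<close> exceeds \<open>g (m x)\<close> on a ball around \<open>x\<close>.
  Among finitely many such balls covering \<open>S\<close>, take the centre with the least
  \<open>g (m x)\<close>: its \<open>m x\<close> lies in one of the balls, whose centre then has a
  smaller value.\<close>

lemma lower_semicontinuous_attains_inf:
  fixes g :: "'a::metric_space \<Rightarrow> real"
  assumes S: "compact S" "S \<noteq> {}" and lsc: "\<And>x c. x \<in> S \<Longrightarrow> c < g x \<Longrightarrow> eventually (\<lambda>z. c < g z) (at x within S)"
  shows "\<exists>x\<in>S. \<forall>y\<in>S. g x \<le> g y"
proof (rule ccontr)
  assume "\<not> ?thesis"
  then have "\<forall>x\<in>S. \<exists>y\<in>S. g y < g x" by (auto simp: not_le)
  then obtain m where m: "\<And>x. x \<in> S \<Longrightarrow> m x \<in> S \<and> g (m x) < g x" by metis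
  have "\<forall>x\<in>S. \<exists>e>0. \<forall>z\<in>S. dist z x < e \<longrightarrow> g (m x) < g z"
  proof
    fix x assume x: "x \<in> S"
    then have "eventually (\<lambda>z. g (m x) < g z) (at x within S)" using lsc m by blast
    then obtain e where e: "e > 0" "\<And>z. z \<in> S \<Longrightarrow> z \<noteq> x \<Longrightarrow> dist z x < e \<Longrightarrow> g (m x) < g z"
      by (auto simp: eventually_at)
    then have "\<forall>z\<in>S. dist z x < e \<longrightarrow> g (m x) < g z" using m[OF x] by metis
    then show "\<exists>e>0. \<forall>z\<in>S. dist z x < e \<longrightarrow> g (m x) < g z" using e(1) by blast
  qed
  then obtain e where e: "\<And>x. x \<in> S \<Longrightarrow> e x > 0" "\<And>x z. x \<in> S \<Longrightarrow> z \<in> S \<Longrightarrow> dist z x < e x \<Longrightarrow> g (m x) < g z" by metis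
  have "S \<subseteq> (\<Union>x\<in>S. ball x (e x))" using e(1) by force
  then obtain D where D: "D \<subseteq> S" "finite D" "S \<subseteq> (\<Union>x\<in>D. ball x (e x))"
    using compactE_image[OF S(1), of S "\<lambda>x. ball x (e x)"] by auto
  then have "D \<noteq> {}" using S(2) by auto
  then have "Min ((\<lambda>x. g (m x)) ` D) \<in> (\<lambda>x. g (m x)) ` D" using D(2) by (intro Min_in) auto
  then obtain x where x': "x \<in> D" "Min ((\<lambda>x. g (m x)) ` D) = g (m x)" by blast
  then have x: "x \<in> D" "\<And>y. y \<in> D \<Longrightarrow> g (m x) \<le> g (m y)"
    using D(2) Min_le[of "(\<lambda>x. g (m x)) ` D"] by auto
  have "m x \<in> S" using m x D by blast
  then obtain y where y: "y \<in> D" "dist (m x) y < e y" using D by (auto simp: dist_commute)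
  then have "g (m y) < g (m x)" using e(2) D \<open>m x \<in> S\<close> by blast
  then show False using x(2)[OF y(1)] by simp
qed

text \<open>Slide the paraboloid \<open>t (9/16 - norm x ^ 2)\<close>, nonpositive off \<open>ball 0 (3/4)\<close>, down until it
  touches the graph of \<open>w\<close> from below.\<close>

lemma contact_point:
  fixes w :: "'a::euclidean_space \<Rightarrow> real"
  assumes lsc: "lower_semicontinuous_on (ball 0 1) w" and pos: "\<And>x. 0 \<le> w x"
    and x1: "norm x1 < 1 / 2" "w x1 < c"
  obtains x0 d where "norm x0 < 3 / 4" "0 \<le> d" "w x0 = 16 / 5 * c * (9 / 16 - (norm x0)\<^sup>2) - d"
    "\<And>x. 16 / 5 * c * (9 / 16 - (norm x)\<^sup>2) - d \<le> w x"
proof -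
  define p where "p x = 16 / 5 * c * (9 / 16 - (norm x)\<^sup>2)" for x :: 'a
  have c: "0 < c" using pos[of x1] x1 by simp
  let ?S = "cball (0::'a) (3 / 4)"
  have "\<exists>x\<in>?S. \<forall>y\<in>?S. w x - p x \<le> w y - p y"
  proof (rule lower_semicontinuous_attains_inf)
    fix x a assume x: "x \<in> ?S" and a: "a < w x - p x"
    define e where "e = (w x - p x - a) / 2"
    have e: "e > 0" using a by (simp add: e_def)
    have "isCont p x" unfolding p_def by (intro continuous_intros)
    then have "(p \<longlongrightarrow> p x) (at x within ?S)"
      by (metis isCont_def subset_UNIV tendsto_within_subset)
    then have 1: "eventually (\<lambda>z. p z < p x + e) (at x within ?S)"
      using e by (intro order_tendstoD) auto
    have "eventually (\<lambda>z. w x - e < w z) (at x within ball 0 1)"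
      using lsc x e by (auto simp: lower_semicontinuous_on_def)
    then have 2: "eventually (\<lambda>z. w x - e < w z) (at x within ?S)"
      by (rule filter_leD[rotated]) (intro at_le, auto)
    show "eventually (\<lambda>z. a < w z - p z) (at x within ?S)"
      using 1 2 by eventually_elim (simp add: e_def field_simps)
  qed auto
  then obtain x0 where x0: "x0 \<in> ?S" "\<And>y. y \<in> ?S \<Longrightarrow> w x0 - p x0 \<le> w y - p y" by blast
  \<comment> \<open>Here 9/16 = (3/4)^2 and 9/16 - (1/2)^2 = 5/16, so the factor 16/5 is what lifts
    the paraboloid above \<open>c\<close>, hence above \<open>w x1\<close>, at the point
    \<open>x1\<close> of the half ball.\<close>
  have "(norm x1)\<^sup>2 < (1 / 2)\<^sup>2" using x1 by (intro power_strict_mono) auto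
  then have "5 / 16 < 9 / 16 - (norm x1)\<^sup>2" by (simp add: power2_eq_square)
  then have "16 / 5 * c * (5 / 16) < p x1" unfolding p_def using c by (intro mult_strict_left_mono) auto
  then have neg: "w x0 - p x0 < 0" using x0(2)[of x1] x1 by auto
  have out: "p x \<le> 0" if "3 / 4 \<le> norm x" for x
  proof -
    have "(3 / 4)\<^sup>2 \<le> (norm x)\<^sup>2" using that by (intro power_mono) auto
    then show ?thesis unfolding p_def using c by (intro mult_nonneg_nonpos) (auto simp: power2_eq_square)
  qed
  have "norm x0 < 3 / 4" using out[of x0] neg pos[of x0] by (cases "norm x0 < 3 / 4") auto
  moreover have "p x - (p x0 - w x0) \<le> w x" for x
  proof (cases "x \<in> ?S")
    case True then show ?thesis using x0(2) by fastforce
  next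
    case False then show ?thesis using out[of x] neg pos[of x] by auto
  qed
  ultimately show thesis using that[of x0 "p x0 - w x0"] neg unfolding p_def by auto
qed

section \<open>The estimate at a contact point\<close>

text \<open>The prefactor is the reciprocal of the ellipticity constant relative to the weight. The
  terms in the bracket are the right-hand side of the equation, the paraboloid near the contact
  point, the loss in the unit ball, the tail, and the drift at radius 1. The absolute value makes
  one formula cover s < 1/2, where \<open>ring_const n (2 * s - 1)\<close> is negative.\<close>

definition harnack_const :: "nat \<Rightarrow> real \<Rightarrow> real \<Rightarrow> real \<Rightarrow> real" where
  "harnack_const n s lam Lam = 2 powr (real n + 2 * s) / lam *
     (1 + 3 * Lam * ring_const n (taylor_order s - 2 * s) + Lam * unit_ball_vol (real n) + Lam * ring_const n (2 * s)
      + 2 * (Lam + Lam * \<bar>ring_const n (2 * s - 1)\<bar>))"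

context fractional_kernel begin

lemma N_pos: "0 < N" using s by (simp add: N_eq)

lemma ring_consts_nonneg: "0 \<le> ring_const DIM('a) \<kappa>" "0 \<le> ring_const DIM('a) (2 * s)"
  using ring_const_nonneg \<kappa>_pos s by auto

lemma weight_ge: "1 \<le> wt (x::'a)" by simp

lemma weight_pos: "0 < wt (x::'a)"
  using powr_ge_zero[of "norm x" N] by linarith

lemma weight_compare:
  assumes "norm y \<le> norm z + 1" shows "norm (y::'a) powr N \<le> 2 powr N * wt (z::'a)"
proof -
  have "norm y \<le> 2 * max 1 (norm z)" using assms by (auto simp: max_def)
  then have "norm y powr N \<le> (2 * max 1 (norm z)) powr N" using N_pos by (intro powr_mono2) auto
  also have "\<dots> = 2 powr N * max 1 (norm z) powr N" by (rule powr_mult)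
  also have "max 1 (norm z) powr N \<le> wt z" by (simp add: max_def)
  finally show ?thesis by simp
qed

text \<open>The way the lower bound on K enters: applied with \<open>z = x0 + y\<close>, where norm
  x0 < 3/4, it makes the kernel centred at the contact point dominate the weight centred at the
  origin.\<close>

lemma kernel_weight:
  assumes "norm y \<le> norm z + 1" "(y::'a) \<noteq> 0"
  shows "lam / 2 powr N / wt (z::'a) \<le> K y"
proof -
  have "lam / (2 powr N * wt z) \<le> lam / norm y powr N"
    using weight_compare[OF assms(1)] weight_pos[of z] lam assms(2) by (intro divide_left_mono) auto
  then show ?thesis using K_lower[OF assms(2)] by simp
qed

lemma weight_meas [measurable]: "(\<lambda>x::'a. wt x) \<in> borel_measurable lebesgue"
  by (intro borel_measurable_lebesgueI) auto

lemma far_integrable: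
  assumes w: "integrable lebesgue (\<lambda>x. w x / wt x)" and wm: "w \<in> borel_measurable lebesgue" and r: "0 < r"
  shows "set_integrable lebesgue (- ball 0 r) (\<lambda>y. w (x0 + y) * K y)"
proof -
  \<comment> \<open>For norm y \<ge> r, both 1 \<le> norm y / r and norm (x0 + y) \<le> (1 + norm x0
    / r) norm y hold, so the weight at \<open>x0 + y\<close> is at most the bracket times
    \<open>norm y powr N\<close>.\<close>
  define c where "c = Lam * ((1 / r) powr N + (1 + norm x0 / r) powr N)"
  have i: "integrable lebesgue (\<lambda>y. c *\<^sub>R (w (x0 + y) / wt (x0 + y)))"
    using integrable_lebesgue_translation[OF w] by (rule integrable_scaleR_right)
  have wm' [measurable]: "(\<lambda>y. w (x0 + y)) \<in> borel_measurable lebesgue"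
    using wm by (rule lebesgue_measurable_translation)
  have [measurable]: "ball (0::'a) r \<in> sets lebesgue" by auto
  show ?thesis
    unfolding set_integrable_def
  proof (rule Bochner_Integration.integrable_bound[OF i])
    show "AE y in lebesgue. norm (indicator (- ball 0 r) y *\<^sub>R (w (x0 + y) * K y))
        \<le> norm (c *\<^sub>R (w (x0 + y) / wt (x0 + y)))"
    proof (rule AE_I2)
      fix y :: 'a
      show "norm (indicator (- ball 0 r) y *\<^sub>R (w (x0 + y) * K y))
        \<le> norm (c *\<^sub>R (w (x0 + y) / wt (x0 + y)))"
      proof (cases "y \<in> - ball 0 r")
        case True
        then have y: "r \<le> norm y" "y \<noteq> 0" using r by auto
        have "1 powr N \<le> ((1 / r) * norm y) powr N"
          using y r N_pos by (intro powr_mono2) (auto simp: field_simps)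
        then have 1: "1 \<le> (1 / r) powr N * norm y powr N" by (simp only: powr_mult powr_one_eq_one)
        have "norm (x0 + y) \<le> (1 + norm x0 / r) * norm y"
        proof -
          have "norm x0 \<le> norm x0 / r * norm y" using mult_left_mono[OF y(1), of "norm x0"] r
            by (simp add: field_simps)
          then show ?thesis using norm_triangle_ineq[of x0 y] by (simp add: distrib_right)
        qed
        then have "norm (x0 + y) powr N \<le> ((1 + norm x0 / r) * norm y) powr N"
          using N_pos by (intro powr_mono2) auto
        then have 2: "norm (x0 + y) powr N \<le> (1 + norm x0 / r) powr N * norm y powr N" by (simp add: powr_mult)
        have "Lam * wt (x0 + y) \<le> Lam * ((1 / r) powr N * norm y powr N + (1 + norm x0 / r) powr N * norm y powr N)"
          using lam by (intro mult_left_mono add_mono 1 2) auto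
        then have "Lam * wt (x0 + y) \<le> c * norm y powr N"
          by (simp only: c_def distrib_right mult.assoc)
        then have "Lam / norm y powr N \<le> c / wt (x0 + y)"
          using y weight_pos[of "x0 + y"] by (simp add: divide_simps)
        then have "\<bar>K y\<bar> \<le> c / wt (x0 + y)"
          using K_upper[OF y(2)] K_nonneg[OF y(2)] by simp
        then have "\<bar>w (x0 + y)\<bar> * \<bar>K y\<bar> \<le> \<bar>w (x0 + y)\<bar> * (c / wt (x0 + y))"
          by (rule mult_left_mono) simp
        moreover have "0 \<le> c" using lam by (simp add: c_def)
        ultimately show ?thesis using True weight_pos[of "x0 + y"]
          by (simp add: abs_mult mult_ac)
      qed simp
    qed
    show "(\<lambda>y. indicator (- ball 0 r) y *\<^sub>R (w (x0 + y) * K y)) \<in> borel_measurable lebesgue" by measurable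
  qed
qed

text \<open>\<open>- (2 * t) *\<^sub>R x0\<close> is the gradient at \<open>x0\<close> of the paraboloid of \<open>contact_point\<close>.\<close>

lemma paraboloid_taylor:
  assumes t: "0 \<le> t" and x0: "norm x0 < 3 / 4" and y: "norm y \<le> 1"
  shows "\<bar>t * (9 / 16 - (norm x0)\<^sup>2) - t * (9 / 16 - (norm (x0 + y))\<^sup>2) + first_order s * ((- (2 * t) *\<^sub>R x0) \<bullet> (y::'a))\<bar>
     \<le> 3 * t * norm y powr taylor_order s"
proof -
  have n2: "(norm (x0 + y))\<^sup>2 = (norm x0)\<^sup>2 + 2 * (x0 \<bullet> y) + (norm y)\<^sup>2"
    by (simp add: power2_norm_eq_inner inner_add_left inner_add_right inner_commute)
  have eq: "t * (9 / 16 - (norm x0)\<^sup>2) - t * (9 / 16 - (norm (x0 + y))\<^sup>2) + first_order s * ((- (2 * t) *\<^sub>R x0) \<bullet> y)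
      = t * (2 * (x0 \<bullet> y) * (1 - first_order s) + (norm y)\<^sup>2)"
    by (simp add: n2 algebra_simps)
  \<comment> \<open>With the gradient term the remainder is exactly \<open>(norm y)\<^sup>2\<close>.
    Without it the linear part costs at most 2 norm y, and norm y \<le> 1 absorbs the square;
    together this gives 3.\<close>
  have "\<bar>2 * (x0 \<bullet> y) * (1 - first_order s) + (norm y)\<^sup>2\<bar> \<le> 3 * norm y powr taylor_order s"
  proof (cases "s < 1 / 2")
    case True
    have "\<bar>x0 \<bullet> y\<bar> \<le> norm x0 * norm y" by (rule Cauchy_Schwarz_ineq2)
    also have "\<dots> \<le> 1 * norm y" using x0 by (intro mult_right_mono) auto
    finally have 1: "\<bar>x0 \<bullet> y\<bar> \<le> norm y" by simp
    have 2: "norm y * norm y \<le> 1 * norm y" using y by (intro mult_right_mono) auto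
    have "\<bar>2 * (x0 \<bullet> y) + (norm y)\<^sup>2\<bar> \<le> 3 * norm y"
      using 1 2 zero_le_power2[of "norm y"] unfolding power2_eq_square abs_le_iff by linarith
    then show ?thesis using True by (simp add: first_order_def taylor_order_def)
  next
    case False
    have "norm y powr 2 = (norm y)\<^sup>2" by (cases "y = 0") (auto simp: powr_numeral)
    then show ?thesis using False by (simp add: first_order_def taylor_order_def)
  qed
  then have "t * \<bar>2 * (x0 \<bullet> y) * (1 - first_order s) + (norm y)\<^sup>2\<bar> \<le> t * (3 * norm y powr taylor_order s)"
    using t by (rule mult_left_mono)
  then show ?thesis unfolding eq abs_mult using t by (simp add: mult_ac)
qed

text \<open>At a contact point, moving the negative contribution of w to the left of the
  supersolution inequality leaves its weighted integral. Only the truncated operator appears, with a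
  gradient given by the paraboloid, and the bound does not depend on \<open>r\<close>.\<close>

lemma core_estimate:
  assumes wm: "w \<in> borel_measurable lebesgue" and wi: "integrable lebesgue (\<lambda>x. w x / wt x)"
    and x0: "norm x0 < 3 / 4" and t: "0 \<le> t" and d: "0 \<le> d" and r: "0 < r" "r < 1" and C1: "0 \<le> C1"
    and pos: "\<And>y. y \<in> - ball 0 r \<Longrightarrow> 0 \<le> w (x0 + y)"
    and low: "\<And>x. t * (9 / 16 - (norm x)\<^sup>2) - d \<le> w x" and eq: "w x0 = t * (9 / 16 - (norm x0)\<^sup>2) - d"
    and b: "s = 1 / 2 \<Longrightarrow> norm b \<le> Lam"
    and super: "- C1 \<le> trunc_op s K b r w (- (2 * t) *\<^sub>R x0) x0"
  shows "(LINT y:- ball 0 r|lebesgue. w (x0 + y) / wt (x0 + y)) \<le> harnack_const DIM('a) s lam Lam * (t + C1)"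
proof -
  define G where "G = - (2 * t) *\<^sub>R x0"
  define c0 where "c0 = lam / 2 powr N"
  have c0: "0 < c0" "c0 \<le> lam"
    using lam N_pos by (auto simp: c0_def field_simps intro!: ge_one_powr_ge_zero)
  let ?A = "{y::'a. r \<le> norm y \<and> norm y < 1}"
  define W where "W y = w (x0 + y) / wt (x0 + y)" for y
  define F where "F y = (w x0 - w (x0 + y)) * K y" for y
  have wx0: "w x0 \<le> t"
  proof -
    have "t * (9 / 16 - (norm x0)\<^sup>2) \<le> t * 1"
      using t zero_le_power2[of "norm x0"] by (intro mult_left_mono; linarith)
    then show ?thesis using eq d by simp
  qed
  have z: "norm y \<le> norm (x0 + y) + 1" for y
    using norm_triangle_ineq4[of "x0 + y" x0] x0 by simp
  have Am: "?A \<in> sets lebesgue" using borel_annulus by simp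
  have U: "- ball 0 r = - ball 0 1 \<union> ?A" "- ball 0 1 \<inter> ?A = {}" using r by auto
  have Wi: "integrable lebesgue W" unfolding W_def using integrable_lebesgue_translation[OF wi] .
  have Wset: "set_integrable lebesgue B W" if "B \<in> sets lebesgue" for B
    unfolding set_integrable_def using integrable_mult_indicator[OF that Wi] .
  have Ff: "set_integrable lebesgue (- ball 0 e) F" if "0 < e" for e
    unfolding F_def left_diff_distrib
    by (intro set_integral_diff(1) set_integrable_mult_right kernel_far_integrable far_integrable wi wm that)
  have FA: "set_integrable lebesgue ?A F"
    by (rule set_integrable_subset[OF Ff[OF r(1)]]) (use Am in auto)
  have split_F: "(LINT y:- ball 0 r|lebesgue. F y) = (LINT y:- ball 0 1|lebesgue. F y) + (LINT y:?A|lebesgue. F y)"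
    unfolding U(1) by (intro set_integral_Un U(2) Ff FA) auto
  have split_W: "(LINT y:- ball 0 r|lebesgue. W y) = (LINT y:- ball 0 1|lebesgue. W y) + (LINT y:?A|lebesgue. W y)"
    unfolding U(1) by (intro set_integral_Un U(2) Wset Am) auto

  note KGi = set_integral_inner_kernel(1)[OF annulus_integrable[OF r(1)], where G=G]
    and KG = set_integral_inner_kernel(2)[OF annulus_integrable[OF r(1)], where G=G]

  \<comment> \<open>Off the unit ball the paraboloid is not consulted: w x0 \<le> t and w \<ge> 0
    suffice.\<close>
  have tail: "(LINT y:- ball 0 1|lebesgue. F y) + c0 * (LINT y:- ball 0 1|lebesgue. W y) \<le> t * (Lam * ring_const DIM('a) (2 * s))"
  proof -
    have "(LINT y:- ball 0 1|lebesgue. F y + c0 * W y) \<le> (LINT y:- ball 0 1|lebesgue. t * K y)"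
    proof (rule set_integral_mono)
      show "set_integrable lebesgue (- ball 0 1) (\<lambda>y. F y + c0 * W y)"
        by (intro set_integral_add(1) Ff set_integrable_mult_right Wset) auto
      show "set_integrable lebesgue (- ball 0 1) (\<lambda>y. t * K y)" by (intro set_integrable_mult_right kernel_far_integrable) simp
      fix y :: 'a assume y: "y \<in> - ball 0 1"
      then have y0: "y \<noteq> 0" and wy: "0 \<le> w (x0 + y)" using pos[of y] r by auto
      have "c0 * W y \<le> w (x0 + y) * K y"
        using mult_left_mono[OF kernel_weight[OF z y0] wy] by (simp add: c0_def W_def mult_ac)
      moreover have "w x0 * K y \<le> t * K y" using wx0 K_nonneg[OF y0] by (rule mult_right_mono)
      ultimately show "F y + c0 * W y \<le> t * K y" by (simp add: F_def left_diff_distrib)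
    qed
    also have "(LINT y:- ball 0 1|lebesgue. F y + c0 * W y) = (LINT y:- ball 0 1|lebesgue. F y) + c0 * (LINT y:- ball 0 1|lebesgue. W y)"
      by (subst set_integral_add(2)) (auto intro!: Ff set_integrable_mult_right Wset)
    also have "(LINT y:- ball 0 1|lebesgue. t * K y) \<le> t * (Lam * ring_const DIM('a) (2 * s))"
      using tail_bound(2)[of "\<lambda>_. 1::real" 1 1] t by (simp add: mult_left_mono)
    finally show ?thesis .
  qed

  define H where "H y = 3 * t * Lam * norm y powr (\<kappa> - real DIM('a))" for y :: 'a
  have Hi: "set_integrable lebesgue (ball 0 1) H" and HI: "\<bar>LINT y:ball 0 1|lebesgue. H y\<bar> \<le> 3 * t * Lam * ring_const DIM('a) \<kappa>"
  proof -
    have "\<bar>H y\<bar> \<le> 3 * t * Lam * norm y powr (\<kappa> - real DIM('a))" for y using t lam by (simp add: H_def)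
    moreover have "H \<in> borel_measurable lebesgue" unfolding H_def by measurable
    moreover have "0 \<le> 3 * t * Lam" using t lam by simp
    ultimately show "set_integrable lebesgue (ball 0 1) H" "\<bar>LINT y:ball 0 1|lebesgue. H y\<bar> \<le> 3 * t * Lam * ring_const DIM('a) \<kappa>"
      using set_integrable_bound_nn[of H lebesgue "\<lambda>y. norm y powr (\<kappa> - real DIM('a))" "ball 0 1" "3 * t * Lam" "ring_const DIM('a) \<kappa> * 1 powr \<kappa>"]
        nn_integral_norm_powr_ball[OF \<kappa>_pos, of 1] ring_consts_nonneg by simp_all
  qed
  have H0: "0 \<le> H y" for y using t lam by (simp add: H_def)
  have ball_int: "set_integrable lebesgue (ball (0::'a) 1) (\<lambda>_. t * lam)"
    unfolding set_integrable_def by (intro integrable_scaleR_left integrable_real_indicator) (auto simp: emeasure_lborel_ball_finite[unfolded infinity_ennreal_def])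
  \<comment> \<open>With \<open>q\<close> the gap between w and the paraboloid, the integrand is
    \<open>\<beta> * K y - q * K y\<close>: the Taylor remainder \<beta> costs \<open>H\<close>, and
    the gap pays for the weighted integral.\<close>
  have near: "(LINT y:?A|lebesgue. F y) + first_order s * (LINT y:?A|lebesgue. (G \<bullet> y) * K y) + c0 * (LINT y:?A|lebesgue. W y)
      \<le> 3 * t * Lam * ring_const DIM('a) \<kappa> + t * lam * unit_ball_vol (real DIM('a))"
  proof -
    have "(LINT y:?A|lebesgue. F y + first_order s * ((G \<bullet> y) * K y) + c0 * W y) \<le> (LINT y:?A|lebesgue. H y + t * lam)"
    proof (rule set_integral_mono)
      show "set_integrable lebesgue ?A (\<lambda>y. F y + first_order s * ((G \<bullet> y) * K y) + c0 * W y)"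
        by (intro set_integral_add(1) FA set_integrable_mult_right KGi Wset Am)
      have "set_integrable lebesgue (ball 0 1) (\<lambda>y. H y + t * lam)"
        using Hi ball_int by (rule set_integral_add(1))
      then show "set_integrable lebesgue ?A (\<lambda>y. H y + t * lam)"
        by (rule set_integrable_subset) (use Am in auto)
      fix y assume y: "y \<in> ?A"
      then have y0: "y \<noteq> 0" using r by auto
      define \<beta> where "\<beta> = t * (9 / 16 - (norm x0)\<^sup>2) - t * (9 / 16 - (norm (x0 + y))\<^sup>2) + first_order s * (G \<bullet> y)"
      define q where "q = w (x0 + y) - (t * (9 / 16 - (norm (x0 + y))\<^sup>2) - d)"
      have q: "0 \<le> q" using low[of "x0 + y"] by (simp add: q_def)
      have \<beta>: "\<beta> \<le> 3 * t * norm y powr taylor_order s"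
      proof -
        have "norm y \<le> 1" using y by simp
        from abs_le_D1[OF paraboloid_taylor[OF t x0 this]] show ?thesis unfolding \<beta>_def G_def .
      qed
      have "\<beta> * K y \<le> 3 * t * norm y powr taylor_order s * K y" using \<beta> K_nonneg[OF y0] by (rule mult_right_mono)
      also have "\<dots> \<le> 3 * t * norm y powr taylor_order s * (Lam / norm y powr N)"
        using K_upper[OF y0] t by (intro mult_left_mono) auto
      also have "\<dots> = H y"
      proof -
        have "\<kappa> - real DIM('a) = taylor_order s - N" by (simp add: N_eq)
        then show ?thesis unfolding H_def by (simp only: powr_diff) simp
      qed
      finally have 1: "\<beta> * K y \<le> H y" .
      have "c0 / wt (x0 + y) \<le> c0 / 1"
        using c0 weight_pos[of "x0 + y"] by (intro divide_left_mono) auto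
      then have wt: "0 < c0 / wt (x0 + y)" "c0 / wt (x0 + y) \<le> lam"
        using c0 divide_pos_pos[OF c0(1) weight_pos[of "x0 + y"]] by auto
      \<comment> \<open>The kernel bound needs a nonnegative factor, which the gap \<open>q\<close>
        is and \<open>w (x0 + y) - t\<close> may fail to be. Replacing w by w - t in the weighted
        term loses at most \<open>t * lam\<close>, integrable over the unit ball.\<close>
      have "(w (x0 + y) - t) * (c0 / wt (x0 + y)) \<le> q * (c0 / wt (x0 + y))"
      proof (rule mult_right_mono)
        have "t * (9 / 16 - (norm (x0 + y))\<^sup>2) \<le> t * 1"
          using t zero_le_power2[of "norm (x0 + y)"] by (intro mult_left_mono; linarith)
        then show "w (x0 + y) - t \<le> q" using d by (simp add: q_def)
      qed (use wt in simp)
      also have "\<dots> \<le> q * K y"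
        using kernel_weight[OF z y0] q unfolding c0_def by (rule mult_left_mono)
      finally have "c0 * W y - t * (c0 / wt (x0 + y)) \<le> q * K y"
        by (simp add: W_def left_diff_distrib right_diff_distrib diff_divide_distrib mult_ac)
      moreover have "t * (c0 / wt (x0 + y)) \<le> t * lam" using wt t by (intro mult_left_mono)
      ultimately have 2: "c0 * W y \<le> q * K y + t * lam" by linarith
      have "F y + first_order s * ((G \<bullet> y) * K y) = \<beta> * K y - q * K y"
        by (simp add: F_def \<beta>_def q_def eq algebra_simps)
      then show "F y + first_order s * ((G \<bullet> y) * K y) + c0 * W y \<le> H y + t * lam" using 1 2 by linarith
    qed
    also have "(LINT y:?A|lebesgue. F y + first_order s * ((G \<bullet> y) * K y) + c0 * W y) =
       (LINT y:?A|lebesgue. F y) + first_order s * (LINT y:?A|lebesgue. (G \<bullet> y) * K y) + c0 * (LINT y:?A|lebesgue. W y)"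
      by (simp add: set_integral_add FA KGi Wset[OF Am])
    \<comment> \<open>Enlarging the annulus to the unit ball makes the bound independent of
      \<open>r\<close>.\<close>
    also have "(LINT y:?A|lebesgue. H y + t * lam) \<le> (LINT y:ball 0 1|lebesgue. H y + t * lam)"
      unfolding set_lebesgue_integral_def
    proof (rule integral_mono)
      have i: "set_integrable lebesgue (ball 0 1) (\<lambda>y. H y + t * lam)"
        using Hi ball_int by (rule set_integral_add(1))
      then show "integrable lebesgue (\<lambda>y. indicator (ball 0 1) y *\<^sub>R (H y + t * lam))" by (simp add: set_integrable_def)
      have "set_integrable lebesgue ?A (\<lambda>y. H y + t * lam)"
        by (rule set_integrable_subset[OF i]) (use Am in auto)
      then show "integrable lebesgue (\<lambda>y. indicator ?A y *\<^sub>R (H y + t * lam))" by (simp add: set_integrable_def)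
      show "indicator ?A y *\<^sub>R (H y + t * lam) \<le> indicator (ball 0 1) y *\<^sub>R (H y + t * lam)" for y
        using H0[of y] t lam by (auto simp: indicator_def)
    qed
    also have "\<dots> = (LINT y:ball 0 1|lebesgue. H y) + (LINT y:ball (0::'a) 1|lebesgue. t * lam)"
      using Hi ball_int by (rule set_integral_add(2))
    also have "(LINT y:ball (0::'a) 1|lebesgue. t * lam) = t * lam * unit_ball_vol (real DIM('a))"
      by (simp add: set_lebesgue_integral_def content_ball)
    finally show ?thesis using HI by linarith
  qed

  have nG: "norm G \<le> 2 * t"
  proof -
    have "2 * t * norm x0 \<le> 2 * t * 1" using x0 t by (intro mult_left_mono) auto
    then show ?thesis using t by (simp add: G_def)
  qed
  have drift: "trunc_drift s K b 1 \<bullet> G \<le> (Lam + Lam * \<bar>ring_const DIM('a) (2 * s - 1)\<bar>) * (2 * t)"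
  proof -
    have "norm (trunc_drift s K b 1) \<le> Lam + Lam * \<bar>ring_const DIM('a) (2 * s - 1)\<bar>"
    proof -
      consider "s < 1/2" | "s = 1/2" | "1/2 < s" by linarith
      then show ?thesis
      proof cases
        case 1 then show ?thesis using lam by (simp add: trunc_drift_def)
      next
        case 2
        have "norm (trunc_drift s K b 1) \<le> Lam" using 2 b by (simp add: trunc_drift_def)
        moreover have "0 \<le> Lam * \<bar>ring_const DIM('a) (2 * s - 1)\<bar>" using lam by simp
        ultimately show ?thesis by linarith
      next
        case 3
        have "norm (trunc_drift s K b 1) \<le> Lam * ring_const DIM('a) (2 * s - 1)"
          using drift_bound(2)[OF 3, of 1] 3 by (simp add: trunc_drift_def)
        also have "\<dots> \<le> Lam * \<bar>ring_const DIM('a) (2 * s - 1)\<bar>" using lam by (intro mult_left_mono) auto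
        finally show ?thesis using lam by linarith
      qed
    qed
    then have "norm (trunc_drift s K b 1) * norm G \<le> (Lam + Lam * \<bar>ring_const DIM('a) (2 * s - 1)\<bar>) * (2 * t)"
      using nG t lam by (intro mult_mono) auto
    then show ?thesis using norm_cauchy_schwarz order_trans by blast
  qed
  have "- C1 \<le> (LINT y:- ball 0 r|lebesgue. F y) + trunc_drift s K b r \<bullet> G"
    using super by (simp add: trunc_op_def F_def G_def)
  \<comment> \<open>The drift at radius \<open>r\<close> has no bound uniform in \<open>r\<close>
    when s > 1/2. At radius 1 it has one, and the moment left over is exactly the gradient term
    already absorbed in \<open>near\<close>.\<close>
  also have "trunc_drift s K b r \<bullet> G = trunc_drift s K b 1 \<bullet> G + first_order s * (LINT y:?A|lebesgue. (G \<bullet> y) * K y)"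
    unfolding trunc_drift_split[OF r] KG by (simp add: inner_add_left)
  finally have "c0 * (LINT y:- ball 0 r|lebesgue. W y) \<le>
     t * (Lam * ring_const DIM('a) (2 * s)) + 3 * t * Lam * ring_const DIM('a) \<kappa> + t * lam * unit_ball_vol (real DIM('a))
      + (Lam + Lam * \<bar>ring_const DIM('a) (2 * s - 1)\<bar>) * (2 * t) + C1"
    using tail near drift unfolding split_F split_W distrib_left by linarith
  also have "\<dots> \<le> c0 * (harnack_const DIM('a) s lam Lam * (t + C1))"
  proof -
    let ?D = "3 * Lam * ring_const DIM('a) \<kappa> + Lam * unit_ball_vol (real DIM('a)) + Lam * ring_const DIM('a) (2 * s)
      + 2 * (Lam + Lam * \<bar>ring_const DIM('a) (2 * s - 1)\<bar>)"
    have D: "0 \<le> ?D" using lam ring_consts_nonneg by (intro add_nonneg_nonneg mult_nonneg_nonneg) auto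
    have "c0 * (harnack_const DIM('a) s lam Lam * (t + C1)) = (1 + ?D) * (t + C1)"
      using lam by (simp add: c0_def harnack_const_def N_eq)
    also have "\<dots> = t + C1 + ?D * t + ?D * C1" by (simp add: algebra_simps)
    finally have e: "c0 * (harnack_const DIM('a) s lam Lam * (t + C1)) = t + C1 + ?D * t + ?D * C1" .
    have "t * lam * unit_ball_vol (real DIM('a)) \<le> t * Lam * unit_ball_vol (real DIM('a))"
      using lam t by (intro mult_right_mono mult_left_mono) auto
    moreover have "0 \<le> ?D * C1" using D C1 by (rule mult_nonneg_nonneg)
    moreover have "?D * t = t * (Lam * ring_const DIM('a) (2 * s)) + 3 * t * Lam * ring_const DIM('a) \<kappa> + t * Lam * unit_ball_vol (real DIM('a))
      + (Lam + Lam * \<bar>ring_const DIM('a) (2 * s - 1)\<bar>) * (2 * t)" by (simp add: algebra_simps)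
    ultimately show ?thesis using e t by linarith
  qed
  finally show ?thesis using c0 by (simp add: W_def)
qed

text \<open>Off the unit ball \<open>1 / wt\<close> is dominated by \<open>K / lam\<close>, whose
  integrability there is already known.\<close>

lemma weight_integrable: "integrable lebesgue (\<lambda>x::'a. 1 / wt x)"
proof -
  have U: "- ball 0 1 \<union> ball (0::'a) 1 = UNIV" by auto
  have m: "(\<lambda>x::'a. 1 / wt x) \<in> borel_measurable lebesgue" by measurable
  have "set_integrable lebesgue (- ball 0 1) (\<lambda>x::'a. 1 / wt x)"
  proof (rule set_integrable_bound[where f="\<lambda>y. K y / lam"])
    show "set_integrable lebesgue (- ball 0 1) (\<lambda>y. K y / lam)" using kernel_far_integrable[of 1] by simp
    show "AE x in lebesgue. x \<in> - ball 0 1 \<longrightarrow> norm (1 / wt x) \<le> norm (K x / lam)"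
    proof (intro AE_I2 impI)
      fix x :: 'a assume "x \<in> - ball 0 1"
      then have x: "x \<noteq> 0" by auto
      have "1 / wt x \<le> 1 / norm x powr N" using x by (intro divide_left_mono) (auto intro: mult_pos_pos weight_pos)
      also have "\<dots> \<le> K x / lam" using K_lower[OF x] lam by (simp add: field_simps)
      finally show "norm (1 / wt x) \<le> norm (K x / lam)"
        using weight_pos[of x] K_nonneg[OF x] lam by (auto simp: abs_of_pos)
    qed
    show "set_borel_measurable lebesgue (- ball 0 1) (\<lambda>x::'a. 1 / wt x)"
      unfolding set_borel_measurable_def using m by (intro borel_measurable_scaleR borel_measurable_indicator) auto
  qed
  moreover have "set_integrable lebesgue (ball 0 1) (\<lambda>x::'a. 1 / wt x)"
  proof (rule set_integrable_bound[where f="\<lambda>y. 1::real"])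
    show "set_integrable lebesgue (ball (0::'a) 1) (\<lambda>_. 1::real)"
      unfolding set_integrable_def by (intro integrable_scaleR_left integrable_real_indicator) (auto simp: emeasure_lborel_ball_finite[unfolded infinity_ennreal_def])
    show "AE x in lebesgue. x \<in> ball 0 1 \<longrightarrow> norm (1 / wt (x::'a)) \<le> norm (1::real)"
      using weight_pos weight_ge by (intro AE_I2 impI) (auto simp: abs_of_pos divide_le_eq)
    show "set_borel_measurable lebesgue (ball 0 1) (\<lambda>x::'a. 1 / wt x)"
      unfolding set_borel_measurable_def using m by (intro borel_measurable_scaleR borel_measurable_indicator) auto
  qed
  ultimately have "set_integrable lebesgue (- ball 0 1 \<union> ball 0 1) (\<lambda>x::'a. 1 / wt x)"
    by (rule set_integrable_Un) auto
  then show ?thesis unfolding U set_integrable_def by simp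
qed

lemma harnack_const_pos: "0 < harnack_const DIM('a) s lam Lam"
proof -
  have "0 < 1 + 3 * Lam * ring_const DIM('a) \<kappa> + Lam * unit_ball_vol (real DIM('a)) + Lam * ring_const DIM('a) (2 * s)
      + 2 * (Lam + Lam * \<bar>ring_const DIM('a) (2 * s - 1)\<bar>)"
    using lam ring_consts_nonneg by (intro add_pos_nonneg mult_nonneg_nonneg add_nonneg_nonneg) auto
  then show ?thesis using lam unfolding harnack_const_def by (intro mult_pos_pos divide_pos_pos) auto
qed

text \<open>Fatou's lemma, for a sequence \<open>w j\<close> so that it serves changing test
  functions and a constant sequence alike. The excised balls shrink to a single point, which is
  null.\<close>

lemma mass_le_of_tail_bounds:
  fixes u :: "'a \<Rightarrow> real"
  assumes um: "u \<in> borel_measurable lebesgue" and pos: "\<And>x. 0 \<le> u x"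
    and wm: "\<And>j. w j \<in> borel_measurable lebesgue"
    and wi: "\<And>j. integrable lebesgue (\<lambda>x. w j x / wt x)"
    and \<rho>: "\<rho> \<longlonglongrightarrow> 0" and \<rho>_pos: "\<And>j. 0 < \<rho> j"
    and wpos: "\<And>j y. y \<in> - ball 0 (\<rho> j) \<Longrightarrow> 0 \<le> w j (x0 + y)"
    and lim: "\<And>x. x \<noteq> x0 \<Longrightarrow> (\<lambda>j. w j x) \<longlonglongrightarrow> u x"
    and bound: "\<And>j. (LINT y:- ball 0 (\<rho> j)|lebesgue. w j (x0 + y) / wt (x0 + y)) \<le> B j"
    and B: "B \<longlonglongrightarrow> B0"
  shows "mass u \<le> ennreal B0"
proof -
  let ?v = "\<lambda>j y. indicator (- ball 0 (\<rho> j)) y * (w j (x0 + y) / wt (x0 + y))"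
  have wtm: "(\<lambda>y. wt (x0 + y)) \<in> borel_measurable lebesgue"
    using lebesgue_measurable_translation[OF weight_meas, of x0] by simp
  have vm: "?v j \<in> borel_measurable lebesgue" for j
    using lebesgue_measurable_translation[OF wm[of j], of x0] wtm
    by (intro borel_measurable_times borel_measurable_indicator borel_measurable_divide) auto
  have nn: "0 \<le> ?v j y" for j y
    using wpos[of y j] weight_pos[of "x0 + y"] by (auto simp: indicator_def intro: less_imp_le)
  have vi: "integrable lebesgue (?v j)" for j
    using integrable_mult_indicator[OF _ integrable_lebesgue_translation[OF wi[of j], of x0], of "- ball 0 (\<rho> j)"] by simp
  have vB: "(\<integral>\<^sup>+y. ennreal (?v j y) \<partial>lebesgue) \<le> ennreal (B j)" for j
    using vi[of j] nn bound[of j]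
    by (subst nn_integral_eq_integral) (auto simp: set_lebesgue_integral_def intro!: ennreal_leI)
  have "mass u = (\<integral>\<^sup>+y. ennreal (u (x0 + y) / wt (x0 + y)) \<partial>lebesgue)"
    using borel_measurable_divide[OF um weight_meas]
    by (intro nn_integral_lebesgue_translation[symmetric]) simp
  also have "\<dots> \<le> (\<integral>\<^sup>+y. liminf (\<lambda>j. ennreal (?v j y)) \<partial>lebesgue)"
  proof (rule nn_integral_mono_AE)
    have "AE y in lebesgue. y \<noteq> (0::'a)"
      by (rule AE_completion) (rule AE_lborel_singleton)
    then show "AE y in lebesgue. ennreal (u (x0 + y) / wt (x0 + y)) \<le> liminf (\<lambda>j. ennreal (?v j y))"
    proof eventually_elim
      case (elim y)
      have "eventually (\<lambda>j. \<rho> j < norm y) sequentially"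
        using order_tendstoD(2)[OF \<rho>, of "norm y"] elim by simp
      then have "eventually (\<lambda>j. w j (x0 + y) / wt (x0 + y) = ?v j y) sequentially"
        by eventually_elim (auto simp: indicator_def)
      moreover have "(\<lambda>j. w j (x0 + y) / wt (x0 + y)) \<longlonglongrightarrow> u (x0 + y) / wt (x0 + y)"
        using elim weight_pos[of "x0 + y"] by (intro tendsto_intros lim) auto
      ultimately have "(\<lambda>j. ?v j y) \<longlonglongrightarrow> u (x0 + y) / wt (x0 + y)"
        by (rule Lim_transform_eventually[rotated])
      then have "(\<lambda>j. ennreal (?v j y)) \<longlonglongrightarrow> ennreal (u (x0 + y) / wt (x0 + y))"
        by (rule tendsto_ennrealI)
      from lim_imp_Liminf[OF sequentially_bot this] show ?case by simp
    qed
  qed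
  also have "\<dots> \<le> liminf (\<lambda>j. \<integral>\<^sup>+y. ennreal (?v j y) \<partial>lebesgue)"
    using vm by (intro nn_integral_liminf) auto
  also have "\<dots> \<le> liminf (\<lambda>j. ennreal (B j))"
    using vB by (intro Liminf_mono always_eventually) auto
  also have "\<dots> = ennreal B0"
    using B by (intro lim_imp_Liminf tendsto_ennrealI) auto
  finally show ?thesis .
qed

lemma paraboloid_has_derivative:
  "((\<lambda>x::'a. t * (9 / 16 - (norm x)\<^sup>2) - d) has_derivative (\<lambda>h. (- (2 * t) *\<^sub>R x) \<bullet> h)) (at x)"
  unfolding power2_norm_eq_inner
  by (rule derivative_eq_intros refl)+ (auto simp: fun_eq_iff inner_commute)

section \<open>Viscosity supersolutions\<close>

lemma viscosity_bound:
  fixes u :: "'a \<Rightarrow> real"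
  assumes pos: "\<And>x. 0 \<le> u x" and visc: "viscosity_supersolution s K b C0 (ball 0 1) u"
    and C0: "0 < C0" and b: "s = 1 / 2 \<Longrightarrow> norm b \<le> Lam"
    and x1: "norm x1 < 1 / 2" "u x1 < m"
  shows "mass u
      \<le> ennreal (harnack_const DIM('a) s lam Lam * (16 / 5 * m + C0))"
proof -
  have um: "u \<in> borel_measurable lebesgue" and lsc: "lower_semicontinuous_on (ball 0 1) u"
    using visc by (auto simp: viscosity_supersolution_def)
  define t where "t = 16 / 5 * m"
  have t: "0 < t" using pos[of x1] x1 by (simp add: t_def)
  obtain x0 d where x0: "norm x0 < 3 / 4" and d: "0 \<le> d" and eq: "u x0 = t * (9 / 16 - (norm x0)\<^sup>2) - d"
    and low: "\<And>x. t * (9 / 16 - (norm x)\<^sup>2) - d \<le> u x"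
    using contact_point[OF lsc pos x1] unfolding t_def by blast
  define p where "p x = t * (9 / 16 - (norm x)\<^sup>2) - d" for x :: 'a
  have p_le: "p x \<le> t" for x
  proof -
    have "t * (9 / 16 - (norm x)\<^sup>2) \<le> t * 1" using t zero_le_power2[of "norm x"] by (intro mult_left_mono; linarith)
    then show ?thesis using d by (simp add: p_def)
  qed
  define \<rho> where "\<rho> j = 1 / (4 + real j)" for j
  \<comment> \<open>A test function must lie in the weighted L^1 space, which is not yet known of u;
    hence the truncation. Its level is at least \<open>t\<close>, an upper bound of the paraboloid,
    so \<open>w j\<close> still lies between the paraboloid and u.\<close>
  define w where "w j x = (if x \<in> ball x0 (\<rho> j) then p x else min (u x) (t + real j))" for j x
  have \<rho>: "0 < \<rho> j" "\<rho> j \<le> 1 / 4" "\<rho> j < 1" for j by (auto simp: \<rho>_def field_simps)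
  have pc: "isCont p x" for x unfolding p_def by (intro continuous_intros)
  have pm: "p \<in> borel_measurable lebesgue"
    by (intro borel_measurable_lebesgueI borel_measurable_continuous_onI continuous_at_imp_continuous_on) (use pc in auto)
  have wm: "w j \<in> borel_measurable lebesgue" for j
    unfolding w_def using um pm by (intro measurable_If_set borel_measurable_min) auto
  have wle: "w j x \<le> u x" for j x using low[of x] by (simp add: w_def p_def)
  have low_w: "p x \<le> w j x" for j x using low[of x] p_le[of x] by (auto simp: w_def p_def)
  have px0: "p x0 = u x0" using eq by (simp add: p_def)
  have wx0: "w j x0 = p x0" for j using \<rho>(1)[of j] by (simp add: w_def)
  have inball: "ball x0 (\<rho> j) \<subseteq> ball 0 1" for j
  proof
    fix x assume "x \<in> ball x0 (\<rho> j)"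
    then have "norm (x - x0) < \<rho> j" by (simp add: dist_norm norm_minus_commute)
    moreover have "norm x \<le> norm x0 + norm (x - x0)" by (rule norm_triangle_sub)
    ultimately show "x \<in> ball 0 1" using x0 \<rho>(2)[of j] by simp
  qed
  define B where "B j = t + d + real j" for j
  have wB: "\<bar>w j x\<bar> \<le> B j" for j x
  proof (cases "x \<in> ball x0 (\<rho> j)")
    case True
    then have "norm x < 1" using inball by force
    then have "(norm x)\<^sup>2 \<le> 1" by (simp add: power_le_one)
    then have "t * (-1) \<le> t * (9 / 16 - (norm x)\<^sup>2)" using t by (intro mult_left_mono) auto
    then show ?thesis using True p_le[of x] d t by (simp add: w_def p_def B_def)
  next
    case False
    then show ?thesis using pos[of x] t d by (auto simp: w_def B_def)
  qed
  have wi: "integrable lebesgue (\<lambda>x. w j x / wt x)" for j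
  proof (rule Bochner_Integration.integrable_bound)
    show "integrable lebesgue (\<lambda>x::'a. B j * (1 / wt x))" using weight_integrable by (rule integrable_mult_right)
    show "(\<lambda>x. w j x / wt x) \<in> borel_measurable lebesgue"
      using borel_measurable_divide[OF wm weight_meas] .
    show "AE x in lebesgue. norm (w j x / wt x) \<le> norm (B j * (1 / wt x))"
    proof (rule AE_I2)
      fix x :: 'a
      have "\<bar>w j x\<bar> / wt x \<le> B j / wt x"
        using wB weight_pos[of x] by (intro divide_right_mono) auto
      moreover have "0 \<le> B j" using wB[of j x] by linarith
      ultimately show "norm (w j x / wt x) \<le> norm (B j * (1 / wt x))"
        using weight_pos[of x] by (simp add: abs_of_pos)
    qed
  qed
  have der: "(w j has_derivative (\<lambda>h. (- (2 * t) *\<^sub>R x) \<bullet> h)) (at x)" if "x \<in> ball x0 (\<rho> j)" for j x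
    by (rule has_derivative_transform_within_open[OF paraboloid_has_derivative[where t=t and d=d and x=x] open_ball that])
      (simp add: w_def p_def)
  have Ck: "Ck_on 2 (ball x0 (\<rho> j)) (w j)" for j
  proof -
    have "Ck_on (Suc 0) (ball x0 (\<rho> j)) (\<lambda>x. (- (2 * t) *\<^sub>R x) \<bullet> i)" for i
      unfolding Ck_on.simps
      by (intro exI[of _ "\<lambda>_. - (2 * t) *\<^sub>R i"] conjI ballI)
         (auto intro!: derivative_eq_intros simp: inner_commute fun_eq_iff)
    then have "Ck_on (Suc (Suc 0)) (ball x0 (\<rho> j)) (w j)"
      using der unfolding Ck_on.simps(2)[of "Suc 0"] by blast
    then show ?thesis by (simp only: numeral_2_eq_2)
  qed
  \<comment> \<open>The bound on the core of the paraboloid near the contact point; it turns the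
    inequality for the full operator into one for the truncated operator and tends to 0 because
    \<kappa> > 0.\<close>
  define E where "E j = 3 * t * Lam * (ring_const DIM('a) \<kappa> * \<rho> j powr \<kappa>)" for j
  have E0: "0 \<le> E j" for j using t lam ring_consts_nonneg by (simp add: E_def)
  have super: "- (C0 + E j) \<le> trunc_op s K b (\<rho> j) (w j) (- (2 * t) *\<^sub>R x0) x0" for j
  proof -
    have "- C0 \<le> nonlocal_op s K b (w j) x0"
    proof -
      have V: "\<forall>x\<in>ball 0 1. \<forall>S \<phi>. open S \<and> x \<in> S \<and> S \<subseteq> ball 0 1 \<and> Ck_on 2 S \<phi> \<and>
          integrable lebesgue (\<lambda>y. \<phi> y / (1 + norm y powr (real DIM('a) + 2 * s))) \<and> \<phi> x = u x \<and> (\<forall>y. \<phi> y \<le> u y)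
          \<longrightarrow> - C0 \<le> nonlocal_op s K b \<phi> x"
        using visc unfolding viscosity_supersolution_def by (elim conjE)
      have "x0 \<in> ball 0 1" "x0 \<in> ball x0 (\<rho> j)" "w j x0 = u x0" using x0 \<rho>(1)[of j] wx0 px0 by simp_all
      then show ?thesis
        using wi[of j] unfolding N_eq by (intro V[rule_format, of x0 "ball x0 (\<rho> j)" "w j"] conjI allI open_ball inball Ck wle)
    qed
    moreover have h1: "0 \<le> 3 * t" using t by simp
    moreover have h2: "(w j has_derivative (\<lambda>h. (- (2 * t) *\<^sub>R x0) \<bullet> h)) (at x0)" using \<rho>(1)[of j] by (intro der) auto
    moreover have h3: "set_integrable lebesgue (- ball 0 (\<rho> j)) (\<lambda>y. (w j x0 - w j (x0 + y)) * K y)"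
      unfolding left_diff_distrib using \<rho>(1)[of j]
      by (intro set_integral_diff(1) set_integrable_mult_right kernel_far_integrable far_integrable wi wm) auto
    moreover have h4: "\<bar>w j x0 - w j (x0 + y) + first_order s * ((- (2 * t) *\<^sub>R x0) \<bullet> y)\<bar> \<le> 3 * t * norm y powr taylor_order s"
      if y: "y \<in> ball 0 (\<rho> j)" for y
    proof -
      have "w j (x0 + y) = p (x0 + y)" using y by (simp add: w_def dist_norm)
      then show ?thesis
        using paraboloid_taylor[of t x0 y] t x0 y \<rho>(3)[of j] by (simp add: wx0 p_def)
    qed
    moreover note nonlocal_op_split[OF wm \<rho>(1) h1 h2 h3 h4]
    ultimately show ?thesis by (simp add: E_def)
  qed
  have bnd: "(LINT y:- ball 0 (\<rho> j)|lebesgue. w j (x0 + y) / wt (x0 + y))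
     \<le> harnack_const DIM('a) s lam Lam * (t + (C0 + E j))" for j
  proof (rule core_estimate[OF wm wi x0 _ d \<rho>(1,3) _ _ _ _ b super])
    show "0 \<le> t" "0 \<le> C0 + E j" using t C0 E0[of j] by auto
    show "t * (9 / 16 - (norm x)\<^sup>2) - d \<le> w j x" for x using low_w unfolding p_def .
    show "w j x0 = t * (9 / 16 - (norm x0)\<^sup>2) - d" using wx0 unfolding p_def .
    fix y :: 'a assume "y \<in> - ball 0 (\<rho> j)"
    then show "0 \<le> w j (x0 + y)" using pos[of "x0 + y"] t by (simp add: w_def dist_norm)
  qed
  have \<rho>0: "\<rho> \<longlonglongrightarrow> 0"
    unfolding \<rho>_def by (rule real_tendsto_divide_at_top[OF tendsto_const])
      (rule filterlim_tendsto_add_at_top[OF tendsto_const filterlim_real_sequentially])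
  have "E \<longlonglongrightarrow> 3 * t * Lam * (ring_const DIM('a) \<kappa> * 0)"
    unfolding E_def using \<kappa>_pos \<rho>0 \<rho>(1)
    by (intro tendsto_mult tendsto_const tendsto_zero_powrI[OF \<rho>0 tendsto_const]) (auto intro!: always_eventually less_imp_le)
  then have lim: "(\<lambda>j. harnack_const DIM('a) s lam Lam * (t + (C0 + E j))) \<longlonglongrightarrow> harnack_const DIM('a) s lam Lam * (t + (C0 + 0))"
    by (intro tendsto_intros) simp
  have "mass u \<le> ennreal (harnack_const DIM('a) s lam Lam * (t + (C0 + 0)))"
  proof (rule mass_le_of_tail_bounds[OF um pos wm wi \<rho>0 \<rho>(1) _ _ bnd lim])
    fix j and y :: 'a assume "y \<in> - ball 0 (\<rho> j)"
    then show "0 \<le> w j (x0 + y)" using pos[of "x0 + y"] t by (simp add: w_def dist_norm)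
  next
    fix x assume x: "x \<noteq> x0"
    obtain l :: nat where l: "u x \<le> real l" using real_arch_simple by blast
    have "eventually (\<lambda>j. w j x = u x) sequentially"
      using order_tendstoD(2)[OF \<rho>0, of "dist x0 x"] x eventually_ge_at_top[of l]
      by (simp, elim eventually_elim2) (use l t in \<open>auto simp: w_def\<close>)
    then show "(\<lambda>j. w j x) \<longlonglongrightarrow> u x" by (rule tendsto_eventually)
  qed
  then show ?thesis by (simp add: t_def)
qed

text \<open>The infimum need not be attained, so a bound is available only for levels m > I. A
  single such level gives integrability, after which m decreases to I.\<close>

lemma weighted_integral_le_of_bounds:
  fixes u :: "'a \<Rightarrow> real"
  assumes um: "u \<in> borel_measurable lebesgue" and pos: "\<And>x. 0 \<le> u x" and C: "0 \<le> C"
    and bd: "\<And>m. I < m \<Longrightarrow> mass u \<le> ennreal (C * (m + C0))"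
    and I: "0 \<le> I" "0 < C0"
  shows "integrable lebesgue (\<lambda>x. u x / wt x)"
    and "(LINT x|lebesgue. u x / wt x) \<le> C * (I + C0)"
proof -
  have nn: "0 \<le> u x / wt x" for x using pos[of x] weight_pos[of x] by simp
  have m: "(\<lambda>x. u x / wt x) \<in> borel_measurable lebesgue"
    using borel_measurable_divide[OF um weight_meas] .
  show i: "integrable lebesgue (\<lambda>x. u x / wt x)"
    using bd[of "I + 1"] nn m
    by (intro integrableI_nonneg) (auto intro: order.strict_trans1)
  have "(LINT x|lebesgue. u x / wt x) \<le> C * (m + C0)" if "I < m" for m
    using bd[OF that] nn i that I C
    by (subst (asm) nn_integral_eq_integral) (auto simp: mult_nonneg_nonneg)
  moreover have "((\<lambda>m. C * (m + C0)) \<longlongrightarrow> C * (I + C0)) (at_right I)"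
    by (intro tendsto_intros)
  ultimately show "(LINT x|lebesgue. u x / wt x) \<le> C * (I + C0)"
    by (intro tendsto_lowerbound) (auto intro: eventually_mono[OF eventually_at_right_less])
qed

theorem viscosity_half_harnack:
  fixes u :: "'a \<Rightarrow> real"
  assumes pos: "\<And>x. 0 \<le> u x" and visc: "viscosity_supersolution s K b C0 (ball 0 1) u"
    and C0: "0 < C0" and b: "s = 1 / 2 \<Longrightarrow> norm b \<le> Lam"
  shows "integrable lebesgue (\<lambda>x. u x / wt x)"
    and "(LINT x|lebesgue. u x / wt x)
      \<le> 4 * harnack_const DIM('a) s lam Lam * ((INF x\<in>ball 0 (1 / 2). u x) + C0)"
proof -
  have um: "u \<in> borel_measurable lebesgue" using visc by (simp add: viscosity_supersolution_def)
  have bb: "bdd_below (u ` ball 0 (1 / 2))" using pos by (auto intro!: bdd_belowI[of _ 0])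
  have I0: "0 \<le> (INF x\<in>ball 0 (1 / 2). u x)" by (rule cINF_greatest) (auto intro: pos)
  have "mass u \<le> ennreal (4 * harnack_const DIM('a) s lam Lam * (m + C0))"
    if m: "(INF x\<in>ball 0 (1 / 2). u x) < m" for m
  proof -
    obtain x1 where "x1 \<in> ball 0 (1 / 2)" "u x1 < m"
      using m bb by (subst (asm) cINF_less_iff) auto
    then have "mass u \<le> ennreal (harnack_const DIM('a) s lam Lam * (16 / 5 * m + C0))"
      by (intro viscosity_bound[OF pos visc C0 b]) auto
    also have "harnack_const DIM('a) s lam Lam * (16 / 5 * m + C0) \<le> 4 * harnack_const DIM('a) s lam Lam * (m + C0)"
    proof -
      have "harnack_const DIM('a) s lam Lam * (16 / 5 * m + C0) \<le> harnack_const DIM('a) s lam Lam * (4 * (m + C0))"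
        using harnack_const_pos m I0 C0 by (intro mult_left_mono) auto
      then show ?thesis by (simp add: algebra_simps)
    qed
    finally show ?thesis by (simp add: ennreal_leI)
  qed
  note * = weighted_integral_le_of_bounds[OF um pos _ this I0 C0]
  show "integrable lebesgue (\<lambda>x. u x / wt x)"
    "(LINT x|lebesgue. u x / wt x)
      \<le> 4 * harnack_const DIM('a) s lam Lam * ((INF x\<in>ball 0 (1 / 2). u x) + C0)"
    using * harnack_const_pos by auto
qed

end

subsection \<open>Bump functions and Tonelli\<close>

lemma Ck_on_Suc_D: "Ck_on (Suc k) S f \<Longrightarrow> Ck_on k S f"
proof (induction k arbitrary: f)
  case 0
  then obtain g where "\<forall>x\<in>S. (f has_derivative (\<lambda>h. g x \<bullet> h)) (at x)" by auto
  then show ?case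
    by (auto intro!: continuous_at_imp_continuous_on has_derivative_continuous)
next
  case (Suc k)
  then show ?case by (metis Ck_on.simps(2))
qed

lemma Ck_on_const: "Ck_on k S (\<lambda>_. c)"
proof (induction k arbitrary: c)
  case (Suc k)
  then show ?case by (auto intro!: exI[of _ "\<lambda>_. 0"])
qed simp

lemma Ck_on_affine: "Ck_on k S (\<lambda>x. a \<bullet> x + c)"
proof (cases k)
  case (Suc j)
  have "((\<lambda>x. a \<bullet> x + c) has_derivative (\<lambda>h. a \<bullet> h)) (at x)" for x
    by (auto intro!: derivative_eq_intros)
  then show ?thesis unfolding Suc Ck_on.simps using Ck_on_const by (intro exI[of _ "\<lambda>_. a"] conjI ballI)
qed (auto intro!: continuous_intros)

lemma Ck_on_add: "Ck_on k S f \<Longrightarrow> Ck_on k S g \<Longrightarrow> Ck_on k S (\<lambda>x. f x + g x)"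
proof (induction k arbitrary: f g)
  case (Suc k)
  then obtain f' g' where f': "\<forall>x\<in>S. (f has_derivative (\<lambda>h. f' x \<bullet> h)) (at x)" "\<forall>i\<in>Basis. Ck_on k S (\<lambda>x. f' x \<bullet> i)"
    and g': "\<forall>x\<in>S. (g has_derivative (\<lambda>h. g' x \<bullet> h)) (at x)" "\<forall>i\<in>Basis. Ck_on k S (\<lambda>x. g' x \<bullet> i)" by auto
  have "\<forall>x\<in>S. ((\<lambda>x. f x + g x) has_derivative (\<lambda>h. (f' x + g' x) \<bullet> h)) (at x)"
    using f'(1) g'(1) by (auto simp: inner_add_left intro!: has_derivative_add)
  moreover have "\<forall>i\<in>Basis. Ck_on k S (\<lambda>x. (f' x + g' x) \<bullet> i)"
    using f'(2) g'(2) Suc.IH by (auto simp: inner_add_left)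
  ultimately show ?case unfolding Ck_on.simps by (intro exI[of _ "\<lambda>x. f' x + g' x"] conjI)
qed (auto intro: continuous_intros)

lemma Ck_on_mult: "Ck_on k S f \<Longrightarrow> Ck_on k S g \<Longrightarrow> Ck_on k S (\<lambda>x. f x * g x)"
proof (induction k arbitrary: f g)
  case (Suc k)
  then obtain f' g' where f': "\<forall>x\<in>S. (f has_derivative (\<lambda>h. f' x \<bullet> h)) (at x)" "\<forall>i\<in>Basis. Ck_on k S (\<lambda>x. f' x \<bullet> i)"
    and g': "\<forall>x\<in>S. (g has_derivative (\<lambda>h. g' x \<bullet> h)) (at x)" "\<forall>i\<in>Basis. Ck_on k S (\<lambda>x. g' x \<bullet> i)" by auto
  have "\<forall>x\<in>S. ((\<lambda>x. f x * g x) has_derivative (\<lambda>h. (f x *\<^sub>R g' x + g x *\<^sub>R f' x) \<bullet> h)) (at x)"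
  proof
    fix x assume "x \<in> S"
    then show "((\<lambda>x. f x * g x) has_derivative (\<lambda>h. (f x *\<^sub>R g' x + g x *\<^sub>R f' x) \<bullet> h)) (at x)"
      using has_derivative_mult[OF f'(1)[rule_format, of x] g'(1)[rule_format, of x]]
      by (simp add: inner_add_left mult.commute)
  qed
  moreover have "\<forall>i\<in>Basis. Ck_on k S (\<lambda>x. (f x *\<^sub>R g' x + g x *\<^sub>R f' x) \<bullet> i)"
  proof
    fix i :: 'a assume "i \<in> Basis"
    then have "Ck_on k S (\<lambda>x. f x * (g' x \<bullet> i) + g x * (f' x \<bullet> i))"
      using f'(2) g'(2) Suc.prems[THEN Ck_on_Suc_D] by (intro Ck_on_add Suc.IH) auto
    then show "Ck_on k S (\<lambda>x. (f x *\<^sub>R g' x + g x *\<^sub>R f' x) \<bullet> i)" by (simp add: inner_add_left)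
  qed
  ultimately show ?case unfolding Ck_on.simps by (intro exI[of _ "\<lambda>x. f x *\<^sub>R g' x + g x *\<^sub>R f' x"] conjI)
qed (auto intro: continuous_intros)

section \<open>Smooth bumps\<close>

text \<open>The division by \<open>t ^ m\<close> makes the family closed under differentiation up to
  linear combinations, so that smoothness of every order follows by induction with \<open>m\<close>
  arbitrary.\<close>

definition flat_exp :: "nat \<Rightarrow> real \<Rightarrow> real" where
  "flat_exp m t = (if t \<le> 0 then 0 else exp (- 1 / t) / t ^ m)"

lemma flat_exp_nonneg: "0 \<le> flat_exp m t" by (simp add: flat_exp_def)

text \<open>One term of the series of exp (1 / t) beats \<open>t ^ m\<close> with two powers of t to
  spare, which makes the difference quotient at 0 tend to 0.\<close>

lemma flat_exp_le: "flat_exp m t \<le> fact (m + 2) * t\<^sup>2"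
proof (cases "t \<le> 0")
  case False
  have "(1 / t) ^ (m + 2) /\<^sub>R fact (m + 2) \<le> exp (1 / t)"
  proof -
    have "(\<Sum>n\<in>{m + 2}. (1 / t) ^ n /\<^sub>R fact n) \<le> (\<Sum>n. (1 / t) ^ n /\<^sub>R fact n)"
      using False by (intro sum_le_suminf summable_exp_generic) auto
    then show ?thesis by (simp add: exp_def)
  qed
  then have "1 \<le> fact (m + 2) * t ^ (m + 2) * exp (1 / t)"
    using False by (simp add: field_simps power_divide del: fact_Suc)
  then have "exp (- (1 / t)) \<le> fact (m + 2) * t ^ (m + 2)"
    using False by (simp add: exp_minus field_simps del: fact_Suc)
  then have "exp (- (1 / t)) / t ^ m \<le> fact (m + 2) * t ^ (m + 2) / t ^ m"
    using False by (intro divide_right_mono) auto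
  then show ?thesis using False by (simp add: flat_exp_def power_add power2_eq_square del: fact_Suc)
qed (simp add: flat_exp_def)

lemma flat_exp_derivative:
  "(flat_exp m has_real_derivative (flat_exp (m + 2) t - real m * flat_exp (m + 1) t)) (at t)"
proof -
  consider "t < 0" | "t = 0" | "0 < t" by linarith
  then show ?thesis
  proof cases
    case 1
    have "((\<lambda>_. 0) has_real_derivative 0) (at t)" by simp
    then have "(flat_exp m has_real_derivative 0) (at t)"
      by (rule DERIV_cong_ev[THEN iffD1, rotated -1, OF _ refl _ refl])
         (use 1 in \<open>auto simp: flat_exp_def intro!: eventually_mono[OF eventually_nhds_in_open[of "{..<0}" t]]\<close>)
    then show ?thesis using 1 by (simp add: flat_exp_def)
  next
    case 2
    have "((\<lambda>h. (flat_exp m (0 + h) - flat_exp m 0) / h) \<longlongrightarrow> 0) (at 0)"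
    proof (rule Lim_null_comparison)
      show "eventually (\<lambda>h. norm ((flat_exp m (0 + h) - flat_exp m 0) / h) \<le> fact (m + 2) * \<bar>h\<bar>) (at 0)"
        unfolding eventually_at
      proof (intro exI[of _ 1] conjI ballI impI)
        fix h :: real assume h: "h \<noteq> 0 \<and> dist h 0 < 1"
        have "flat_exp m h / \<bar>h\<bar> \<le> fact (m + 2) * h\<^sup>2 / \<bar>h\<bar>"
          using flat_exp_le by (intro divide_right_mono) auto
        also have "\<dots> = fact (m + 2) * \<bar>h\<bar>" using h by (simp add: power2_eq_square abs_if del: fact_Suc)
        finally show "norm ((flat_exp m (0 + h) - flat_exp m 0) / h) \<le> fact (m + 2) * \<bar>h\<bar>"
          using flat_exp_nonneg[of m h] by (simp add: flat_exp_def[of m 0] del: fact_Suc)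
      qed simp
      show "((\<lambda>h::real. fact (m + 2) * \<bar>h\<bar>) \<longlongrightarrow> 0) (at 0)"
        by (rule tendsto_eq_intros refl)+ simp
    qed
    then show ?thesis using 2 by (simp add: DERIV_def flat_exp_def)
  next
    case 3
    have "((\<lambda>t. exp (- 1 / t) / t ^ m) has_real_derivative
        (exp (- 1 / t) * (1 / t\<^sup>2) * t ^ m - exp (- 1 / t) * (real m * t ^ (m - 1))) / (t ^ m * t ^ m)) (at t)"
      using 3 by (auto intro!: derivative_eq_intros simp: power2_eq_square)
    moreover have "(exp (- 1 / t) * (1 / t\<^sup>2) * t ^ m - exp (- 1 / t) * (real m * t ^ (m - 1))) / (t ^ m * t ^ m)
        = exp (- 1 / t) / t ^ (m + 2) - real m * (exp (- 1 / t) / t ^ (m + 1))"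
    proof (cases m)
      case (Suc k)
      then show ?thesis using 3 by (simp add: field_simps power2_eq_square)
    qed (use 3 in \<open>simp add: field_simps power2_eq_square\<close>)
    ultimately have "((\<lambda>t. exp (- 1 / t) / t ^ m) has_real_derivative
        exp (- 1 / t) / t ^ (m + 2) - real m * (exp (- 1 / t) / t ^ (m + 1))) (at t)" by simp
    then have "(flat_exp m has_real_derivative exp (- 1 / t) / t ^ (m + 2) - real m * (exp (- 1 / t) / t ^ (m + 1))) (at t)"
      by (rule DERIV_cong_ev[THEN iffD1, rotated -1, OF _ refl _ refl])
         (use 3 in \<open>auto simp: flat_exp_def intro!: eventually_mono[OF eventually_nhds_in_open[of "{0<..}" t]]\<close>)
    then show ?thesis using 3 by (simp add: flat_exp_def)
  qed
qed

definition bump :: "real \<Rightarrow> 'a::euclidean_space \<Rightarrow> 'a \<Rightarrow> real" where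
  "bump e c x = flat_exp 0 (e\<^sup>2 - (norm (x - c))\<^sup>2)"

lemma Ck_on_flat_exp: "Ck_on k UNIV (\<lambda>x. flat_exp m (e - (norm (x - c))\<^sup>2))" for c :: "'a::euclidean_space"
proof (induction k arbitrary: m)
  case 0
  have "isCont (flat_exp m) t" for t using flat_exp_derivative DERIV_isCont by blast
  then show ?case
    by (auto intro!: continuous_at_imp_continuous_on isCont_o2[of _ "\<lambda>x. e - (norm (x - c))\<^sup>2" "flat_exp m"] continuous_intros)
next
  case (Suc k)
  let ?q = "\<lambda>x. e - (norm (x - c))\<^sup>2"
  let ?g = "\<lambda>x. (flat_exp (m + 2) (?q x) - real m * flat_exp (m + 1) (?q x)) *\<^sub>R ((- 2) *\<^sub>R (x - c))"
  have "((\<lambda>x. flat_exp m (?q x)) has_derivative (\<lambda>h. ?g x \<bullet> h)) (at x)" for x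
  proof -
    have q: "(?q has_derivative (\<lambda>h. (- 2) * ((x - c) \<bullet> h))) (at x)"
      unfolding power2_norm_eq_inner
      by (rule derivative_eq_intros refl)+ (auto simp: fun_eq_iff inner_commute algebra_simps)
    have "(flat_exp m has_derivative (*) (flat_exp (m + 2) (?q x) - real m * flat_exp (m + 1) (?q x))) (at (?q x))"
      using flat_exp_derivative by (simp only: has_field_derivative_def)
    from has_derivative_compose[OF q this] show ?thesis unfolding inner_scaleR_left .
  qed
  moreover have "Ck_on k UNIV (\<lambda>x. ?g x \<bullet> i)" for i
  proof -
    have "Ck_on k UNIV (\<lambda>x. (flat_exp (m + 2) (?q x) + (- real m) * flat_exp (m + 1) (?q x)) * (((- 2) *\<^sub>R i) \<bullet> x + 2 * (c \<bullet> i)))"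
      by (intro Ck_on_mult Ck_on_add Suc.IH Ck_on_const Ck_on_affine)
    also have "(\<lambda>x. (flat_exp (m + 2) (?q x) + (- real m) * flat_exp (m + 1) (?q x)) * (((- 2) *\<^sub>R i) \<bullet> x + 2 * (c \<bullet> i)))
       = (\<lambda>x. ?g x \<bullet> i)"
      by (auto simp: fun_eq_iff inner_diff_left inner_commute algebra_simps)
    finally show ?thesis .
  qed
  ultimately show ?case unfolding Ck_on.simps by (intro exI[of _ ?g] conjI ballI)
qed

lemma bump_nonneg: "0 \<le> bump e c x" by (simp add: bump_def flat_exp_nonneg)

lemma bump_le_1: "bump e c x \<le> 1" by (simp add: bump_def flat_exp_def)

lemma bump_pos_iff: "0 < e \<Longrightarrow> 0 < bump e c x \<longleftrightarrow> x \<in> ball c e"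
  using abs_le_square_iff[of e "norm (x - c)"]
  by (auto simp: bump_def flat_exp_def dist_norm norm_minus_commute not_le[symmetric])

lemma bump_eq_0: "0 < e \<Longrightarrow> x \<notin> ball c e \<Longrightarrow> bump e c x = 0"
  using bump_pos_iff[of e c x] bump_nonneg[of e c x] by linarith

lemma smooth_compact_support_bump:
  assumes "0 < e" "cball c e \<subseteq> S"
  shows "smooth_compact_support S (\<lambda>x. a * bump e c x)"
proof -
  have "Ck_on k UNIV (\<lambda>x. a * bump e c x)" for k
    unfolding bump_def by (intro Ck_on_mult Ck_on_const Ck_on_flat_exp)
  moreover have sub: "closure {x. a * bump e c x \<noteq> 0} \<subseteq> cball c e"
  proof (rule closure_minimal)
    show "{x. a * bump e c x \<noteq> 0} \<subseteq> cball c e"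
    proof clarify
      fix x assume "a * bump e c x \<noteq> 0"
      then have "x \<in> ball c e" using bump_eq_0[OF assms(1), of x c] by auto
      then show "x \<in> cball c e" by simp
    qed
  qed simp
  moreover have "compact (closure {x. a * bump e c x \<noteq> 0})"
    using sub by (meson bounded_cball bounded_subset closed_closure compact_eq_bounded_closed)
  ultimately show ?thesis using assms by (auto simp: smooth_compact_support_def)
qed

section \<open>Uniform Taylor bounds and Tonelli's theorem\<close>

text \<open>One constant works at all base points: gradient and second derivatives are continuous
  and vanish off the compact set, hence are bounded, and the mean value theorem turns these bounds
  into the Taylor estimates.\<close>

lemma C2_compact_support_taylor:
  fixes f :: "'a::euclidean_space \<Rightarrow> real"
  assumes f: "Ck_on 2 UNIV f" and C: "compact C" "\<And>x. x \<notin> C \<Longrightarrow> f x = 0"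
  shows "\<exists>g M. (\<forall>x. (f has_derivative (\<lambda>h. g x \<bullet> h)) (at x)) \<and> continuous_on UNIV g \<and> 0 \<le> M \<and>
    (\<forall>x y. \<bar>f (x + y) - f x - g x \<bullet> y\<bar> \<le> M * (norm y)\<^sup>2) \<and> (\<forall>x y. \<bar>f (x + y) - f x\<bar> \<le> M * norm y) \<and>
    (\<forall>x. norm (g x) \<le> M) \<and> (\<forall>x. x \<notin> C \<longrightarrow> g x = 0)"
proof -
  obtain g where g: "\<And>x. (f has_derivative (\<lambda>h. g x \<bullet> h)) (at x)" and gk: "\<And>i. i \<in> Basis \<Longrightarrow> Ck_on (Suc 0) UNIV (\<lambda>x. g x \<bullet> i)"
    using f unfolding numeral_2_eq_2 Ck_on.simps(2)[of "Suc 0"] by blast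
  have zero_grad: "v = 0" if "(q has_derivative (\<lambda>h. v \<bullet> h)) (at x)" "\<And>x. x \<notin> C \<Longrightarrow> q x = 0" "x \<notin> C" for q :: "'a \<Rightarrow> real" and v x
  proof -
    have "open (- C)" using C by (simp add: compact_imp_closed open_Compl)
    then have "(q has_derivative (\<lambda>h. 0)) (at x)"
      by (rule has_derivative_transform_within_open[OF has_derivative_const[of 0]]) (use that in auto)
    then have "(\<lambda>h. v \<bullet> h) = (\<lambda>h. 0)" using that(1) has_derivative_unique by blast
    then have "v \<bullet> v = 0" by metis
    then show ?thesis by simp
  qed
  have g0: "g x = 0" if "x \<notin> C" for x using zero_grad[OF g C(2) that] .
  have "\<exists>H. (\<forall>x. ((\<lambda>x. g x \<bullet> i) has_derivative (\<lambda>h. H x \<bullet> h)) (at x)) \<and> (\<forall>j\<in>Basis. continuous_on UNIV (\<lambda>x. H x \<bullet> j))"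
    if "i \<in> Basis" for i using gk[OF that] by auto
  then obtain H where H: "\<And>i x. i \<in> Basis \<Longrightarrow> ((\<lambda>x. g x \<bullet> i) has_derivative (\<lambda>h. H i x \<bullet> h)) (at x)"
    "\<And>i j. i \<in> Basis \<Longrightarrow> j \<in> Basis \<Longrightarrow> continuous_on UNIV (\<lambda>x. H i x \<bullet> j)" by metis
  have bound: "\<exists>B\<ge>0. \<forall>x. norm (q x) \<le> B" if "continuous_on UNIV q" "\<And>x. x \<notin> C \<Longrightarrow> q x = 0" for q :: "'a \<Rightarrow> 'a"
  proof -
    have "bounded (q ` C)" using that(1) C by (intro compact_imp_bounded compact_continuous_image) (auto intro: continuous_on_subset)
    then obtain B where "\<forall>x\<in>C. norm (q x) \<le> B" by (auto simp: bounded_iff)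
    then have "\<forall>x. norm (q x) \<le> max B 0" using that(2) by (metis max.coboundedI1 max.coboundedI2 norm_zero order_refl)
    then show ?thesis by (intro exI[of _ "max B 0"]) auto
  qed
  have "\<exists>B\<ge>0. \<forall>x. norm (H i x) \<le> B" if i: "i \<in> Basis" for i
  proof (rule bound)
    show "continuous_on UNIV (H i)" using H(2)[OF i] continuous_on_componentwise by blast
    show "H i x = 0" if "x \<notin> C" for x by (rule zero_grad[OF H(1)[OF i] _ that]) (simp add: g0)
  qed
  then obtain B where B: "\<And>i. i \<in> Basis \<Longrightarrow> 0 \<le> B i" "\<And>i x. i \<in> Basis \<Longrightarrow> norm (H i x) \<le> B i" by metis
  have on: "onorm (\<lambda>h. v \<bullet> h) \<le> norm v" for v :: 'a
    by (rule onorm_le) (simp add: Cauchy_Schwarz_ineq2)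
  define L where "L = (\<Sum>i\<in>Basis. B i)"
  have L0: "0 \<le> L" unfolding L_def using B by (intro sum_nonneg) auto
  have gL: "norm (g x - g y) \<le> L * norm (x - y)" for x y
  proof -
    have "norm (g x - g y) \<le> (\<Sum>i\<in>Basis. \<bar>(g x - g y) \<bullet> i\<bar>)" by (rule norm_le_l1)
    also have "\<dots> \<le> (\<Sum>i\<in>Basis. B i * norm (x - y))"
    proof (rule sum_mono)
      fix i :: 'a assume i: "i \<in> Basis"
      have "norm (g x \<bullet> i - g y \<bullet> i) \<le> B i * norm (x - y)"
        by (rule differentiable_bound[where S=UNIV and f'="\<lambda>x h. H i x \<bullet> h"])
          (use H(1)[OF i] B(2)[OF i] on order_trans in \<open>auto, blast\<close>)
      then show "\<bar>(g x - g y) \<bullet> i\<bar> \<le> B i * norm (x - y)" by (simp add: inner_diff_left)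
    qed
    finally show ?thesis by (simp add: L_def sum_distrib_right)
  qed
  have gc: "continuous_on UNIV g"
    unfolding continuous_on_componentwise[of UNIV g] using H(1)
    by (auto intro!: continuous_at_imp_continuous_on has_derivative_continuous)
  obtain A where A: "0 \<le> A" "\<And>x. norm (g x) \<le> A" using bound[OF gc g0] by blast
  have lip: "\<bar>f (x + y) - f x\<bar> \<le> A * norm y" for x y
  proof -
    have "norm (f (x + y) - f x) \<le> A * norm (x + y - x)"
      by (rule differentiable_bound[where S=UNIV and f'="\<lambda>x h. g x \<bullet> h"])
        (use g A(2) on order_trans in \<open>auto, blast\<close>)
    then show ?thesis by simp
  qed
  have taylor: "\<bar>f (x + y) - f x - g x \<bullet> y\<bar> \<le> L * (norm y)\<^sup>2" for x y
  proof -
    let ?S = "closed_segment x (x + y)"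
    \<comment> \<open>The mean value inequality for f minus its linear part at x: along the segment
      the derivative is g z - g x, which the Lipschitz bound makes at most L norm y.\<close>
    have "norm ((f (x + y) - g x \<bullet> (x + y)) - (f x - g x \<bullet> x)) \<le> (L * norm y) * norm (x + y - x)"
    proof (rule differentiable_bound[where S="?S" and f'="\<lambda>z h. (g z - g x) \<bullet> h"])
      fix z assume z: "z \<in> ?S"
      show "((\<lambda>z. f z - g x \<bullet> z) has_derivative (\<lambda>h. (g z - g x) \<bullet> h)) (at z within ?S)"
        by (rule has_derivative_at_withinI) (auto intro!: derivative_eq_intros g simp: inner_diff_left)
      have "norm (z - x) \<le> norm y" using segment_bound(1)[OF z] by simp
      then have "norm (g z - g x) \<le> L * norm y" using gL[of z x] L0 by (meson mult_left_mono order_trans)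
      then show "onorm (\<lambda>h. (g z - g x) \<bullet> h) \<le> L * norm y" using on order_trans by blast
    qed auto
    then show ?thesis by (simp add: inner_add_right power2_eq_square algebra_simps)
  qed
  show ?thesis
  proof (intro exI[of _ g] exI[of _ "max A L"] conjI allI impI)
    show "0 \<le> max A L" using A by simp
    show "\<bar>f (x + y) - f x - g x \<bullet> y\<bar> \<le> max A L * (norm y)\<^sup>2" for x y
      using taylor[of x y] by (meson max.cobounded2 mult_right_mono order_trans zero_le_power2)
    show "\<bar>f (x + y) - f x\<bar> \<le> max A L * norm y" for x y
      using lip[of x y] by (meson max.cobounded1 mult_right_mono order_trans norm_ge_zero)
    show "norm (g x) \<le> max A L" for x using A(2)[of x] by simp
  qed (use g gc g0 in auto)
qed

text \<open>\<open>f\<close> and \<open>h\<close> are measurable only for the completion, so both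
  are replaced by Borel functions equal to them almost everywhere before the order of integration is
  changed on \<open>lborel\<close>. The kernel depends on both variables and is Borel from the
  start.\<close>

lemma tonelli_lebesgue_kernel:
  fixes f h :: "'a::euclidean_space \<Rightarrow> ennreal" and k :: "'a \<Rightarrow> 'a \<Rightarrow> ennreal"
  assumes f: "f \<in> borel_measurable lebesgue" and h: "h \<in> borel_measurable lebesgue"
    and k: "(\<lambda>p. k (fst p) (snd p)) \<in> borel_measurable borel"
  shows "(\<integral>\<^sup>+x. f x * (\<integral>\<^sup>+y. k x y * h y \<partial>lebesgue) \<partial>lebesgue) = (\<integral>\<^sup>+y. h y * (\<integral>\<^sup>+x. f x * k x y \<partial>lebesgue) \<partial>lebesgue)"
proof -
  obtain f' where f' [measurable]: "f' \<in> borel_measurable borel" and ff: "AE x in lborel. f x = f' x"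
    using completion_ex_borel_measurable[OF f] by auto
  obtain h' where h' [measurable]: "h' \<in> borel_measurable borel" and hh: "AE x in lborel. h x = h' x"
    using completion_ex_borel_measurable[OF h] by auto
  have k' [measurable]: "(\<lambda>p. k (fst p) (snd p)) \<in> borel_measurable (borel \<Otimes>\<^sub>M borel)"
    using k by (simp add: borel_prod)
  have m: "(\<lambda>(x, y). f' x * (k x y * h' y)) \<in> borel_measurable (lborel \<Otimes>\<^sub>M lborel)"
    unfolding split_beta by measurable
  have kx [measurable]: "k x \<in> borel_measurable borel" for x
    using measurable_compose[OF _ k', of "\<lambda>y. (x, y)" borel] by simp
  have ky [measurable]: "(\<lambda>x. k x y) \<in> borel_measurable borel" for y
    using measurable_compose[OF _ k', of "\<lambda>x. (x, y)" borel] by simp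
  have "(\<integral>\<^sup>+x. f x * (\<integral>\<^sup>+y. k x y * h y \<partial>lebesgue) \<partial>lebesgue) = (\<integral>\<^sup>+x. f' x * (\<integral>\<^sup>+y. k x y * h' y \<partial>lborel) \<partial>lborel)"
  proof -
    have "(\<integral>\<^sup>+y. k x y * h y \<partial>lborel) = (\<integral>\<^sup>+y. k x y * h' y \<partial>lborel)" for x
      by (rule nn_integral_cong_AE) (use hh in eventually_elim, simp)
    then show ?thesis unfolding nn_integral_completion
      by (intro nn_integral_cong_AE) (use ff in eventually_elim, simp)
  qed
  also have "\<dots> = (\<integral>\<^sup>+x. (\<integral>\<^sup>+y. f' x * (k x y * h' y) \<partial>lborel) \<partial>lborel)"
    by (intro nn_integral_cong nn_integral_cmult[symmetric]) measurable
  also have "\<dots> = (\<integral>\<^sup>+y. (\<integral>\<^sup>+x. f' x * (k x y * h' y) \<partial>lborel) \<partial>lborel)"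
    using lborel_pair.Fubini'[OF m] by simp
  also have "\<dots> = (\<integral>\<^sup>+y. h' y * (\<integral>\<^sup>+x. f' x * k x y \<partial>lborel) \<partial>lborel)"
  proof (rule nn_integral_cong)
    fix y
    have "(\<integral>\<^sup>+x. f' x * (k x y * h' y) \<partial>lborel) = (\<integral>\<^sup>+x. h' y * (f' x * k x y) \<partial>lborel)"
      by (simp add: mult_ac)
    also have "\<dots> = h' y * (\<integral>\<^sup>+x. f' x * k x y \<partial>lborel)" by (rule nn_integral_cmult) measurable
    finally show "(\<integral>\<^sup>+x. f' x * (k x y * h' y) \<partial>lborel) = h' y * (\<integral>\<^sup>+x. f' x * k x y \<partial>lborel)" .
  qed
  also have "\<dots> = (\<integral>\<^sup>+y. h y * (\<integral>\<^sup>+x. f x * k x y \<partial>lebesgue) \<partial>lebesgue)"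
  proof -
    have "(\<integral>\<^sup>+x. f' x * k x y \<partial>lborel) = (\<integral>\<^sup>+x. f x * k x y \<partial>lborel)" for y
      by (rule nn_integral_cong_AE) (use ff in eventually_elim, simp)
    then show ?thesis unfolding nn_integral_completion
      by (intro nn_integral_cong_AE) (use hh in eventually_elim, simp)
  qed
  finally show ?thesis .
qed

lemma quadratic_bound_has_derivative:
  fixes f :: "'a::real_normed_vector \<Rightarrow> real"
  assumes "bounded_linear f'" and q: "\<And>h. norm h < 1 \<Longrightarrow> \<bar>f (x + h) - f x - f' h\<bar> \<le> c * (norm h)\<^sup>2"
  shows "(f has_derivative f') (at x)"
  unfolding has_derivative_at
proof (intro conjI assms(1))
  show "(\<lambda>h. norm (f (x + h) - f x - f' h) / norm h) \<midarrow>0\<rightarrow> 0"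
  proof (rule Lim_null_comparison)
    show "eventually (\<lambda>h. norm (norm (f (x + h) - f x - f' h) / norm h) \<le> c * norm h) (at 0)"
      unfolding eventually_at
    proof (intro exI[of _ 1] conjI ballI impI)
      fix h :: 'a assume h: "h \<noteq> 0 \<and> dist h 0 < 1"
      then have "\<bar>f (x + h) - f x - f' h\<bar> / norm h \<le> c * (norm h)\<^sup>2 / norm h"
        using q[of h] by (intro divide_right_mono) auto
      then show "norm (norm (f (x + h) - f x - f' h) / norm h) \<le> c * norm h"
        using h by (simp add: power2_eq_square)
    qed simp
    show "((\<lambda>h::'a. c * norm h) \<longlongrightarrow> 0) (at 0)" by (rule tendsto_eq_intros refl)+ simp
  qed
qed

subsection \<open>Weak supersolutions\<close>

lemma integrable_bump: "0 < e \<Longrightarrow> integrable lebesgue (bump e c)"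
  and bump_measurable: "bump e c \<in> borel_measurable borel"
  and integral_bump_pos: "0 < e \<Longrightarrow> 0 < (LINT x|lebesgue. bump e c x)"
  for c :: "'a::euclidean_space"
proof -
  have "continuous_on UNIV (bump e c)"
    unfolding bump_def using Ck_on_flat_exp[of 0 0 "e\<^sup>2" c] by simp
  then show m: "bump e c \<in> borel_measurable borel" by (rule borel_measurable_continuous_onI)
  show i: "integrable lebesgue (bump e c)" if e: "0 < e"
  proof (rule Bochner_Integration.integrable_bound)
    show "integrable lebesgue (indicator (ball c e) :: 'a \<Rightarrow> real)"
      by (intro integrable_real_indicator) (auto simp: emeasure_lborel_ball_finite[unfolded infinity_ennreal_def])
    show "bump e c \<in> borel_measurable lebesgue" using m by (rule borel_measurable_lebesgueI)
    show "AE x in lebesgue. norm (bump e c x) \<le> norm (indicator (ball c e) x :: real)"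
    proof (rule AE_I2)
      fix x show "norm (bump e c x) \<le> norm (indicator (ball c e) x :: real)"
        using bump_eq_0[OF e, of x c] bump_le_1[of e c x] bump_nonneg[of e c x] by (cases "x \<in> ball c e") auto
    qed
  qed
  show "0 < (LINT x|lebesgue. bump e c x)" if e: "0 < e"
  proof (rule ccontr)
    assume "\<not> ?thesis"
    then have "(LINT x|lebesgue. bump e c x) = 0"
      using Bochner_Integration.integral_nonneg[where M=lebesgue and f="bump e c"] bump_nonneg[of e c]
      by (metis order_le_less)
    then have "AE x in lebesgue. bump e c x = 0"
      using integral_nonneg_eq_0_iff_AE[OF i[OF e]] bump_nonneg[of e c] by simp
    then have "AE x in lebesgue. x \<in> - ball c e"
      by eventually_elim (use bump_pos_iff[OF e, of c] in \<open>metis ComplI less_irrefl\<close>)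
    then have "c \<in> - ball c e" by (intro mem_closed_if_AE_lebesgue) auto
    then show False using e by simp
  qed
qed

context fractional_kernel begin

text \<open>\<open>nonlocal_op_split\<close> for the reflected kernel, followed by y \<mapsto> - y
  in the far part. This produces a convolution with K itself, the form in which the kernel can be
  moved from the test function onto u.\<close>

lemma dual_op_split:
  fixes f :: "'a \<Rightarrow> real"
  assumes f: "f \<in> borel_measurable borel" and B: "\<And>x. \<bar>f x\<bar> \<le> B" and r: "0 < r" and M: "0 \<le> M"
    and d: "(f has_derivative (\<lambda>h. G \<bullet> h)) (at x)"
    and q: "\<And>y. \<bar>f (x + y) - f x - G \<bullet> y\<bar> \<le> M * (norm y)\<^sup>2" and l: "\<And>y. \<bar>f (x + y) - f x\<bar> \<le> M * norm y"
  shows "set_integrable lebesgue (- ball 0 r) (\<lambda>y. f (x - y) * K y)"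
    and "dual_op s K b f x = (LINT y:- ball 0 r|lebesgue. K y) * f x - (LINT y:- ball 0 r|lebesgue. f (x - y) * K y)
       - trunc_drift s K b r \<bullet> G + core_op s (\<lambda>y. K (- y)) r f G x"
    and "\<bar>core_op s (\<lambda>y. K (- y)) r f G x\<bar> \<le> M * Lam * (ring_const DIM('a) \<kappa> * r powr \<kappa>)"
proof -
  interpret R: fractional_kernel s lam Lam N "\<lambda>y. K (- y)" by (rule reflect)
  have fl: "f \<in> borel_measurable lebesgue" using f by (rule borel_measurable_lebesgueI)
  have B0: "0 \<le> B" using B[of 0] by linarith
  show fK: "set_integrable lebesgue (- ball 0 r) (\<lambda>y. f (x - y) * K y)"
    using tail_bound(1)[OF lebesgue_measurable_reflection(1)[OF fl, of x] B0 r] B by (simp add: mult.commute)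
  have "set_integrable lebesgue (- ball 0 r) (\<lambda>y. K (- y) *\<^sub>R (f x - f (x + y)))"
  proof (rule R.tail_bound(1)[OF _ _ r, where M="2 * B"])
    show "(\<lambda>y. f x - f (x + y)) \<in> borel_measurable lebesgue"
      using lebesgue_measurable_translation[OF fl, of x] by simp
    show "norm (f x - f (x + y)) \<le> 2 * B" for y using B[of x] B[of "x + y"] by (simp add: abs_le_iff)
  qed (use B0 in simp)
  then have far: "set_integrable lebesgue (- ball 0 r) (\<lambda>y. (f x - f (x + y)) * K (- y))" by (simp add: mult.commute)
  have near: "\<bar>f x - f (x + y) + first_order s * (G \<bullet> y)\<bar> \<le> M * norm y powr taylor_order s" for y
  proof (cases "s < 1 / 2")
    case True
    then show ?thesis using l[of y] by (simp add: first_order_def taylor_order_def abs_minus_commute)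
  next
    case False
    have "norm y powr 2 = (norm y)\<^sup>2" by (cases "y = 0") (auto simp: powr_numeral)
    moreover have "\<bar>f x - f (x + y) + G \<bullet> y\<bar> = \<bar>f (x + y) - f x - G \<bullet> y\<bar>" by linarith
    ultimately show ?thesis using q[of y] False by (simp add: first_order_def taylor_order_def)
  qed
  note sp = R.nonlocal_op_split[OF fl r M d far near]
  show "\<bar>core_op s (\<lambda>y. K (- y)) r f G x\<bar> \<le> M * Lam * (ring_const DIM('a) \<kappa> * r powr \<kappa>)" by (rule sp(2))
  have "(LINT y:- ball 0 r|lebesgue. (f x - f (x + y)) * K (- y)) = (LINT y:- ball 0 r|lebesgue. (f x - f (x - y)) * K y)"
  proof -
    have m: "(\<lambda>y. (f x - f (x - y)) * K y) \<in> borel_measurable lebesgue"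
      using lebesgue_measurable_reflection(1)[OF fl, of x] by measurable
    show ?thesis
      using set_integral_lebesgue_reflection[OF m, of "- ball 0 r"] by simp
  qed
  also have "\<dots> = (LINT y:- ball 0 r|lebesgue. f x * K y - f (x - y) * K y)" by (simp add: left_diff_distrib)
  also have "\<dots> = (LINT y:- ball 0 r|lebesgue. K y) * f x - (LINT y:- ball 0 r|lebesgue. f (x - y) * K y)"
    using kernel_far_integrable[OF r] fK by (subst set_integral_diff(2)) (auto simp: mult.commute)
  finally show "dual_op s K b f x = (LINT y:- ball 0 r|lebesgue. K y) * f x - (LINT y:- ball 0 r|lebesgue. f (x - y) * K y)
       - trunc_drift s K b r \<bullet> G + core_op s (\<lambda>y. K (- y)) r f G x"
    using sp(1)[of "- b"] by (simp add: dual_op_def trunc_op_def trunc_drift_reflect)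
qed

lemma core_op_eq_0:
  fixes f :: "'a \<Rightarrow> real"
  assumes "\<And>y. y \<in> ball 0 r \<Longrightarrow> f (x + y) = 0" "f x = 0" "G = 0"
  shows "core_op s K' r f G x = 0"
proof -
  have "core_op s K' r f G x = (LINT y:ball (0::'a) r|lebesgue. 0)"
    unfolding core_op_def using assms by (intro set_lebesgue_integral_cong) auto
  then show ?thesis by simp
qed

section \<open>Weighted integrability of weak supersolutions\<close>

text \<open>Only the integrability clause of \<open>weak_supersolution\<close> is exploited. Outside
  the support of a bump the dual operator reduces to minus the convolution of the bump with K, and
  the lower bound on K makes that convolution at least a multiple of \<open>1 / wt\<close>.\<close>

lemma weak_integrable_off_ball:
  fixes u :: "'a \<Rightarrow> real"
  assumes pos: "\<And>x. 0 \<le> u x" and weak: "weak_supersolution s K b C0 (ball 0 1) u"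
    and e: "0 < e" "cball c e \<subseteq> ball 0 1"
  shows "set_integrable lebesgue (- cball c e) (\<lambda>x. u x / wt x)"
proof -
  define c0 where "c0 = lam / 2 powr N"
  have c0: "0 < c0" using lam by (simp add: c0_def)
  let ?f = "bump e c"
  have um: "u \<in> borel_measurable lebesgue" using weak by (simp add: weak_supersolution_def)
  have smooth: "smooth_compact_support (ball 0 1) ?f" using smooth_compact_support_bump[OF e, of 1] by simp
  then have ui: "integrable lebesgue (\<lambda>x. u x * dual_op s K b ?f x)"
    using weak bump_nonneg unfolding weak_supersolution_def by blast
  have "Ck_on 2 UNIV ?f" using smooth by (simp add: smooth_compact_support_def)
  moreover have "?f x = 0" if "x \<notin> cball c e" for x
    using that ball_subset_cball[of c e] by (intro bump_eq_0[OF e(1)]) auto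
  ultimately have "\<exists>g M. (\<forall>x. (?f has_derivative (\<lambda>h. g x \<bullet> h)) (at x)) \<and> continuous_on UNIV g \<and> 0 \<le> M \<and>
    (\<forall>x y. \<bar>?f (x + y) - ?f x - g x \<bullet> y\<bar> \<le> M * (norm y)\<^sup>2) \<and> (\<forall>x y. \<bar>?f (x + y) - ?f x\<bar> \<le> M * norm y) \<and>
    (\<forall>x. norm (g x) \<le> M) \<and> (\<forall>x. x \<notin> cball c e \<longrightarrow> g x = 0)"
    by (rule C2_compact_support_taylor[OF _ compact_cball])
  then obtain g M where g: "\<And>x. (?f has_derivative (\<lambda>h. g x \<bullet> h)) (at x)" "0 \<le> M"
    "\<And>x y. \<bar>?f (x + y) - ?f x - g x \<bullet> y\<bar> \<le> M * (norm y)\<^sup>2" "\<And>x y. \<bar>?f (x + y) - ?f x\<bar> \<le> M * norm y"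
    "\<And>x. x \<notin> cball c e \<Longrightarrow> g x = 0"
    by blast
  define I where "I = (LINT x|lebesgue. ?f x)"
  have I: "0 < I" unfolding I_def using e(1) by (rule integral_bump_pos)
  have key: "c0 * I / wt x \<le> - dual_op s K b ?f x" if x: "x \<notin> cball c e" for x
  proof -
    \<comment> \<open>The distance from \<open>x\<close> to the ball carrying the bump: with this
      truncation radius the bump vanishes throughout the core, and the operator is its far part
      alone.\<close>
    define r where "r = dist c x - e"
    have r: "0 < r" using x by (simp add: r_def)
    have z: "?f (x + y) = 0" "?f (x - y) = 0" if "norm y < r" for y
    proof -
      have "e \<le> dist c (x + y)" "e \<le> dist c (x - y)"
        using that norm_triangle_ineq[of "c - x - y" y] norm_triangle_ineq4[of "c - x + y" y]
        by (auto simp: r_def dist_norm algebra_simps)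
      then show "?f (x + y) = 0" "?f (x - y) = 0" by (auto intro!: bump_eq_0[OF e(1)])
    qed
    have fx: "?f x = 0" using z(1)[of 0] r by simp
    note sp = dual_op_split[where f="?f" and x=x and B=1, OF bump_measurable _ r g(2) g(1) g(3) g(4)]
    have b1: "\<bar>?f x\<bar> \<le> 1" for x using bump_le_1[of e c x] bump_nonneg[of e c x] by simp
    have "core_op s (\<lambda>y. K (- y)) r ?f (g x) x = 0"
      using z(1) fx g(5)[OF x] by (intro core_op_eq_0) auto
    then have D: "- dual_op s K b ?f x = (LINT y:- ball 0 r|lebesgue. ?f (x - y) * K y)"
      using sp(2)[OF b1] fx g(5)[OF x] by simp
    have fi: "integrable lebesgue (\<lambda>y. ?f (x - y))"
      using integrable_distr[OF lebesgue_affine_isometry_measurable[where c="-1" and t=x], of ?f] integrable_bump[OF e(1), of c]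
      by (simp add: distr_lebesgue_affine_isometry[where c="-1", simplified])
    have fI: "(LINT y|lebesgue. ?f (x - y)) = I"
      using integral_distr[OF lebesgue_affine_isometry_measurable[where c="-1" and t=x], of ?f] bump_measurable[of e c]
      by (simp add: distr_lebesgue_affine_isometry[where c="-1", simplified] I_def borel_measurable_lebesgueI)
    have "c0 * I / wt x = (LINT y|lebesgue. c0 / wt x * ?f (x - y))"
      by (simp add: fI)
    also have "\<dots> = (LINT y:- ball 0 r|lebesgue. c0 / wt x * ?f (x - y))"
      unfolding set_lebesgue_integral_def using z(2)
      by (intro Bochner_Integration.integral_cong) (auto simp: indicator_def)
    also have "\<dots> \<le> (LINT y:- ball 0 r|lebesgue. ?f (x - y) * K y)"
    proof (rule set_integral_mono)
      show "set_integrable lebesgue (- ball 0 r) (\<lambda>y. c0 / wt x * ?f (x - y))"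
        unfolding set_integrable_def by (intro integrable_mult_indicator integrable_mult_right fi) auto
      show "set_integrable lebesgue (- ball 0 r) (\<lambda>y. ?f (x - y) * K y)" using sp(1)[OF b1] .
      fix y :: 'a assume y: "y \<in> - ball 0 r"
      show "c0 / wt x * ?f (x - y) \<le> ?f (x - y) * K y"
      proof (cases "x - y \<in> ball c e")
        case True
        then have "norm (x - y) < 1" using e(2) ball_subset_cball by fastforce
        then have "norm y \<le> norm x + 1" using norm_triangle_ineq4[of x "x - y"] by simp
        then have "c0 / wt x \<le> K y" unfolding c0_def
          by (rule kernel_weight) (use y r in auto)
        then have "c0 / wt x * ?f (x - y) \<le> K y * ?f (x - y)"
          using bump_nonneg by (rule mult_right_mono)
        then show ?thesis by (simp only: mult.commute)
      next
        case False
        then show ?thesis using bump_eq_0[OF e(1) False] by simp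
      qed
    qed
    finally show ?thesis unfolding D .
  qed
  show ?thesis
  proof (rule set_integrable_bound)
    have "integrable lebesgue (\<lambda>x. (1 / (c0 * I)) * (u x * dual_op s K b ?f x))" using ui by (rule integrable_mult_right)
    then show "set_integrable lebesgue (- cball c e) (\<lambda>x. (1 / (c0 * I)) * (u x * dual_op s K b ?f x))"
      unfolding set_integrable_def by (intro integrable_mult_indicator) auto
    show "set_borel_measurable lebesgue (- cball c e) (\<lambda>x. u x / wt x)"
      unfolding set_borel_measurable_def
      by (intro borel_measurable_scaleR borel_measurable_indicator borel_measurable_divide um weight_meas) auto
    show "AE x in lebesgue. x \<in> - cball c e \<longrightarrow> norm (u x / wt x) \<le> norm (1 / (c0 * I) * (u x * dual_op s K b ?f x))"
    proof (intro AE_I2 impI)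
      fix x assume "x \<in> - cball c e"
      then have k: "c0 * I / wt x \<le> - dual_op s K b ?f x" using key by simp
      have "1 / wt x = (1 / (c0 * I)) * (c0 * I / wt x)" using c0 I by simp
      also have "\<dots> \<le> (1 / (c0 * I)) * (- dual_op s K b ?f x)" using k c0 I by (intro mult_left_mono) auto
      also have "\<dots> \<le> (1 / (c0 * I)) * \<bar>dual_op s K b ?f x\<bar>" using c0 I by (intro mult_left_mono) auto
      finally have "u x * (1 / wt x) \<le> u x * ((1 / (c0 * I)) * \<bar>dual_op s K b ?f x\<bar>)"
        using pos[of x] by (rule mult_left_mono)
      then show "norm (u x / wt x) \<le> norm (1 / (c0 * I) * (u x * dual_op s K b ?f x))"
        using pos[of x] c0 I weight_pos[of x] by (simp add: abs_mult mult_ac abs_of_pos)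
    qed
  qed
qed

text \<open>The closed balls of radius 1/8 around 0 and around a point of norm 1/2 are disjoint, so
  their complements cover the space.\<close>

lemma weak_integrable:
  fixes u :: "'a \<Rightarrow> real"
  assumes pos: "\<And>x. 0 \<le> u x" and weak: "weak_supersolution s K b C0 (ball 0 1) u"
  shows "integrable lebesgue (\<lambda>x. u x / wt x)"
proof -
  obtain i :: 'a where i: "i \<in> Basis" using nonempty_Basis by blast
  let ?p = "(1 / 2) *\<^sub>R i"
  have np: "norm ?p = 1 / 2" using i by simp
  have sub: "cball (0::'a) (1 / 8) \<subseteq> ball 0 1" by auto
  have sub': "cball ?p (1 / 8) \<subseteq> ball 0 1"
  proof
    fix x assume "x \<in> cball ?p (1 / 8)"
    then have "norm (x - ?p) \<le> 1 / 8" by (simp add: dist_norm norm_minus_commute)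
    then show "x \<in> ball 0 1" using norm_triangle_sub[of x ?p] np by simp
  qed
  have "- cball (0::'a) (1 / 8) \<union> - cball ?p (1 / 8) = UNIV"
  proof -
    have "x \<notin> cball ?p (1 / 8)" if "x \<in> cball 0 (1 / 8)" for x
    proof
      assume "x \<in> cball ?p (1 / 8)"
      then have "norm (?p - x) \<le> 1 / 8" by (simp add: dist_norm)
      then show False using norm_triangle_sub[of ?p x] that unfolding np by simp
    qed
    then show ?thesis by blast
  qed
  moreover have "set_integrable lebesgue (- cball 0 (1 / 8) \<union> - cball ?p (1 / 8)) (\<lambda>x. u x / wt x)"
    by (intro set_integrable_Un weak_integrable_off_ball[OF pos weak] sub sub') auto
  ultimately show ?thesis unfolding set_integrable_def by simp
qed

end

text \<open>In the application \<open>\<rho>\<close> is a normalised \<open>bump\<close> of radius \<open>e\<close>; \<open>U\<close> is the mollification of \<open>u\<close>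
  and \<open>GU\<close> its gradient.\<close>

locale mollified = fractional_kernel s lam Lam N K
  for s lam Lam N :: real and K :: "'a::euclidean_space \<Rightarrow> real" +
  fixes u :: "'a \<Rightarrow> real" and e M :: real and \<rho> :: "'a \<Rightarrow> real" and g :: "'a \<Rightarrow> 'a"
  assumes um: "u \<in> borel_measurable lebesgue" and u_nonneg: "\<And>x. 0 \<le> u x"
    and ui: "integrable lebesgue (\<lambda>x. u x / wt x)"
    and e: "0 < e" "e < 1 / 4" and M0: "0 \<le> M"
    and \<rho>_nonneg: "\<And>x. 0 \<le> \<rho> x" and \<rho>_le: "\<And>x. \<rho> x \<le> M" and \<rho>_supp: "\<And>x. x \<notin> ball 0 e \<Longrightarrow> \<rho> x = 0"
    and \<rho>_meas: "\<rho> \<in> borel_measurable borel" and \<rho>_int: "(\<integral>\<^sup>+x. ennreal (\<rho> x) \<partial>lebesgue) = 1"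
    and \<rho>_deriv: "\<And>x. (\<rho> has_derivative (\<lambda>h. g x \<bullet> h)) (at x)"
    and g_meas: "g \<in> borel_measurable borel" and g_le: "\<And>x. norm (g x) \<le> M" and g_supp: "\<And>x. x \<notin> cball 0 e \<Longrightarrow> g x = 0"
    and \<rho>_taylor: "\<And>x y. \<bar>\<rho> (x + y) - \<rho> x - g x \<bullet> y\<bar> \<le> M * (norm y)\<^sup>2"
    and \<rho>_lip: "\<And>x y. \<bar>\<rho> (x + y) - \<rho> x\<bar> \<le> M * norm y"
    and \<rho>_test: "\<And>z. norm z < 3 / 4 \<Longrightarrow> smooth_compact_support (ball 0 1) (\<lambda>x. \<rho> (x - z))"
begin

section \<open>Mollification\<close>

text \<open>Correlation rather than convolution: \<open>U z\<close> is the pairing of u with the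
  translate of \<rho> centred at \<open>z\<close>, which is the test function used at
  \<open>z\<close>.\<close>

definition U :: "'a \<Rightarrow> real" where "U z = (LINT x|lebesgue. u x * \<rho> (x - z))"

text \<open>The minus sign arises because \<open>z\<close> enters through
  \<open>x - z\<close>.\<close>

definition GU :: "'a \<Rightarrow> 'a" where "GU z = - (LINT x|lebesgue. u x *\<^sub>R g (x - z))"

text \<open>The weight is bounded on a ball, so the finite weighted integral makes u integrable
  there.\<close>

lemma local_integrable:
  fixes q :: "'a \<Rightarrow> 'c::{banach,second_countable_topology}"
  assumes q: "q \<in> borel_measurable lebesgue" and B: "\<And>x. norm (q x) \<le> B" and R: "\<And>x. x \<notin> cball z R \<Longrightarrow> q x = 0"
  shows "integrable lebesgue (\<lambda>x. u x *\<^sub>R q x)"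
proof -
  have B0: "0 \<le> B" using B[of 0] norm_ge_zero order_trans by blast
  define c where "c = B * (1 + (norm z + \<bar>R\<bar>) powr N)"
  show ?thesis
  proof (rule Bochner_Integration.integrable_bound)
    show "integrable lebesgue (\<lambda>x. c * (u x / wt x))" using ui by (rule integrable_mult_right)
    show "(\<lambda>x. u x *\<^sub>R q x) \<in> borel_measurable lebesgue" using um q by measurable
    show "AE x in lebesgue. norm (u x *\<^sub>R q x) \<le> norm (c * (u x / wt x))"
    proof (rule AE_I2)
      fix x :: 'a
      show "norm (u x *\<^sub>R q x) \<le> norm (c * (u x / wt x))"
      proof (cases "x \<in> cball z R")
        case True
        then have "norm x \<le> norm z + \<bar>R\<bar>"
          using norm_triangle_sub[of x z] by (simp add: dist_norm norm_minus_commute)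
        then have "norm x powr N \<le> (norm z + \<bar>R\<bar>) powr N" using N_pos by (intro powr_mono2) auto
        then have "B * wt x \<le> c" unfolding c_def using B0 by (intro mult_left_mono) auto
        then have "B \<le> c / wt x" using weight_pos[of x] by (simp add: le_divide_eq)
        then have "norm (q x) \<le> c / wt x" using B[of x] by linarith
        then have "u x * norm (q x) \<le> u x * (c / wt x)" using u_nonneg[of x] by (rule mult_left_mono)
        moreover have "0 \<le> c" using B0 by (simp add: c_def)
        ultimately show ?thesis using u_nonneg[of x] weight_pos[of x] by (simp add: abs_of_pos mult_ac)
      qed (simp add: R)
    qed
  qed
qed

lemma shift_meas:
  fixes q :: "'a \<Rightarrow> 'c::topological_space"
  assumes "q \<in> borel_measurable borel"
  shows "(\<lambda>x. q (x - z)) \<in> borel_measurable lebesgue"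
  using lebesgue_measurable_translation[OF borel_measurable_lebesgueI[OF assms], of "- z"] by simp

lemma u\<rho>_integrable: "integrable lebesgue (\<lambda>x. u x * \<rho> (x - z))"
proof -
  have "norm (\<rho> (x - z)) \<le> M" for x using \<rho>_nonneg[of "x - z"] \<rho>_le[of "x - z"] by simp
  moreover have "\<rho> (x - z) = 0" if "x \<notin> cball z e" for x
    using that by (intro \<rho>_supp) (simp add: dist_norm norm_minus_commute)
  ultimately show ?thesis using local_integrable[OF shift_meas[OF \<rho>_meas, of z], of M z e] by simp
qed

lemma ug_integrable: "integrable lebesgue (\<lambda>x. u x *\<^sub>R g (x - z))"
proof -
  have "g (x - z) = 0" if "x \<notin> cball z e" for x
    using that by (intro g_supp) (simp add: dist_norm norm_minus_commute)
  then show ?thesis using local_integrable[OF shift_meas[OF g_meas, of z], of M z e] g_le by simp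
qed

lemma U_nonneg: "0 \<le> U z"
  unfolding U_def by (intro Bochner_Integration.integral_nonneg mult_nonneg_nonneg u_nonneg \<rho>_nonneg)

lemma ennreal_U: "ennreal (U z) = (\<integral>\<^sup>+x. ennreal (u x) * ennreal (\<rho> (x - z)) \<partial>lebesgue)"
proof -
  have "(\<integral>\<^sup>+x. ennreal (u x * \<rho> (x - z)) \<partial>lebesgue) = ennreal (U z)"
    unfolding U_def using u_nonneg \<rho>_nonneg by (intro nn_integral_eq_integral u\<rho>_integrable) auto
  then show ?thesis using u_nonneg \<rho>_nonneg by (simp add: ennreal_mult)
qed

text \<open>The quadratic Taylor bound for \<rho> is uniform in the base point. Integrated against u
  over \<open>cball z (e + 1)\<close>, which contains the supports of all translates with norm h <
  1, it gives a quadratic remainder for U.\<close>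

lemma U_has_derivative: "(U has_derivative (\<lambda>h. GU z \<bullet> h)) (at z)"
proof (rule quadratic_bound_has_derivative)
  show "bounded_linear (\<lambda>h. GU z \<bullet> h)" by (rule bounded_linear_inner_right)
  define P where "P = (LINT x|lebesgue. u x * indicator (cball z (e + 1)) x)"
  have Pi: "integrable lebesgue (\<lambda>x. u x * indicator (cball z (e + 1)) x)"
  proof -
    have "(indicator (cball z (e + 1)) :: 'a \<Rightarrow> real) \<in> borel_measurable lebesgue"
      by (intro borel_measurable_indicator) auto
    then show ?thesis using local_integrable[of "indicator (cball z (e + 1)) :: 'a \<Rightarrow> real" 1 z "e + 1"] by simp
  qed
  fix h :: 'a assume h: "norm h < 1"
  have i3: "integrable lebesgue (\<lambda>x. (u x *\<^sub>R g (x - z)) \<bullet> h)" using ug_integrable by (rule integrable_inner_left)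
  have "U (z + h) - U z - GU z \<bullet> h = (LINT x|lebesgue. u x * \<rho> (x - (z + h)) - u x * \<rho> (x - z) + (u x *\<^sub>R g (x - z)) \<bullet> h)"
    unfolding U_def GU_def using u\<rho>_integrable[of "z + h"] u\<rho>_integrable[of z] i3 integral_inner_left[OF ug_integrable[of z], of h]
    by simp
  also have "norm \<dots> \<le> (LINT x|lebesgue. (M * (norm h)\<^sup>2) * (u x * indicator (cball z (e + 1)) x))"
  proof (rule Bochner_Integration.integral_norm_bound_integral)
    show "integrable lebesgue (\<lambda>x. u x * \<rho> (x - (z + h)) - u x * \<rho> (x - z) + (u x *\<^sub>R g (x - z)) \<bullet> h)"
      by (intro Bochner_Integration.integrable_add Bochner_Integration.integrable_diff u\<rho>_integrable i3)
    show "integrable lebesgue (\<lambda>x. (M * (norm h)\<^sup>2) * (u x * indicator (cball z (e + 1)) x))"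
      using Pi by (rule integrable_mult_right)
    fix x
    show "norm (u x * \<rho> (x - (z + h)) - u x * \<rho> (x - z) + (u x *\<^sub>R g (x - z)) \<bullet> h)
       \<le> (M * (norm h)\<^sup>2) * (u x * indicator (cball z (e + 1)) x)"
    proof (cases "x \<in> cball z (e + 1)")
      case True
      have "u x * \<rho> (x - (z + h)) - u x * \<rho> (x - z) + (u x *\<^sub>R g (x - z)) \<bullet> h
         = u x * (\<rho> ((x - z) + (- h)) - \<rho> (x - z) - g (x - z) \<bullet> (- h))"
        by (simp add: algebra_simps)
      then have "norm (u x * \<rho> (x - (z + h)) - u x * \<rho> (x - z) + (u x *\<^sub>R g (x - z)) \<bullet> h)
         = u x * \<bar>\<rho> ((x - z) + (- h)) - \<rho> (x - z) - g (x - z) \<bullet> (- h)\<bar>"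
        using u_nonneg[of x] by (simp add: abs_mult)
      also have "\<dots> \<le> u x * (M * (norm h)\<^sup>2)"
        using \<rho>_taylor[of "x - z" "- h"] u_nonneg[of x] by (intro mult_left_mono) auto
      finally show ?thesis using True by (simp add: mult_ac)
    next
      case False
      then have "e + 1 < norm (x - z)" by (simp add: dist_norm norm_minus_commute)
      then have "e < norm (x - (z + h))" using norm_triangle_ineq2[of "x - z" h] h by (simp add: algebra_simps)
      then have "\<rho> (x - (z + h)) = 0" by (intro \<rho>_supp) simp
      moreover have "\<rho> (x - z) = 0" "g (x - z) = 0"
        using \<open>e + 1 < norm (x - z)\<close> by (auto intro!: \<rho>_supp g_supp)
      ultimately show ?thesis using False by simp
    qed
  qed
  also have "\<dots> = M * P * (norm h)\<^sup>2" by (simp add: P_def)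
  finally show "\<bar>U (z + h) - U z - GU z \<bullet> h\<bar> \<le> M * P * (norm h)\<^sup>2" by simp
qed

lemma U_isCont: "isCont U z"
  using U_has_derivative has_derivative_continuous by blast

lemma U_meas: "U \<in> borel_measurable borel"
  using U_isCont by (intro borel_measurable_continuous_onI continuous_at_imp_continuous_on) auto

lemma \<rho>_kernel_meas: "(\<lambda>p. ennreal (\<rho> (fst p - snd p - z))) \<in> borel_measurable borel"
proof -
  have "(\<lambda>p::'a \<times> 'a. fst p - snd p - z) \<in> borel_measurable borel"
    by (intro borel_measurable_continuous_onI continuous_intros)
  from measurable_compose[OF this \<rho>_meas] show ?thesis by simp
qed

lemma \<rho>_reflected_int: "(\<integral>\<^sup>+y. ennreal (\<rho> (x - y)) \<partial>lebesgue) = 1"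
  using nn_integral_distr[OF lebesgue_affine_isometry_measurable[where c="-1" and t=x], of "\<lambda>y. ennreal (\<rho> y)"]
    \<rho>_int borel_measurable_lebesgueI[OF \<rho>_meas]
  by (simp add: distr_lebesgue_affine_isometry[where c="-1", simplified])

lemma nn_integral_U:
  assumes h: "h \<in> borel_measurable lebesgue"
  shows "(\<integral>\<^sup>+y. h y * ennreal (U (z + y)) \<partial>lebesgue) = (\<integral>\<^sup>+x. ennreal (u x) * (\<integral>\<^sup>+y. ennreal (\<rho> (x - y - z)) * h y \<partial>lebesgue) \<partial>lebesgue)"
proof -
  have "(\<integral>\<^sup>+x. ennreal (u x) * (\<integral>\<^sup>+y. ennreal (\<rho> (x - y - z)) * h y \<partial>lebesgue) \<partial>lebesgue)
    = (\<integral>\<^sup>+y. h y * (\<integral>\<^sup>+x. ennreal (u x) * ennreal (\<rho> (x - y - z)) \<partial>lebesgue) \<partial>lebesgue)"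
    using um h \<rho>_kernel_meas by (intro tonelli_lebesgue_kernel) auto
  then show ?thesis by (simp add: ennreal_U algebra_simps)
qed

lemma weight_near:
  assumes "norm (x - z) < e"
  shows "wt x \<le> (1 + 2 powr N) * wt (z::'a)"
proof -
  have "norm x \<le> norm z + 1" using norm_triangle_sub[of x z] assms e by simp
  from weight_compare[OF this] powr_ge_zero[of "norm z" N] show ?thesis
    unfolding distrib_right[of 1] mult_1_left by linarith
qed

lemma inverse_weight_near:
  assumes "norm (x - z) < e"
  shows "1 / wt z \<le> (1 + 2 powr N) * (1 / wt (x::'a))"
proof -
  have "wt x / (wt z * wt x)
     \<le> ((1 + 2 powr N) * wt z) / (wt z * wt x)"
    using weight_near[OF assms] weight_pos[of z] weight_pos[of x] by (intro divide_right_mono) auto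
  then show ?thesis using weight_pos[of z] weight_pos[of x] by simp
qed

lemma inv_weight_meas: "(\<lambda>x::'a. ennreal (1 / wt x)) \<in> borel_measurable lebesgue"
  using borel_measurable_divide[OF _ weight_meas, of "\<lambda>_. 1"] by simp

lemma U_weight:
  "(\<integral>\<^sup>+z. ennreal (1 / wt z) * ennreal (U z) \<partial>lebesgue)
    = (\<integral>\<^sup>+x. ennreal (u x) * (\<integral>\<^sup>+z. ennreal (\<rho> (x - z)) * ennreal (1 / wt z) \<partial>lebesgue) \<partial>lebesgue)"
  using nn_integral_U[OF inv_weight_meas, of 0] by simp

text \<open>At distance below e < 1 the weights at two points differ at most by the factor 1 + 2^N;
  averaging this against \<rho>, which has total mass 1, compares u with U. The factor does not
  involve \<open>e\<close>, which matters because \<open>e\<close> is chosen from u and the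
  level.\<close>

lemma u_weight_le:
  "mass u
    \<le> ennreal (1 + 2 powr N) * mass U"
proof -
  have "mass u
    \<le> (\<integral>\<^sup>+x. ennreal (1 + 2 powr N) * (ennreal (u x) * (\<integral>\<^sup>+z. ennreal (\<rho> (x - z)) * ennreal (1 / wt z) \<partial>lebesgue)) \<partial>lebesgue)"
  proof (rule nn_integral_mono)
    fix x :: 'a
    have "ennreal (1 / wt x) = ennreal (1 / wt x) * (\<integral>\<^sup>+z. ennreal (\<rho> (x - z)) \<partial>lebesgue)"
      by (simp add: \<rho>_reflected_int)
    also have "\<dots> = (\<integral>\<^sup>+z. ennreal (1 / wt x) * ennreal (\<rho> (x - z)) \<partial>lebesgue)"
      using lebesgue_measurable_reflection(1)[OF borel_measurable_lebesgueI[OF \<rho>_meas], of x]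
      by (intro nn_integral_cmult[symmetric]) auto
    also have "\<dots> \<le> (\<integral>\<^sup>+z. ennreal (1 + 2 powr N) * (ennreal (\<rho> (x - z)) * ennreal (1 / wt z)) \<partial>lebesgue)"
    proof (rule nn_integral_mono)
      fix z :: 'a
      show "ennreal (1 / wt x) * ennreal (\<rho> (x - z)) \<le> ennreal (1 + 2 powr N) * (ennreal (\<rho> (x - z)) * ennreal (1 / wt z))"
      proof (cases "x - z \<in> ball 0 e")
        case True
        then have "1 / wt x \<le> (1 + 2 powr N) * (1 / wt z)"
          by (intro inverse_weight_near) (simp add: norm_minus_commute)
        then have "1 / wt x * \<rho> (x - z) \<le> (1 + 2 powr N) * (1 / wt z) * \<rho> (x - z)"
          using \<rho>_nonneg by (rule mult_right_mono)
        then have "ennreal (1 / wt x * \<rho> (x - z)) \<le> ennreal ((1 + 2 powr N) * (\<rho> (x - z) * (1 / wt z)))"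
          by (intro ennreal_leI) (simp add: mult_ac)
        then show ?thesis using weight_pos[of x] weight_pos[of z] \<rho>_nonneg[of "x - z"]
          by (simp only: ennreal_mult' ennreal_mult'' less_imp_le divide_nonneg_nonneg zero_le_one add_nonneg_nonneg powr_ge_zero)
      next
        case False
        then show ?thesis using \<rho>_supp by simp
      qed
    qed
    also have "\<dots> = ennreal (1 + 2 powr N) * (\<integral>\<^sup>+z. ennreal (\<rho> (x - z)) * ennreal (1 / wt z) \<partial>lebesgue)"
      using lebesgue_measurable_reflection(1)[OF borel_measurable_lebesgueI[OF \<rho>_meas], of x] inv_weight_meas
      by (intro nn_integral_cmult) auto
    finally have "ennreal (u x) * ennreal (1 / wt x)
       \<le> ennreal (u x) * (ennreal (1 + 2 powr N) * (\<integral>\<^sup>+z. ennreal (\<rho> (x - z)) * ennreal (1 / wt z) \<partial>lebesgue))"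
      by (rule mult_left_mono) simp
    moreover have "ennreal (u x / wt x) = ennreal (u x) * ennreal (1 / wt x)"
      using u_nonneg[of x] weight_pos[of x] by (simp add: ennreal_mult[symmetric])
    ultimately show "ennreal (u x / wt x)
       \<le> ennreal (1 + 2 powr N) * (ennreal (u x) * (\<integral>\<^sup>+z. ennreal (\<rho> (x - z)) * ennreal (1 / wt z) \<partial>lebesgue))"
      by (simp add: mult_ac)
  qed
  also have "\<dots> \<le> ennreal (1 + 2 powr N) * (\<integral>\<^sup>+z. ennreal (1 / wt z) * ennreal (U z) \<partial>lebesgue)"
  proof -
    have "(\<lambda>x. \<integral>\<^sup>+z. ennreal (\<rho> (x - z)) * ennreal (1 / wt z) \<partial>lborel) \<in> borel_measurable lborel"
    proof (rule lborel.borel_measurable_nn_integral)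
      have B: "(\<lambda>p::'a \<times> 'a. ennreal (\<rho> (fst p - snd p)) * ennreal (1 / wt (snd p))) \<in> borel_measurable borel"
      proof (rule borel_measurable_times_ennreal)
        show "(\<lambda>p::'a \<times> 'a. ennreal (\<rho> (fst p - snd p))) \<in> borel_measurable borel"
          using \<rho>_kernel_meas[of 0] by (simp only: diff_zero)
        have "(\<lambda>x::'a. ennreal (1 / wt x)) \<in> borel_measurable borel" by measurable
        then show "(\<lambda>p::'a \<times> 'a. ennreal (1 / wt (snd p))) \<in> borel_measurable borel"
          by (rule measurable_compose[rotated]) (intro borel_measurable_continuous_onI continuous_intros)
      qed
      have "sets (lborel \<Otimes>\<^sub>M lborel :: ('a \<times> 'a) measure) = sets borel"
        using sets_pair_measure_cong[OF sets_lborel sets_lborel] unfolding borel_prod .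
      then have M1: "borel_measurable (lborel \<Otimes>\<^sub>M lborel) = (borel_measurable borel :: ('a \<times> 'a \<Rightarrow> ennreal) set)"
        by (rule measurable_cong_sets) (rule refl)
      show "(\<lambda>(x, z). ennreal (\<rho> (x - z)) * ennreal (1 / wt z)) \<in> borel_measurable (lborel \<Otimes>\<^sub>M lborel)"
        unfolding split_beta M1 by (rule B)
    qed
    then have "(\<lambda>x. \<integral>\<^sup>+z. ennreal (\<rho> (x - z)) * ennreal (1 / wt z) \<partial>lebesgue) \<in> borel_measurable lebesgue"
      unfolding nn_integral_completion by (rule measurable_completion)
    then show ?thesis unfolding U_weight using um by (subst nn_integral_cmult) auto
  qed
  also have "(\<integral>\<^sup>+z. ennreal (1 / wt z) * ennreal (U z) \<partial>lebesgue) = mass U"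
    using U_nonneg weight_pos by (intro nn_integral_cong) (simp add: ennreal_mult[symmetric])
  finally show ?thesis .
qed

text \<open>The comparison of weights in the other direction. It is what admits U to
  \<open>far_integrable\<close> and \<open>core_estimate\<close>.\<close>

lemma U_weight_integrable: "integrable lebesgue (\<lambda>z. U z / wt z)"
proof (rule integrableI_nonneg)
  show "(\<lambda>z. U z / wt z) \<in> borel_measurable lebesgue"
    using borel_measurable_divide[OF borel_measurable_lebesgueI[OF U_meas] weight_meas] .
  show "AE z in lebesgue. 0 \<le> U z / wt z"
    using U_nonneg weight_pos by (intro AE_I2 divide_nonneg_pos)
  have "mass U = (\<integral>\<^sup>+z. ennreal (1 / wt z) * ennreal (U z) \<partial>lebesgue)"
    using U_nonneg weight_pos by (intro nn_integral_cong) (simp add: ennreal_mult[symmetric])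
  also have "\<dots> \<le> (\<integral>\<^sup>+x. ennreal (1 + 2 powr N) * ennreal (u x / wt x) \<partial>lebesgue)"
    unfolding U_weight
  proof (rule nn_integral_mono)
    fix x :: 'a
    have "(\<integral>\<^sup>+z. ennreal (\<rho> (x - z)) * ennreal (1 / wt z) \<partial>lebesgue)
       \<le> (\<integral>\<^sup>+z. ennreal ((1 + 2 powr N) * (1 / wt x)) * ennreal (\<rho> (x - z)) \<partial>lebesgue)"
    proof (rule nn_integral_mono)
      fix z :: 'a
      show "ennreal (\<rho> (x - z)) * ennreal (1 / wt z) \<le> ennreal ((1 + 2 powr N) * (1 / wt x)) * ennreal (\<rho> (x - z))"
      proof (cases "x - z \<in> ball 0 e")
        case True
        then have "ennreal (1 / wt z) \<le> ennreal ((1 + 2 powr N) * (1 / wt x))"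
          by (intro ennreal_leI inverse_weight_near) simp
        then show ?thesis by (subst mult.commute) (rule mult_right_mono, simp_all)
      qed (use \<rho>_supp in simp)
    qed
    also have "\<dots> = ennreal ((1 + 2 powr N) * (1 / wt x))"
      using lebesgue_measurable_reflection(1)[OF borel_measurable_lebesgueI[OF \<rho>_meas], of x]
      by (subst nn_integral_cmult) (auto simp: \<rho>_reflected_int)
    finally have "ennreal (u x) * (\<integral>\<^sup>+z. ennreal (\<rho> (x - z)) * ennreal (1 / wt z) \<partial>lebesgue)
       \<le> ennreal (u x) * ennreal ((1 + 2 powr N) * (1 / wt x))"
      by (rule mult_left_mono) simp
    also have "\<dots> = ennreal (1 + 2 powr N) * ennreal (u x / wt x)"
      using u_nonneg[of x] weight_pos[of x] by (simp add: ennreal_mult[symmetric] mult_ac del: ennreal_plus)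
    finally show "ennreal (u x) * (\<integral>\<^sup>+z. ennreal (\<rho> (x - z)) * ennreal (1 / wt z) \<partial>lebesgue)
      \<le> ennreal (1 + 2 powr N) * ennreal (u x / wt x)" .
  qed
  also have "\<dots> = ennreal (1 + 2 powr N) * mass u"
    using borel_measurable_divide[OF um weight_meas] by (intro nn_integral_cmult) auto
  also have "\<dots> < \<infinity>"
  proof -
    have "mass u = ennreal (LINT x|lebesgue. u x / wt x)"
      using u_nonneg weight_pos by (intro nn_integral_eq_integral ui AE_I2 divide_nonneg_pos)
    then show ?thesis by (simp add: ennreal_mult_less_top)
  qed
  finally show "mass U < \<infinity>" .
qed

section \<open>Moving the kernel from the test function to u\<close>

text \<open>The convolution term of \<open>dual_op_split\<close> for the translate of \<rho> centred
  at \<open>z\<close>.\<close>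

definition tail_potential :: "real \<Rightarrow> 'a \<Rightarrow> 'a \<Rightarrow> real" where
  "tail_potential r z x = (LINT y:- ball 0 r|lebesgue. \<rho> (x - y - z) * K y)"

text \<open>All integrands are nonnegative, so Tonelli comes first in \<open>ennreal\<close>;
  integrability on the left is then read off from the right, which is finite by
  \<open>far_integrable\<close>.\<close>

lemma tail_potential_duality:
  assumes r: "0 < r"
  shows "integrable lebesgue (\<lambda>x. u x * tail_potential r z x)"
    and "(LINT x|lebesgue. u x * tail_potential r z x) = (LINT y:- ball 0 r|lebesgue. U (z + y) * K y)"
proof -
  define h where "h y = ennreal (K y * indicator (- ball 0 r) y)" for y
  have Kn: "0 \<le> K y" if "y \<in> - ball 0 r" for y
    using K_nonneg[of y] r that by (cases "y = 0") auto
  have \<rho>Kn: "0 \<le> indicator (- ball 0 r) y *\<^sub>R (\<rho> w * K y)" for y w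
    using Kn[of y] \<rho>_nonneg[of w] by (cases "y \<in> - ball 0 r") simp_all
  have UKn: "0 \<le> indicator (- ball 0 r) y *\<^sub>R (U w * K y)" for y w
    using Kn[of y] U_nonneg[of w] by (cases "y \<in> - ball 0 r") simp_all
  have h_mult: "ennreal c * h y = ennreal (indicator (- ball 0 r) y *\<^sub>R (c * K y))" if "0 \<le> c" for c y
    using Kn[of y] that by (cases "y \<in> - ball 0 r") (simp_all add: h_def ennreal_mult)
  have hm: "h \<in> borel_measurable lebesgue"
    unfolding h_def by (intro measurable_compose[OF _ measurable_ennreal] borel_measurable_times K_meas)
      (intro borel_measurable_indicator, auto)
  have nonneg: "0 \<le> tail_potential r z x" for x
    unfolding tail_potential_def set_lebesgue_integral_def
    by (intro Bochner_Integration.integral_nonneg \<rho>Kn)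
  have shift: "(\<lambda>y. \<rho> (x - y - z)) \<in> borel_measurable lebesgue" for x
    using lebesgue_measurable_reflection(1)[OF borel_measurable_lebesgueI[OF \<rho>_meas], of "x - z"] by (simp add: algebra_simps)
  have int: "set_integrable lebesgue (- ball 0 r) (\<lambda>y. \<rho> (x - y - z) * K y)" for x
    using tail_bound(1)[OF shift M0 r, of x] \<rho>_nonneg \<rho>_le by (simp add: mult.commute)
  have T_nn: "ennreal (tail_potential r z x) = (\<integral>\<^sup>+y. ennreal (\<rho> (x - y - z)) * h y \<partial>lebesgue)" for x
  proof -
    have "(\<integral>\<^sup>+y. ennreal (indicator (- ball 0 r) y *\<^sub>R (\<rho> (x - y - z) * K y)) \<partial>lebesgue) = ennreal (tail_potential r z x)"
      unfolding tail_potential_def set_lebesgue_integral_def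
      using int[of x] unfolding set_integrable_def
      by (intro nn_integral_eq_integral AE_I2 \<rho>Kn)
    then show ?thesis by (simp only: h_mult[OF \<rho>_nonneg])
  qed
  \<comment> \<open>Measurability of the potential in \<open>x\<close> needs a jointly measurable
    integrand, hence a Borel representative of the truncated kernel.\<close>
  obtain h' where h': "h' \<in> borel_measurable borel" and hh: "AE x in lborel. h x = h' x"
    using completion_ex_borel_measurable[OF hm] by auto
  have Tm: "tail_potential r z \<in> borel_measurable lebesgue"
  proof -
    have "(\<lambda>x. \<integral>\<^sup>+y. ennreal (\<rho> (x - y - z)) * h' y \<partial>lborel) \<in> borel_measurable lborel"
    proof (rule lborel.borel_measurable_nn_integral)
      have h2: "(\<lambda>p::'a \<times> 'a. h' (snd p)) \<in> borel_measurable borel"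
        by (rule measurable_compose[OF _ h']) (intro borel_measurable_continuous_onI continuous_intros)
      have B: "(\<lambda>p::'a \<times> 'a. ennreal (\<rho> (fst p - snd p - z)) * h' (snd p)) \<in> borel_measurable borel"
        by (rule borel_measurable_times_ennreal[OF \<rho>_kernel_meas h2])
      have "sets (lborel \<Otimes>\<^sub>M lborel :: ('a \<times> 'a) measure) = sets borel"
        using sets_pair_measure_cong[OF sets_lborel sets_lborel] unfolding borel_prod .
      then have M1: "borel_measurable (lborel \<Otimes>\<^sub>M lborel) = (borel_measurable borel :: ('a \<times> 'a \<Rightarrow> ennreal) set)"
        by (rule measurable_cong_sets) (rule refl)
      show "(\<lambda>(x, y). ennreal (\<rho> (x - y - z)) * h' y) \<in> borel_measurable (lborel \<Otimes>\<^sub>M lborel)"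
        unfolding split_beta M1 by (rule B)
    qed
    then have "(\<lambda>x. enn2real (\<integral>\<^sup>+y. ennreal (\<rho> (x - y - z)) * h' y \<partial>lborel)) \<in> borel_measurable lebesgue"
      by (intro borel_measurable_enn2real measurable_completion)
    moreover have "enn2real (\<integral>\<^sup>+y. ennreal (\<rho> (x - y - z)) * h' y \<partial>lborel) = tail_potential r z x" for x
    proof -
      have "(\<integral>\<^sup>+y. ennreal (\<rho> (x - y - z)) * h' y \<partial>lborel) = ennreal (tail_potential r z x)"
        unfolding T_nn nn_integral_completion
        by (rule nn_integral_cong_AE) (use hh in eventually_elim, simp)
      then show ?thesis using nonneg[of x] by simp
    qed
    ultimately show ?thesis by simp
  qed
  have Ui: "set_integrable lebesgue (- ball 0 r) (\<lambda>y. U (z + y) * K y)"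
    by (rule far_integrable[OF U_weight_integrable borel_measurable_lebesgueI[OF U_meas] r])
  have "(\<integral>\<^sup>+x. ennreal (u x * tail_potential r z x) \<partial>lebesgue) = (\<integral>\<^sup>+y. h y * ennreal (U (z + y)) \<partial>lebesgue)"
    unfolding nn_integral_U[OF hm] T_nn[symmetric]
    using u_nonneg nonneg by (intro nn_integral_cong) (simp add: ennreal_mult)
  also have "\<dots> = (\<integral>\<^sup>+y. ennreal (indicator (- ball 0 r) y *\<^sub>R (U (z + y) * K y)) \<partial>lebesgue)"
    by (simp only: h_mult[OF U_nonneg] mult.commute[of "h _"])
  also have "\<dots> = ennreal (LINT y:- ball 0 r|lebesgue. U (z + y) * K y)"
    unfolding set_lebesgue_integral_def
    using Ui unfolding set_integrable_def
    by (intro nn_integral_eq_integral AE_I2 UKn)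
  finally have nn: "(\<integral>\<^sup>+x. ennreal (u x * tail_potential r z x) \<partial>lebesgue) = ennreal (LINT y:- ball 0 r|lebesgue. U (z + y) * K y)" .
  have R0: "0 \<le> (LINT y:- ball 0 r|lebesgue. U (z + y) * K y)"
    unfolding set_lebesgue_integral_def
    by (intro Bochner_Integration.integral_nonneg UKn)
  show i: "integrable lebesgue (\<lambda>x. u x * tail_potential r z x)"
    using nn u_nonneg nonneg um Tm by (intro integrableI_nonneg) auto
  have "ennreal (LINT x|lebesgue. u x * tail_potential r z x) = ennreal (LINT y:- ball 0 r|lebesgue. U (z + y) * K y)"
    using nn i u_nonneg nonneg by (subst (asm) nn_integral_eq_integral) auto
  moreover have "0 \<le> (LINT x|lebesgue. u x * tail_potential r z x)"
    using u_nonneg nonneg by (intro Bochner_Integration.integral_nonneg) auto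
  ultimately show "(LINT x|lebesgue. u x * tail_potential r z x) = (LINT y:- ball 0 r|lebesgue. U (z + y) * K y)"
    using R0 by simp
qed

text \<open>Tonelli moves the truncated kernel from \<open>\<rho>\<close> to \<open>u\<close>; only the core part of the operator is left as
  an error.\<close>

lemma mollified_operator:
  assumes r: "0 < r" "r < 1"
    and ti: "integrable lebesgue (\<lambda>x. u x * dual_op s K b (\<lambda>x. \<rho> (x - z)) x)"
  shows "(LINT x|lebesgue. u x * dual_op s K b (\<lambda>x. \<rho> (x - z)) x)
     \<le> trunc_op s K b r U (GU z) z
       + M * Lam * (ring_const DIM('a) \<kappa> * r powr \<kappa>) * (LINT x|lebesgue. u x * indicator (cball z (e + 1)) x)"
proof -
  let ?f = "\<lambda>x. \<rho> (x - z)"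
  let ?T = "tail_potential r z"
  define k where "k = (LINT y:- ball 0 r|lebesgue. K y)"
  define v where "v = trunc_drift s K b r"
  define c where "c x = core_op s (\<lambda>y. K (- y)) r ?f (g (x - z)) x" for x
  define Q where "Q = M * Lam * (ring_const DIM('a) \<kappa> * r powr \<kappa>)"
  have Q0: "0 \<le> Q" using M0 lam ring_consts_nonneg by (simp add: Q_def)
  have fm: "?f \<in> borel_measurable borel"
    by (rule measurable_compose[OF _ \<rho>_meas]) simp
  have fB: "\<bar>?f x\<bar> \<le> M" for x using \<rho>_nonneg[of "x - z"] \<rho>_le[of "x - z"] by simp
  have fd: "(?f has_derivative (\<lambda>h. g (x - z) \<bullet> h)) (at x)" for x
  proof -
    have "((\<lambda>x. x - z) has_derivative (\<lambda>h. h)) (at x)" by (auto intro!: derivative_eq_intros)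
    from has_derivative_compose[OF this \<rho>_deriv[of "x - z"]] show ?thesis .
  qed
  have ft: "\<bar>?f (x + y) - ?f x - g (x - z) \<bullet> y\<bar> \<le> M * (norm y)\<^sup>2" for x y
    using \<rho>_taylor[of "x - z" y] by (simp add: algebra_simps)
  have fl: "\<bar>?f (x + y) - ?f x\<bar> \<le> M * norm y" for x y
    using \<rho>_lip[of "x - z" y] by (simp add: algebra_simps)
  note sp = dual_op_split[OF fm fB r(1) M0 fd ft fl]
  have D: "dual_op s K b ?f x = k * ?f x - ?T x - v \<bullet> g (x - z) + c x" for x
    using sp(2)[of b x] by (simp add: k_def v_def c_def tail_potential_def algebra_simps)
  have cQ: "\<bar>c x\<bar> \<le> Q" for x unfolding c_def Q_def by (rule sp(3))
  have c0: "c x = 0" if "x \<notin> cball z (e + 1)" for x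
    unfolding c_def
  proof (rule core_op_eq_0)
    have n: "e + 1 < norm (x - z)" using that by (simp add: dist_norm norm_minus_commute)
    then show "\<rho> (x - z) = 0" "g (x - z) = 0" by (auto intro!: \<rho>_supp g_supp)
    fix y :: 'a assume "y \<in> ball 0 r"
    then have "e < norm (x + y - z)" using norm_triangle_ineq2[of "x - z" "- y"] n r by (simp add: algebra_simps)
    then show "\<rho> (x + y - z) = 0" by (intro \<rho>_supp) simp
  qed
  have i1: "integrable lebesgue (\<lambda>x. k * (u x * ?f x))" by (intro integrable_mult_right u\<rho>_integrable)
  note i2 = tail_potential_duality(1)[OF r(1), of z]
  have i3: "integrable lebesgue (\<lambda>x. v \<bullet> (u x *\<^sub>R g (x - z)))" by (intro integrable_inner_right ug_integrable)
  \<comment> \<open>Solving for the core term gives the integrability of \<open>u x * c x\<close>,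
    and with it measurability, from that of all the other terms.\<close>
  have uc: "u x * c x = u x * dual_op s K b ?f x - k * (u x * ?f x) + u x * ?T x + v \<bullet> (u x *\<^sub>R g (x - z))" for x
    by (simp add: D algebra_simps)
  have i4: "integrable lebesgue (\<lambda>x. u x * c x)"
    unfolding uc by (intro Bochner_Integration.integrable_add Bochner_Integration.integrable_diff i1 i2 i3 ti)
  have Pi: "integrable lebesgue (\<lambda>x. u x * indicator (cball z (e + 1)) x)"
  proof -
    have "(indicator (cball z (e + 1)) :: 'a \<Rightarrow> real) \<in> borel_measurable lebesgue"
      by (intro borel_measurable_indicator) auto
    then show ?thesis using local_integrable[of "indicator (cball z (e + 1)) :: 'a \<Rightarrow> real" 1 z "e + 1"] by simp
  qed
  have err: "(LINT x|lebesgue. u x * c x) \<le> Q * (LINT x|lebesgue. u x * indicator (cball z (e + 1)) x)"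
  proof -
    have "(LINT x|lebesgue. u x * c x) \<le> (LINT x|lebesgue. Q * (u x * indicator (cball z (e + 1)) x))"
    proof (rule integral_mono[OF i4])
      show "integrable lebesgue (\<lambda>x. Q * (u x * indicator (cball z (e + 1)) x))" using Pi by (rule integrable_mult_right)
      fix x
      have "c x \<le> Q * indicator (cball z (e + 1)) x" using cQ[of x] c0[of x] by (auto simp: indicator_def)
      then have "u x * c x \<le> u x * (Q * indicator (cball z (e + 1)) x)" using u_nonneg[of x] by (rule mult_left_mono)
      then show "u x * c x \<le> Q * (u x * indicator (cball z (e + 1)) x)" by (simp only: mult_ac)
    qed
    then show ?thesis by simp
  qed
  have "(LINT x|lebesgue. u x * dual_op s K b ?f x) =
      (LINT x|lebesgue. k * (u x * ?f x) - u x * ?T x - v \<bullet> (u x *\<^sub>R g (x - z)) + u x * c x)"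
    by (intro Bochner_Integration.integral_cong) (auto simp: D algebra_simps)
  also have "\<dots> = k * U z - (LINT x|lebesgue. u x * ?T x) - v \<bullet> (LINT x|lebesgue. u x *\<^sub>R g (x - z)) + (LINT x|lebesgue. u x * c x)"
    using i1 i2 i3 i4 integral_inner_right[OF ug_integrable, of v z] by (simp add: U_def)
  also have "(LINT x|lebesgue. u x * ?T x) = (LINT y:- ball 0 r|lebesgue. U (z + y) * K y)"
    by (rule tail_potential_duality(2)[OF r(1)])
  also have "k * U z - (LINT y:- ball 0 r|lebesgue. U (z + y) * K y) = (LINT y:- ball 0 r|lebesgue. (U z - U (z + y)) * K y)"
  proof -
    have Ui: "set_integrable lebesgue (- ball 0 r) (\<lambda>y. U (z + y) * K y)"
      by (rule far_integrable[OF U_weight_integrable borel_measurable_lebesgueI[OF U_meas] r(1)])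
    show ?thesis unfolding left_diff_distrib k_def
      using kernel_far_integrable[OF r(1)] Ui by (subst set_integral_diff(2)) (auto simp: mult.commute)
  qed
  finally have "(LINT x|lebesgue. u x * dual_op s K b ?f x) = trunc_op s K b r U (GU z) z + (LINT x|lebesgue. u x * c x)"
    by (simp add: trunc_op_def v_def GU_def)
  then show ?thesis using err unfolding Q_def by simp
qed

text \<open>The contact argument is run for U. Being differentiable, U has the gradient of the
  paraboloid at the contact point, so the operator on U meets the form required by
  \<open>core_estimate\<close>; \<open>u_weight_le\<close> carries the result back to u.\<close>

lemma mollified_bound:
  assumes weak: "weak_supersolution s K b C0 (ball 0 1) u" and C0: "0 < C0"
    and b: "s = 1 / 2 \<Longrightarrow> norm b \<le> Lam" and x1: "norm x1 < 1 / 2" "U x1 < m"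
  shows "mass u
    \<le> ennreal ((1 + 2 powr N) * (harnack_const DIM('a) s lam Lam * (16 / 5 * m + C0)))"
proof -
  have lsc: "lower_semicontinuous_on (ball 0 1) U"
    unfolding lower_semicontinuous_on_def
  proof (intro ballI allI impI)
    fix x c assume "c < U x"
    moreover have "(U \<longlongrightarrow> U x) (at x within ball 0 1)"
      using U_isCont[of x] by (metis isCont_def subset_UNIV tendsto_within_subset)
    ultimately show "eventually (\<lambda>z. c < U z) (at x within ball 0 1)" by (metis order_tendstoD(1))
  qed
  define t where "t = 16 / 5 * m"
  have t: "0 < t" using U_nonneg[of x1] x1 by (simp add: t_def)
  obtain x0 d where x0: "norm x0 < 3 / 4" and d: "0 \<le> d" and eq: "U x0 = t * (9 / 16 - (norm x0)\<^sup>2) - d"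
    and low: "\<And>x. t * (9 / 16 - (norm x)\<^sup>2) - d \<le> U x"
    using contact_point[OF lsc U_nonneg x1] unfolding t_def by blast
  have grad: "GU x0 = - (2 * t) *\<^sub>R x0"
  proof -
    let ?w = "\<lambda>x. U x - (t * (9 / 16 - (norm x)\<^sup>2) - d)"
    have "(?w has_derivative (\<lambda>h. GU x0 \<bullet> h - (- (2 * t) *\<^sub>R x0) \<bullet> h)) (at x0)"
      by (rule has_derivative_diff[OF U_has_derivative paraboloid_has_derivative])
    moreover have "\<forall>y\<in>UNIV. ?w x0 \<le> ?w y" using low eq by simp
    ultimately have "(\<lambda>h. GU x0 \<bullet> h - (- (2 * t) *\<^sub>R x0) \<bullet> h) = (\<lambda>h. 0)"
      using differential_zero_maxmin[of x0 UNIV ?w] by blast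
    then have "(GU x0 - (- (2 * t) *\<^sub>R x0)) \<bullet> h = 0" for h by (simp add: inner_diff_left inner_add_left fun_eq_iff)
    then have "GU x0 - (- (2 * t) *\<^sub>R x0) = 0" by (metis inner_eq_zero_iff)
    then show ?thesis by (simp add: eq_neg_iff_add_eq_0)
  qed
  let ?f = "\<lambda>x. \<rho> (x - x0)"
  have "smooth_compact_support (ball 0 1) ?f" using x0 by (rule \<rho>_test)
  then have ti: "integrable lebesgue (\<lambda>x. u x * dual_op s K b ?f x)"
    and sup: "- C0 * (LINT x:ball 0 1|lebesgue. ?f x) \<le> (LINT x|lebesgue. u x * dual_op s K b ?f x)"
    using weak \<rho>_nonneg unfolding weak_supersolution_def by blast+
  have one: "(LINT x:ball 0 1|lebesgue. ?f x) = 1"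
  proof -
    have fm: "?f \<in> borel_measurable lebesgue" by (rule shift_meas[OF \<rho>_meas])
    have nn: "(\<integral>\<^sup>+x. ennreal (?f x) \<partial>lebesgue) = 1"
      using nn_integral_lebesgue_translation[of "\<lambda>x. ennreal (\<rho> x)" "- x0"] borel_measurable_lebesgueI[OF \<rho>_meas] \<rho>_int by simp
    have "indicator (ball 0 1) x *\<^sub>R ?f x = ?f x" for x
    proof (cases "x \<in> ball 0 1")
      case False
      then have "e < norm (x - x0)" using norm_triangle_sub[of x x0] x0 e by auto
      then show ?thesis using \<rho>_supp[of "x - x0"] by simp
    qed simp
    then have "(LINT x:ball 0 1|lebesgue. ?f x) = (LINT x|lebesgue. ?f x)" by (simp only: set_lebesgue_integral_def)
    also have "\<dots> = enn2real (\<integral>\<^sup>+x. ennreal (?f x) \<partial>lebesgue)"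
      using fm \<rho>_nonneg by (intro integral_eq_nn_integral) auto
    finally show ?thesis using nn by simp
  qed
  define P where "P = (LINT x|lebesgue. u x * indicator (cball x0 (e + 1)) x)"
  have P0: "0 \<le> P" unfolding P_def using u_nonneg by (intro Bochner_Integration.integral_nonneg) auto
  define \<sigma> where "\<sigma> j = 1 / (4 + real j)" for j
  have \<sigma>: "0 < \<sigma> j" "\<sigma> j < 1" for j by (auto simp: \<sigma>_def field_simps)
  \<comment> \<open>\<open>M\<close> and \<open>P\<close> belong to the fixed mollifier and contact
    point; only the truncation radius tends to 0, and that alone removes the error.\<close>
  define E where "E j = M * Lam * (ring_const DIM('a) \<kappa> * \<sigma> j powr \<kappa>) * P" for j
  have E0: "0 \<le> E j" for j using M0 lam ring_consts_nonneg P0 by (simp add: E_def)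
  have super: "- (C0 + E j) \<le> trunc_op s K b (\<sigma> j) U (- (2 * t) *\<^sub>R x0) x0" for j
    using mollified_operator[OF \<sigma> ti, of j] sup unfolding one grad E_def P_def by linarith
  have bnd: "(LINT y:- ball 0 (\<sigma> j)|lebesgue. U (x0 + y) / wt (x0 + y))
     \<le> harnack_const DIM('a) s lam Lam * (t + (C0 + E j))" for j
    using t C0 E0[of j] U_nonneg low eq
    by (intro core_estimate[OF borel_measurable_lebesgueI[OF U_meas] U_weight_integrable x0 _ d \<sigma> _ _ _ _ b super]) auto
  have \<sigma>0: "\<sigma> \<longlonglongrightarrow> 0"
    unfolding \<sigma>_def by (rule real_tendsto_divide_at_top[OF tendsto_const])
      (rule filterlim_tendsto_add_at_top[OF tendsto_const filterlim_real_sequentially])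
  have "E \<longlonglongrightarrow> M * Lam * (ring_const DIM('a) \<kappa> * 0) * P"
    unfolding E_def using \<kappa>_pos \<sigma>0 \<sigma>(1)
    by (intro tendsto_mult tendsto_const tendsto_zero_powrI[OF \<sigma>0 tendsto_const]) (auto intro!: always_eventually less_imp_le)
  then have lim: "(\<lambda>j. harnack_const DIM('a) s lam Lam * (t + (C0 + E j))) \<longlonglongrightarrow> harnack_const DIM('a) s lam Lam * (t + (C0 + 0))"
    by (intro tendsto_intros) simp
  have "mass U \<le> ennreal (harnack_const DIM('a) s lam Lam * (t + (C0 + 0)))"
    by (rule mass_le_of_tail_bounds[OF borel_measurable_lebesgueI[OF U_meas] U_nonneg borel_measurable_lebesgueI[OF U_meas]
        U_weight_integrable \<sigma>0 \<sigma>(1) U_nonneg tendsto_const bnd lim])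
  then have "ennreal (1 + 2 powr N) * mass U
     \<le> ennreal (1 + 2 powr N) * ennreal (harnack_const DIM('a) s lam Lam * (t + C0))"
    by (intro mult_left_mono) simp_all
  also have "\<dots> = ennreal ((1 + 2 powr N) * (harnack_const DIM('a) s lam Lam * (t + C0)))"
    using t C0 harnack_const_pos by (intro ennreal_mult[symmetric]) auto
  finally show ?thesis using u_weight_le order_trans unfolding t_def by blast
qed

end

section \<open>Choosing the mollification radius\<close>

text \<open>If U were at least \<open>m\<close> on \<open>T\<close>, integrating over
  \<open>T\<close> and exchanging the integrals would give at least \<open>m\<close> times the
  measure of \<open>T\<close>; but this integral is at most that of u over the
  \<open>e\<close>-neighbourhood of \<open>T\<close>.\<close>

lemma (in mollified) U_below:
  assumes T: "T \<in> sets lebesgue" and m: "0 \<le> m"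
    and less: "(\<integral>\<^sup>+x. ennreal (u x) * indicator (\<Union>y\<in>T. ball y e) x \<partial>lebesgue) < ennreal m * emeasure lebesgue T"
  shows "\<exists>x\<in>T. U x < m"
proof (rule ccontr)
  assume "\<not> ?thesis"
  then have ge: "m \<le> U x" if "x \<in> T" for x using that by force
  have im: "(indicator T :: 'a \<Rightarrow> ennreal) \<in> borel_measurable lebesgue" using T by simp
  have "ennreal m * emeasure lebesgue T = (\<integral>\<^sup>+y. ennreal m * indicator T y \<partial>lebesgue)"
    using T by (simp add: nn_integral_cmult_indicator)
  also have "\<dots> \<le> (\<integral>\<^sup>+y. indicator T y * ennreal (U (0 + y)) \<partial>lebesgue)"
    using ge by (intro nn_integral_mono) (auto simp: indicator_def intro!: ennreal_leI)
  also have "\<dots> = (\<integral>\<^sup>+x. ennreal (u x) * (\<integral>\<^sup>+y. ennreal (\<rho> (x - y - 0)) * indicator T y \<partial>lebesgue) \<partial>lebesgue)"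
    by (rule nn_integral_U[OF im])
  also have "\<dots> \<le> (\<integral>\<^sup>+x. ennreal (u x) * indicator (\<Union>y\<in>T. ball y e) x \<partial>lebesgue)"
  proof (intro nn_integral_mono mult_left_mono)
    fix x :: 'a
    show "(\<integral>\<^sup>+y. ennreal (\<rho> (x - y - 0)) * indicator T y \<partial>lebesgue) \<le> indicator (\<Union>y\<in>T. ball y e) x"
    proof (cases "x \<in> (\<Union>y\<in>T. ball y e)")
      case True
      have "(\<integral>\<^sup>+y. ennreal (\<rho> (x - y - 0)) * indicator T y \<partial>lebesgue) \<le> (\<integral>\<^sup>+y. ennreal (\<rho> (x - y)) \<partial>lebesgue)"
        by (intro nn_integral_mono) (auto simp: indicator_def)
      then show ?thesis using True by (simp add: \<rho>_reflected_int)
    next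
      case False
      have "(\<integral>\<^sup>+y. ennreal (\<rho> (x - y - 0)) * indicator T y \<partial>lebesgue) = (\<integral>\<^sup>+y. (0::ennreal) \<partial>(lebesgue :: 'a measure))"
      proof (rule nn_integral_cong)
        fix y :: 'a
        show "ennreal (\<rho> (x - y - 0)) * indicator T y = 0"
        proof (cases "y \<in> T")
          case True
          then have "x \<notin> ball y e" using False by blast
          then have "\<rho> (x - y) = 0" by (intro \<rho>_supp) (simp add: dist_norm norm_minus_commute)
          then show ?thesis by simp
        qed simp
      qed
      then show ?thesis by simp
    qed
  qed simp
  finally show False using less by simp
qed

context fractional_kernel begin

text \<open>The sublevel set of u in the half ball has positive measure, hence so has some closed
  subset \<open>T\<close>, on which the integral of u is strictly below \<open>m\<close> times the
  measure. Neighbourhoods of a closed set decrease to it, so continuity from above preserves the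
  strict inequality for a small radius.\<close>

lemma sublevel_neighbourhood:
  fixes u :: "'a \<Rightarrow> real"
  assumes um: "u \<in> borel_measurable lebesgue" and pos: "\<And>x. 0 \<le> u x"
    and ui: "integrable lebesgue (\<lambda>x. u x / wt x)"
    and m: "\<not> (AE x in lebesgue. x \<in> ball 0 (1 / 2) \<longrightarrow> m \<le> u x)"
  shows "\<exists>T e. T \<in> sets lebesgue \<and> T \<subseteq> ball 0 (1 / 2) \<and> 0 < e \<and> e < 1 / 4 \<and>
    (\<integral>\<^sup>+x. ennreal (u x) * indicator (\<Union>y\<in>T. ball y e) x \<partial>lebesgue) < ennreal m * emeasure lebesgue T"
proof -
  define A where "A = {x \<in> ball 0 (1 / 2). u x < m}"
  have Am: "A \<in> sets lebesgue"
  proof -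
    have "A = ball 0 (1 / 2) \<inter> (u -` {..<m} \<inter> space lebesgue)" by (auto simp: A_def)
    moreover have "u -` {..<m} \<inter> space lebesgue \<in> sets lebesgue" using um by (rule measurable_sets) simp
    ultimately show ?thesis by auto
  qed
  have "A \<notin> null_sets lebesgue"
  proof
    assume "A \<in> null_sets lebesgue"
    then have "AE x in lebesgue. x \<notin> A" by (rule AE_not_in)
    then have "AE x in lebesgue. x \<in> ball 0 (1 / 2) \<longrightarrow> m \<le> u x" by eventually_elim (auto simp: A_def)
    then show False using m by blast
  qed
  then have Apos: "emeasure lebesgue A \<noteq> 0" using Am by auto
  have bA: "bounded A" by (rule bounded_subset[of "ball 0 (1 / 2)"]) (auto simp: A_def)
  have fin: "emeasure lebesgue B < \<infinity>" if "B \<subseteq> A" "B \<in> sets lebesgue" for B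
  proof -
    have "B \<in> lmeasurable" using that bA bounded_subset by (intro bounded_set_imp_lmeasurable) auto
    then show ?thesis by (simp only: fmeasurable_def mem_Collect_eq infinity_ennreal_def)
  qed
  obtain a where a: "emeasure lebesgue A = ennreal a" "0 \<le> a" using fin[of A] Am by (cases "emeasure lebesgue A") auto
  have a0: "a > 0" using a Apos by (cases "a = 0") auto
  obtain T where T: "closed T" "T \<subseteq> A" "emeasure lebesgue (A - T) < ennreal a"
    using sets_lebesgue_inner_closed[OF Am a0] by metis
  have Tm: "T \<in> sets lebesgue" using T by auto
  have Tpos: "emeasure lebesgue T \<noteq> 0"
  proof
    assume "emeasure lebesgue T = 0"
    then have "emeasure lebesgue (T \<union> (A - T)) \<le> emeasure lebesgue (A - T)"
      using emeasure_subadditive[of T lebesgue "A - T"] Tm Am by auto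
    moreover have "T \<union> (A - T) = A" using T by auto
    ultimately show False using T(3) a by simp
  qed
  obtain x0 where "x0 \<in> T" using Tpos by (metis emeasure_empty ex_in_conv)
  then have mpos: "0 < m" using T(2) pos[of x0] by (auto simp: A_def)
  define \<mu> where "\<mu> = density lebesgue (\<lambda>x. ennreal (u x))"
  have em: "emeasure \<mu> B = (\<integral>\<^sup>+x. ennreal (u x) * indicator B x \<partial>lebesgue)" if "B \<in> sets lebesgue" for B
    unfolding \<mu>_def using that um by (intro emeasure_density) auto
  have less: "emeasure \<mu> T < ennreal m * emeasure lebesgue T"
  proof -
    have dm: "(\<lambda>x. ennreal (m - u x) * indicator T x) \<in> borel_measurable lebesgue"
      using um Tm by (intro borel_measurable_times_ennreal borel_measurable_indicator) auto
    have um': "(\<lambda>x. ennreal (u x) * indicator T x) \<in> borel_measurable lebesgue"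
      using um Tm by (intro borel_measurable_times_ennreal borel_measurable_indicator) auto
    have "ennreal m * emeasure lebesgue T = (\<integral>\<^sup>+x. ennreal m * indicator T x \<partial>lebesgue)"
      using Tm by (simp add: nn_integral_cmult_indicator)
    also have "\<dots> = (\<integral>\<^sup>+x. ennreal (u x) * indicator T x + ennreal (m - u x) * indicator T x \<partial>lebesgue)"
    proof (rule nn_integral_cong)
      fix x
      show "ennreal m * indicator T x = ennreal (u x) * indicator T x + ennreal (m - u x) * indicator T x"
      proof (cases "x \<in> T")
        case True
        then have "u x < m" using T(2) by (auto simp: A_def)
        then show ?thesis using pos[of x] True by (simp add: ennreal_plus[symmetric] del: ennreal_plus)
      qed simp
    qed
    also have "\<dots> = emeasure \<mu> T + (\<integral>\<^sup>+x. ennreal (m - u x) * indicator T x \<partial>lebesgue)"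
      unfolding em[OF Tm] using um' dm by (rule nn_integral_add)
    finally have sum: "ennreal m * emeasure lebesgue T = emeasure \<mu> T + (\<integral>\<^sup>+x. ennreal (m - u x) * indicator T x \<partial>lebesgue)" .
    have "(\<integral>\<^sup>+x. ennreal (m - u x) * indicator T x \<partial>lebesgue) \<noteq> 0"
    proof
      assume "(\<integral>\<^sup>+x. ennreal (m - u x) * indicator T x \<partial>lebesgue) = 0"
      then have "AE x in lebesgue. ennreal (m - u x) * indicator T x = 0"
        using nn_integral_0_iff_AE[OF dm] by simp
      then have "AE x in lebesgue. x \<notin> T"
      proof eventually_elim
        case (elim x)
        show ?case
        proof
          assume "x \<in> T"
          then have "u x < m" using T(2) by (auto simp: A_def)
          then show False using elim \<open>x \<in> T\<close> by simp
        qed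
      qed
      then have "T \<in> null_sets lebesgue" using AE_iff_null_sets[OF Tm] by simp
      then show False using Tpos by auto
    qed
    moreover have "emeasure \<mu> T < \<infinity>"
    proof -
      have "emeasure \<mu> T \<le> ennreal m * emeasure lebesgue T" unfolding sum by simp
      also have "\<dots> < \<infinity>" using fin[OF T(2) Tm] by (simp add: ennreal_mult_less_top)
      finally show ?thesis .
    qed
    ultimately show ?thesis unfolding sum
      by (metis add.right_neutral ennreal_add_left_cancel_less infinity_ennreal_def less_top zero_less_iff_neq_zero)
  qed
  \<comment> \<open>All radii are at most 1/5, below the bound 1/4 in \<open>mollified\<close>. The
    neighbourhoods stay in the unit ball, where the weight is at most 2, so u has finite integral
    over them.\<close>
  let ?T = "\<lambda>j. \<Union>y\<in>T. ball y (1 / (5 + real j))"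
  have TB: "?T j \<subseteq> ball 0 1" for j
  proof clarify
    fix x y assume "y \<in> T" "x \<in> ball y (1 / (5 + real j))"
    moreover have "1 / (5 + real j) \<le> 1 / 2" by (simp add: field_simps)
    ultimately have "norm y < 1 / 2" "norm (x - y) < 1 / 2"
      using T(2) unfolding A_def mem_ball dist_norm norm_minus_commute[of x y] by (force, linarith)
    then show "x \<in> ball 0 1" using norm_triangle_sub[of x y] by simp
  qed
  have To: "?T j \<in> sets lebesgue" for j
  proof -
    have "open (?T j)" by auto
    then show ?thesis by simp
  qed
  have "(\<lambda>j. emeasure \<mu> (?T j)) \<longlonglongrightarrow> emeasure \<mu> (\<Inter>j. ?T j)"
  proof (rule Lim_emeasure_decseq)
    show "range ?T \<subseteq> sets \<mu>" using To by (auto simp: \<mu>_def)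
    show "decseq ?T" unfolding decseq_def by (intro allI impI UN_mono order_refl subset_ball divide_left_mono) auto
    fix j
    have "emeasure \<mu> (?T j) \<le> (\<integral>\<^sup>+x. ennreal 2 * ennreal (u x / wt x) \<partial>lebesgue)"
      unfolding em[OF To]
    proof (rule nn_integral_mono)
      fix x
      show "ennreal (u x) * indicator (?T j) x \<le> ennreal 2 * ennreal (u x / wt x)"
      proof (cases "x \<in> ?T j")
        case True
        then have "norm x < 1" using TB[of j] by force
        then have "norm x powr N \<le> 1 powr N" using N_pos by (intro powr_mono2) auto
        then have "u x * wt x \<le> u x * 2" using pos[of x] by (intro mult_left_mono) auto
        then have "u x \<le> 2 * (u x / wt x)" using weight_pos[of x] by (simp add: le_divide_eq mult.commute)
        then have "ennreal (u x) \<le> ennreal (2 * (u x / wt x))" by (rule ennreal_leI)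
        also have "\<dots> = ennreal 2 * ennreal (u x / wt x)"
          using pos[of x] weight_pos[of x] by (intro ennreal_mult) auto
        finally show ?thesis using True by simp
      qed simp
    qed
    also have "\<dots> = ennreal 2 * mass u"
      using borel_measurable_divide[OF um weight_meas] by (intro nn_integral_cmult) auto
    also have "mass u = ennreal (LINT x|lebesgue. u x / wt x)"
      using pos weight_pos by (intro nn_integral_eq_integral ui AE_I2 divide_nonneg_pos)
    also have "ennreal 2 * \<dots> < \<infinity>" by (simp add: ennreal_mult_less_top)
    finally show "emeasure \<mu> (?T j) \<noteq> \<infinity>" by simp
  qed
  also have "(\<Inter>j. ?T j) = T"
  proof
    show "(\<Inter>j. ?T j) \<subseteq> T"
    proof
      fix x assume x: "x \<in> (\<Inter>j. ?T j)"
      have "\<exists>y\<in>T. dist y x < d" if d: "d > 0" for d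
      proof -
        obtain j :: nat where j: "1 / real (Suc j) < d" using d nat_approx_posE by metis
        obtain y where y: "y \<in> T" "dist y x < 1 / (5 + real j)" using x by force
        have "1 / (5 + real j) \<le> 1 / real (Suc j)" by (intro divide_left_mono) auto
        then show ?thesis using y j by (intro bexI[of _ y]) auto
      qed
      then show "x \<in> T" using T(1) closed_approachable by blast
    qed
    show "T \<subseteq> (\<Inter>j. ?T j)" by (force simp: add_pos_nonneg)
  qed
  finally have "eventually (\<lambda>j. emeasure \<mu> (?T j) < ennreal m * emeasure lebesgue T) sequentially"
    using less by (rule order_tendstoD(2))
  then obtain j where "emeasure \<mu> (?T j) < ennreal m * emeasure lebesgue T"
    by (meson eventually_sequentially order_refl)
  then show ?thesis using Tm T(2) unfolding em[OF To]
    by (intro exI[of _ T] exI[of _ "1 / (5 + real j)"]) (auto simp: A_def field_simps)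
qed

lemma weak_bound:
  fixes u :: "'a \<Rightarrow> real"
  assumes pos: "\<And>x. 0 \<le> u x" and weak: "weak_supersolution s K b C0 (ball 0 1) u"
    and C0: "0 < C0" and b: "s = 1 / 2 \<Longrightarrow> norm b \<le> Lam"
    and m: "\<not> (AE x in lebesgue. x \<in> ball 0 (1 / 2) \<longrightarrow> m \<le> u x)" "0 \<le> m"
  shows "mass u
    \<le> ennreal ((1 + 2 powr N) * (harnack_const DIM('a) s lam Lam * (16 / 5 * m + C0)))"
proof -
  have um: "u \<in> borel_measurable lebesgue" using weak by (simp add: weak_supersolution_def)
  have ui: "integrable lebesgue (\<lambda>x. u x / wt x)" using pos weak by (rule weak_integrable)
  obtain T e where T: "T \<in> sets lebesgue" "T \<subseteq> ball 0 (1 / 2)" and e: "0 < e" "e < 1 / 4"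
    and less: "(\<integral>\<^sup>+x. ennreal (u x) * indicator (\<Union>y\<in>T. ball y e) x \<partial>lebesgue) < ennreal m * emeasure lebesgue T"
    using sublevel_neighbourhood[OF um pos ui m(1)] by blast
  define I where "I = (LINT x|lebesgue. bump e (0::'a) x)"
  have I: "0 < I" unfolding I_def using e(1) by (rule integral_bump_pos)
  define \<rho> where "\<rho> x = (1 / I) * bump e 0 x" for x :: 'a
  have \<rho>_shift: "\<rho> (x - z) = (1 / I) * bump e z x" for x z by (simp add: \<rho>_def bump_def)
  have supp: "\<rho> x = 0" if "x \<notin> ball 0 e" for x using bump_eq_0[OF e(1) that] by (simp add: \<rho>_def)
  \<comment> \<open>Contact points lie in the ball of radius 3/4 and e < 1/4, so the translate is
    supported in the unit ball.\<close>
  have test: "smooth_compact_support (ball 0 1) (\<lambda>x. \<rho> (x - z))" if z: "norm z < 3 / 4" for z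
  proof -
    have "cball z e \<subseteq> ball 0 1"
    proof
      fix x assume "x \<in> cball z e"
      then have "norm (x - z) \<le> e" by (simp add: dist_norm norm_minus_commute)
      then show "x \<in> ball 0 1" using norm_triangle_sub[of x z] z e by simp
    qed
    then show ?thesis unfolding \<rho>_shift using e(1) by (rule smooth_compact_support_bump[rotated])
  qed
  have "Ck_on 2 UNIV \<rho>" using test[of 0] by (simp add: smooth_compact_support_def)
  moreover have "\<rho> x = 0" if "x \<notin> cball 0 e" for x
    using that ball_subset_cball[of 0 e] by (intro supp) auto
  ultimately have "\<exists>g M. (\<forall>x. (\<rho> has_derivative (\<lambda>h. g x \<bullet> h)) (at x)) \<and> continuous_on UNIV g \<and> 0 \<le> M \<and>
    (\<forall>x y. \<bar>\<rho> (x + y) - \<rho> x - g x \<bullet> y\<bar> \<le> M * (norm y)\<^sup>2) \<and> (\<forall>x y. \<bar>\<rho> (x + y) - \<rho> x\<bar> \<le> M * norm y) \<and>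
    (\<forall>x. norm (g x) \<le> M) \<and> (\<forall>x. x \<notin> cball 0 e \<longrightarrow> g x = 0)"
    by (rule C2_compact_support_taylor[OF _ compact_cball])
  then obtain g M where g: "\<And>x. (\<rho> has_derivative (\<lambda>h. g x \<bullet> h)) (at x)" "continuous_on UNIV g" "0 \<le> M"
    "\<And>x y. \<bar>\<rho> (x + y) - \<rho> x - g x \<bullet> y\<bar> \<le> M * (norm y)\<^sup>2" "\<And>x y. \<bar>\<rho> (x + y) - \<rho> x\<bar> \<le> M * norm y"
    "\<And>x. norm (g x) \<le> M" "\<And>x. x \<notin> cball 0 e \<Longrightarrow> g x = 0"
    by blast
  \<comment> \<open>A single constant for all bounds: \<open>M\<close> controls the derivatives of
    \<rho>, and 1 / I its values.\<close>
  interpret mollified s lam Lam N K u e "max M (1 / I)" \<rho> g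
  proof
    show "0 \<le> \<rho> x" for x using I bump_nonneg[of e 0 x] by (simp add: \<rho>_def)
    show "\<rho> x \<le> max M (1 / I)" for x
    proof -
      have "(1 / I) * bump e 0 x \<le> (1 / I) * 1" using I bump_le_1 by (intro mult_left_mono) auto
      then show ?thesis by (simp add: \<rho>_def)
    qed
    show "\<rho> \<in> borel_measurable borel" unfolding \<rho>_def using bump_measurable by (intro borel_measurable_times) auto
    have "(\<integral>\<^sup>+x. ennreal (\<rho> x) \<partial>lebesgue) = ennreal (LINT x|lebesgue. \<rho> x)"
      unfolding \<rho>_def
      by (intro nn_integral_eq_integral integrable_mult_right integrable_bump e AE_I2 mult_nonneg_nonneg bump_nonneg)
        (use I in auto)
    also have "(LINT x|lebesgue. \<rho> x) = 1" unfolding \<rho>_def using I by (simp add: I_def)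
    finally show "(\<integral>\<^sup>+x. ennreal (\<rho> x) \<partial>lebesgue) = 1" by simp
    show "g \<in> borel_measurable borel" using g(2) by (rule borel_measurable_continuous_onI)
    show "norm (g x) \<le> max M (1 / I)" for x using g(6)[of x] by simp
    show "\<bar>\<rho> (x + y) - \<rho> x - g x \<bullet> y\<bar> \<le> max M (1 / I) * (norm y)\<^sup>2" for x y
      using g(4)[of x y] by (meson max.cobounded1 mult_right_mono order_trans zero_le_power2)
    show "\<bar>\<rho> (x + y) - \<rho> x\<bar> \<le> max M (1 / I) * norm y" for x y
      using g(5)[of x y] by (meson max.cobounded1 mult_right_mono order_trans norm_ge_zero)
    show "0 \<le> max M (1 / I)" using g(3) by simp
  qed (use um pos ui e supp g test in auto)
  obtain x1 where "x1 \<in> T" "U x1 < m" using U_below[OF T(1) m(2) less] by blast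
  then show ?thesis using T(2) by (intro mollified_bound[OF weak C0 b]) auto
qed

text \<open>\<open>ess_inf_on\<close> is a supremum of reals, so the set of essential lower bounds
  must be shown bounded above. Otherwise u would exceed every natural number almost everywhere on
  the half ball, which is not null.\<close>

lemma ess_inf_on_half_ball:
  fixes u :: "'a \<Rightarrow> real"
  assumes pos: "\<And>x. 0 \<le> u x"
  shows "0 \<le> ess_inf_on (ball 0 (1 / 2)) u"
    and "ess_inf_on (ball 0 (1 / 2)) u < m \<Longrightarrow> \<not> (AE x in lebesgue. x \<in> ball 0 (1 / 2) \<longrightarrow> m \<le> u x)"
proof -
  let ?S = "{c. AE x in lebesgue. x \<in> ball 0 (1 / 2) \<longrightarrow> c \<le> u x}"
  have bdd: "bdd_above ?S"
  proof (rule ccontr)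
    assume "\<not> bdd_above ?S"
    then have "\<exists>c\<in>?S. real n < c" for n by (meson bdd_above.I not_le)
    then have "AE x in lebesgue. x \<in> ball 0 (1 / 2) \<longrightarrow> real n \<le> u x" for n
    proof -
      obtain c where c: "AE x in lebesgue. x \<in> ball 0 (1 / 2) \<longrightarrow> c \<le> u x" "real n < c"
        using \<open>\<And>n. \<exists>c\<in>?S. real n < c\<close>[of n] by auto
      from c(1) show ?thesis by eventually_elim (use c(2) in auto)
    qed
    then have "AE x in lebesgue. \<forall>n. x \<in> ball 0 (1 / 2) \<longrightarrow> real n \<le> u x" unfolding AE_all_countable by (rule allI)
    then have "AE x in lebesgue. x \<in> - ball (0::'a) (1 / 2)"
    proof eventually_elim
      case (elim x)
      obtain n where "u x < real n" using reals_Archimedean2 by blast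
      then show ?case using elim[rule_format, of n] by (cases "x \<in> ball 0 (1 / 2)") auto
    qed
    then have "(0::'a) \<in> - ball 0 (1 / 2)" by (intro mem_closed_if_AE_lebesgue) auto
    then show False by simp
  qed
  have "0 \<in> ?S" using pos by simp
  then show "0 \<le> ess_inf_on (ball 0 (1 / 2)) u"
    unfolding ess_inf_on_def using bdd by (rule cSup_upper)
  assume m: "ess_inf_on (ball 0 (1 / 2)) u < m"
  show "\<not> (AE x in lebesgue. x \<in> ball 0 (1 / 2) \<longrightarrow> m \<le> u x)"
  proof
    assume "AE x in lebesgue. x \<in> ball 0 (1 / 2) \<longrightarrow> m \<le> u x"
    then have "m \<in> ?S" by simp
    then have "m \<le> ess_inf_on (ball 0 (1 / 2)) u" unfolding ess_inf_on_def using bdd by (rule cSup_upper)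
    then show False using m by simp
  qed
qed

theorem weak_half_harnack:
  fixes u :: "'a \<Rightarrow> real"
  assumes pos: "\<And>x. 0 \<le> u x" and weak: "weak_supersolution s K b C0 (ball 0 1) u"
    and C0: "0 < C0" and b: "s = 1 / 2 \<Longrightarrow> norm b \<le> Lam"
  shows "integrable lebesgue (\<lambda>x. u x / wt x)"
    and "(LINT x|lebesgue. u x / wt x)
      \<le> 4 * (1 + 2 powr N) * harnack_const DIM('a) s lam Lam * (ess_inf_on (ball 0 (1 / 2)) u + C0)"
proof -
  have um: "u \<in> borel_measurable lebesgue" using weak by (simp add: weak_supersolution_def)
  let ?C = "(1 + 2 powr N) * harnack_const DIM('a) s lam Lam"
  have C: "0 \<le> ?C" using harnack_const_pos by (intro mult_nonneg_nonneg) auto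
  have I0: "0 \<le> ess_inf_on (ball 0 (1 / 2)) u" using pos by (rule ess_inf_on_half_ball(1))
  have bd: "mass u
     \<le> ennreal (4 * (1 + 2 powr N) * harnack_const DIM('a) s lam Lam * (m + C0))"
    if m: "ess_inf_on (ball 0 (1 / 2)) u < m" for m
  proof -
    have "mass u
      \<le> ennreal ((1 + 2 powr N) * (harnack_const DIM('a) s lam Lam * (16 / 5 * m + C0)))"
      using ess_inf_on_half_ball(2)[OF pos m] m I0 by (intro weak_bound[OF pos weak C0 b]) auto
    also have "\<dots> \<le> ennreal (4 * (1 + 2 powr N) * harnack_const DIM('a) s lam Lam * (m + C0))"
    proof (rule ennreal_leI)
      have "?C * (16 / 5 * m + C0) \<le> ?C * (4 * (m + C0))"
        using C m I0 C0 by (intro mult_left_mono) auto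
      then show "(1 + 2 powr N) * (harnack_const DIM('a) s lam Lam * (16 / 5 * m + C0))
        \<le> 4 * (1 + 2 powr N) * harnack_const DIM('a) s lam Lam * (m + C0)" by (simp only: mult_ac)
    qed
    finally show ?thesis .
  qed
  have C4: "0 \<le> 4 * (1 + 2 powr N) * harnack_const DIM('a) s lam Lam"
    unfolding mult.assoc by (intro mult_nonneg_nonneg C) (use C in simp_all)
  show "integrable lebesgue (\<lambda>x. u x / wt x)"
    "(LINT x|lebesgue. u x / wt x)
      \<le> 4 * (1 + 2 powr N) * harnack_const DIM('a) s lam Lam * (ess_inf_on (ball 0 (1 / 2)) u + C0)"
    using weighted_integral_le_of_bounds[OF um pos C4 bd I0 C0] by auto
qed

end

theorem theorem3p10:
  fixes s lam Lam :: real
  assumes "0 < s" "s < 1" and "0 < lam" "lam \<le> Lam"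
  shows "\<exists>C>0. \<forall>(K :: 'a::euclidean_space \<Rightarrow> real) (b :: 'a) (u :: 'a \<Rightarrow> real) (C0 :: real).
    admissible_kernel s K \<and>
    (\<forall>y. y \<noteq> 0 \<longrightarrow> lam / norm y powr (real DIM('a) + 2 * s) \<le> K y \<and>
                   K y \<le> Lam / norm y powr (real DIM('a) + 2 * s)) \<and>
    (s = 1 / 2 \<longrightarrow> norm b \<le> Lam) \<and>
    0 < C0 \<and> (\<forall>x. 0 \<le> u x) \<longrightarrow>
    (weak_supersolution s K b C0 (ball 0 1) u \<longrightarrow>
       integrable lebesgue (\<lambda>x. u x / (1 + norm x powr (real DIM('a) + 2 * s))) \<and>
       (LINT x|lebesgue. u x / (1 + norm x powr (real DIM('a) + 2 * s)))
         \<le> C * (ess_inf_on (ball 0 (1 / 2)) u + C0)) \<and>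
    (viscosity_supersolution s K b C0 (ball 0 1) u \<longrightarrow>
       integrable lebesgue (\<lambda>x. u x / (1 + norm x powr (real DIM('a) + 2 * s))) \<and>
       (LINT x|lebesgue. u x / (1 + norm x powr (real DIM('a) + 2 * s)))
         \<le> C * ((INF x \<in> ball 0 (1 / 2). u x) + C0))"
proof -
  let ?N = "real DIM('a) + 2 * s"
  let ?H = "harnack_const DIM('a) s lam Lam"
  let ?C = "4 * (1 + 2 powr ?N) * ?H"
  have kernel: "fractional_kernel s lam Lam ?N K"
    if "admissible_kernel s K" "\<forall>y. y \<noteq> 0 \<longrightarrow> lam / norm y powr ?N \<le> K y \<and> K y \<le> Lam / norm y powr ?N"
    for K :: "'a \<Rightarrow> real"
    using assms elliptic_kernelI[OF that(1) assms(3), of Lam] that(2) by unfold_locales auto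
  show ?thesis
  \<comment> \<open>Positivity of the constant is proved inside \<open>fractional_kernel\<close>,
    which needs a kernel; if there is none, the claim is vacuous and any positive constant will
    do.\<close>
  proof (cases "\<exists>K :: 'a \<Rightarrow> real. admissible_kernel s K \<and> (\<forall>y. y \<noteq> 0 \<longrightarrow> lam / norm y powr ?N \<le> K y \<and> K y \<le> Lam / norm y powr ?N)")
    case False
    then show ?thesis by (intro exI[of _ 1]) auto
  next
    case True
    then have H: "0 < ?H" using kernel fractional_kernel.harnack_const_pos by blast
    have "0 < ?C" using H by (simp add: add_pos_nonneg)
    moreover have "(weak_supersolution s K b C0 (ball 0 1) u \<longrightarrow>
       integrable lebesgue (\<lambda>x. u x / (1 + norm x powr ?N)) \<and>
       (LINT x|lebesgue. u x / (1 + norm x powr ?N)) \<le> ?C * (ess_inf_on (ball 0 (1 / 2)) u + C0)) \<and>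
    (viscosity_supersolution s K b C0 (ball 0 1) u \<longrightarrow>
       integrable lebesgue (\<lambda>x. u x / (1 + norm x powr ?N)) \<and>
       (LINT x|lebesgue. u x / (1 + norm x powr ?N)) \<le> ?C * ((INF x \<in> ball 0 (1 / 2). u x) + C0))"
      if K: "admissible_kernel s K" "\<forall>y. y \<noteq> 0 \<longrightarrow> lam / norm y powr ?N \<le> K y \<and> K y \<le> Lam / norm y powr ?N"
        and b: "s = 1 / 2 \<longrightarrow> norm b \<le> Lam" and C0: "0 < C0" and pos: "\<forall>x. 0 \<le> u x"
      for K :: "'a \<Rightarrow> real" and b u C0
    proof -
      interpret fractional_kernel s lam Lam ?N K using K by (rule kernel)
      have I0: "0 \<le> (INF x \<in> ball 0 (1 / 2). u x)" by (rule cINF_greatest) (use pos in auto)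
      have "4 * ?H * ((INF x \<in> ball 0 (1 / 2). u x) + C0) \<le> ?C * ((INF x \<in> ball 0 (1 / 2). u x) + C0)"
        using H I0 C0 by (intro mult_right_mono) auto
      then show ?thesis
        using weak_half_harnack[of u b C0] viscosity_half_harnack[of u b C0] pos b C0
        by (auto intro: order_trans)
    qed
    ultimately show ?thesis by blast
  qed
qed

end
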